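(* Let $\mathsf{k}$ be a field, $\Gamma$ an abelian group and $R$ a commutative $\mathsf{k}$-semisimple algebra (i.e. a finite product of copies of $\mathsf{k}$), considered as a $\Gamma$-graded algebra concentrated in degree zero. Let $(e,f)=\{(e_u,f_u)\}_{u\in U}$ be a family of pairs of homogeneous idempotents over $R$. Then the graded Bergman algebra $B_R(e,f)$ is $\Gamma$-graded isomorphic to a unital hyper Leavitt path algebra $L_{\mathsf{k}}(H)$ whose grading is induced by a $\Gamma$-weight map. Conversely, any unital hyper Leavitt path algebra $L_{\mathsf{k}}(H)$ whose $\Gamma$-grading is induced by a $\Gamma$-weight map is graded isomorphic to a Bergman algebra $B_R(e,f)$, where $R$ is a commutative $\mathsf{k}$-semisimple algebra concentrated in degree zero and $(e,f)$ is a family of pairs of homogeneous idempotents over $R$.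
   Context: For a $\Gamma$-graded ring $R$ and $\overline\alpha=(\alpha_1,\dots,\alpha_n)\in\Gamma^n$, $\mathbb M_n(R)(\overline\alpha)_0$ is the ring of $n\times n$ matrices whose $(i,j)$-entry lies in $R_{\alpha_j-\alpha_i}$. A family of pairs of homogeneous idempotents consists of idempotents $e_u\in\mathbb M_{m_u}(R)(\overline\beta_u)_0$ and $f_u\in\mathbb M_{n_u}(R)(\overline\gamma_u)_0$, $u\in U$, with $\overline\beta_u=(\beta_{u,1},\dots,\beta_{u,m_u})\in\Gamma^{m_u}$, $\overline\gamma_u=(\gamma_{u,1},\dots,\gamma_{u,n_u})\in\Gamma^{n_u}$. The graded Bergman algebra is $$B_R(e,f)=R\langle h_u,h_u^*\mid u\in U\rangle\big/\langle e_uh_uf_u=h_u,\ f_uh_u^*e_u=h_u^*,\ h_uh_u^*=e_u,\ h_u^*h_u=f_u\mid u\in U\rangle,$$ where $h_u=((h_u)_{ij})$ is an $m_u\times n_u$ matrix and $h_u^*=((h_u^* )_{ji})$ an $n_u\times m_u$ matrix of symbols, $R\langle h_u,h_u^*\rangle$ is the free product over $\mathsf{k}$ of $R$ with the free $\mathsf{k}$-algebra on these symbols, the matrix relations mean the corresponding entrywise relations, and $\deg (h_u)_{ij}=\gamma_{u,j}-\beta_{u,i}$, $\deg(h_u^* )_{ji}=\beta_{u,i}-\gamma_{u,j}$. A hypergraph is $H=(H^0,H^1,s,r)$ where $H^0,H^1$ are sets and $s,r$ associate to each $h\in H^1$ non-empty families $s(h)=(s(h)_i)_{i\in I_h}$,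 $r(h)=(r(h)_j)_{j\in J_h}$ of elements of $H^0$; the sets $I_h,J_h$ are assumed finite. The hyper Leavitt path algebra $L_{\mathsf{k}}(H)$ is the (not necessarily unital) $\mathsf{k}$-algebra with generators $v,h_{ij},h_{ij}^*$ ($v\in H^0,h\in H^1,i\in I_h,j\in J_h$) and relations: (i) $uv=\delta_{uv}u$ for $u,v\in H^0$; (ii) $s(h)_ih_{ij}=h_{ij}=h_{ij}r(h)_j$, $r(h)_jh_{ij}^*=h_{ij}^*=h_{ij}^*s(h)_i$; (iii) $\sum_{j\in J_h}h_{ij}h_{i'j}^*=\delta_{ii'}s(h)_i$; (iv) $\sum_{i\in I_h}h_{ij}^*h_{ij'}=\delta_{jj'}r(h)_j$. Choose $i_h\in I_h$, $j_h\in J_h$ for each $h$. A $\Gamma$-weight map for $H$ is a map $w$ assigning to each generator $h_{ij}$ an element of $\Gamma$ such that $w(h_{ij})=w(h_{ij_h})-w(h_{i_hj_h})+w(h_{i_hj})$ for all $h,i,j$; it induces a $\Gamma$-grading on $L_{\mathsf{k}}(H)$ with $\deg(v)=0$, $\deg(h_{ij})=w(h_{ij})$, $\deg(h_{ij}^* )=-w(h_{ij})$. *)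

theory Defs
  imports
    "HOL-Algebra.Algebra"
    "HOL-Algebra.Algebraic_Closure_Type"
    "HOL-Library.Poly_Mapping"
begin

text \<open>
  Not necessarily unital \<open>k\<close>-algebras over a field \<open>'k\<close> are carried by the record
  \<^typ>\<open>('k, 'a) module\<close> of HOL-Algebra. In an algebra that need not be unital
  the field \<^const>\<open>one\<close> is a dummy (it may lie outside the carrier); this is why \<open>algebra_iso\<close> and
  \<open>unital\<close> ignore it.
\<close>

subsection \<open>Isomorphisms, units and gradings\<close>

definition algebra_iso :: "('k, 'a) module \<Rightarrow> ('k, 'b) module \<Rightarrow> ('a \<Rightarrow> 'b) \<Rightarrow> bool" where
  "algebra_iso A B \<phi> \<longleftrightarrow>
     bij_betw \<phi> (carrier A) (carrier B) \<and>
     (\<forall>x\<in>carrier A. \<forall>y\<in>carrier A. \<phi> (x \<oplus>\<^bsub>A\<^esub> y) = \<phi> x \<oplus>\<^bsub>B\<^esub> \<phi> y) \<and>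
     (\<forall>x\<in>carrier A. \<forall>y\<in>carrier A. \<phi> (x \<otimes>\<^bsub>A\<^esub> y) = \<phi> x \<otimes>\<^bsub>B\<^esub> \<phi> y) \<and>
     (\<forall>c. \<forall>x\<in>carrier A. \<phi> (c \<odot>\<^bsub>A\<^esub> x) = c \<odot>\<^bsub>B\<^esub> \<phi> x)"

definition unital :: "('k, 'a) module \<Rightarrow> bool" where
  "unital A \<longleftrightarrow> (\<exists>u\<in>carrier A. \<forall>x\<in>carrier A. u \<otimes>\<^bsub>A\<^esub> x = x \<and> x \<otimes>\<^bsub>A\<^esub> u = x)"

text \<open>
  The last conjunct says that \<open>A\<close> is the internal direct sum of the components \<open>G \<gamma>\<close>.
\<close>

definition algebra_grading :: "('k, 'a) module \<Rightarrow> ('g::ab_group_add \<Rightarrow> 'a set) \<Rightarrow> bool" where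
  "algebra_grading A G \<longleftrightarrow>
     (\<forall>\<gamma>. G \<gamma> \<subseteq> carrier A \<and> \<zero>\<^bsub>A\<^esub> \<in> G \<gamma> \<and>
        (\<forall>x\<in>G \<gamma>. \<forall>y\<in>G \<gamma>. x \<oplus>\<^bsub>A\<^esub> y \<in> G \<gamma>) \<and> (\<forall>c. \<forall>x\<in>G \<gamma>. c \<odot>\<^bsub>A\<^esub> x \<in> G \<gamma>)) \<and>
     (\<forall>\<gamma> \<delta>. \<forall>x\<in>G \<gamma>. \<forall>y\<in>G \<delta>. x \<otimes>\<^bsub>A\<^esub> y \<in> G (\<gamma> + \<delta>)) \<and>
     (\<forall>x\<in>carrier A. \<exists>!f. (\<forall>\<gamma>. f \<gamma> \<in> G \<gamma>) \<and> finite {\<gamma>. f \<gamma> \<noteq> \<zero>\<^bsub>A\<^esub>} \<and>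
        x = finsum A f {\<gamma>. f \<gamma> \<noteq> \<zero>\<^bsub>A\<^esub>})"

definition graded_isomorphic ::
  "('k, 'a) module \<Rightarrow> ('g::ab_group_add \<Rightarrow> 'a set) \<Rightarrow> ('k, 'b) module \<Rightarrow> ('g \<Rightarrow> 'b set) \<Rightarrow> bool" where
  "graded_isomorphic A G B G' \<longleftrightarrow>
     algebra_grading A G \<and> algebra_grading B G' \<and>
     (\<exists>\<phi>. algebra_iso A B \<phi> \<and> (\<forall>\<gamma>. \<phi> ` G \<gamma> = G' \<gamma>))"

definition concentrated_in_zero :: "('k, 'a) module \<Rightarrow> 'g::ab_group_add \<Rightarrow> 'a set" where
  "concentrated_in_zero A \<gamma> = (if \<gamma> = 0 then carrier A else {\<zero>\<^bsub>A\<^esub>})"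

subsection \<open>Commutative semisimple algebras\<close>

definition power_algebra :: "nat \<Rightarrow> ('k::field, nat \<Rightarrow> 'k) module" where
  "power_algebra n =
     \<lparr>carrier = {..<n} \<rightarrow>\<^sub>E UNIV,
      monoid.mult = (\<lambda>f g. \<lambda>l\<in>{..<n}. f l * g l),
      monoid.one = (\<lambda>l\<in>{..<n}. 1),
      ring.zero = (\<lambda>l\<in>{..<n}. 0),
      ring.add = (\<lambda>f g. \<lambda>l\<in>{..<n}. f l + g l),
      module.smult = (\<lambda>c f. \<lambda>l\<in>{..<n}. c * f l)\<rparr>"

text \<open>
  The empty product is allowed, so the zero algebra is semisimple. It is the Leavitt path algebra of
  the empty hypergraph, and it also arises as a Bergman algebra when some \<open>e\<^sub>u = 0\<close> and \<open>f\<^sub>u = 1\<close>.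
\<close>

definition comm_semisimple :: "('k::field, 'r) module \<Rightarrow> bool" where
  "comm_semisimple R \<longleftrightarrow>
     algebra (ring_of_type_algebra :: 'k ring) R \<and>
     (\<exists>n \<phi>. \<phi> \<in> ring_iso R (power_algebra n) \<and> algebra_iso R (power_algebra n) \<phi>)"

subsection \<open>Free algebras, ideals and quotients\<close>

text \<open>
  The free monoid, written additively because multiplication of \<^typ>\<open>'a \<Rightarrow>\<^sub>0 'b\<close> is convolution
  with respect to an additive monoid of exponents. Thus \<open>'x word \<Rightarrow>\<^sub>0 'k\<close> is the free unital
  algebra on all of \<open>'x\<close>.
\<close>

datatype 'x word = Word (letters: "'x list")

instantiation word :: (type) monoid_add
begin

definition zero_word :: "'x word" where "zero_word = Word []"

definition plus_word :: "'x word \<Rightarrow> 'x word \<Rightarrow> 'x word" where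
  "plus_word v w = Word (letters v @ letters w)"

instance by standard (simp_all add: zero_word_def plus_word_def)

end

definition gen :: "'x \<Rightarrow> 'x word \<Rightarrow>\<^sub>0 'k::field" where
  "gen x = Poly_Mapping.single (Word [x]) 1"

definition scale :: "'k::field \<Rightarrow> ('x word \<Rightarrow>\<^sub>0 'k) \<Rightarrow> ('x word \<Rightarrow>\<^sub>0 'k)" where
  "scale c p = Poly_Mapping.single 0 c * p"

definition free_algebra :: "'x set \<Rightarrow> ('k::field, 'x word \<Rightarrow>\<^sub>0 'k) module" where
  "free_algebra Y =
     \<lparr>carrier = {p. \<forall>w\<in>Poly_Mapping.keys p. set (letters w) \<subseteq> Y},
      monoid.mult = (*), monoid.one = 1, ring.zero = 0, ring.add = (+), module.smult = scale\<rparr>"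

definition free_nonunital_algebra :: "'x set \<Rightarrow> ('k::field, 'x word \<Rightarrow>\<^sub>0 'k) module" where
  "free_nonunital_algebra Y =
     (free_algebra Y)\<lparr>carrier := {p \<in> carrier (free_algebra Y). Poly_Mapping.lookup p 0 = 0}\<rparr>"

definition algebra_ideal :: "('k, 'a) module \<Rightarrow> 'a set \<Rightarrow> bool" where
  "algebra_ideal A I \<longleftrightarrow>
     I \<subseteq> carrier A \<and> \<zero>\<^bsub>A\<^esub> \<in> I \<and>
     (\<forall>x\<in>I. \<forall>y\<in>I. x \<oplus>\<^bsub>A\<^esub> y \<in> I) \<and>
     (\<forall>c. \<forall>x\<in>I. c \<odot>\<^bsub>A\<^esub> x \<in> I) \<and>
     (\<forall>a\<in>carrier A. \<forall>x\<in>I. a \<otimes>\<^bsub>A\<^esub> x \<in> I \<and> x \<otimes>\<^bsub>A\<^esub> a \<in> I)"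

definition generated_ideal :: "('k, 'a) module \<Rightarrow> 'a set \<Rightarrow> 'a set" where
  "generated_ideal A S = \<Inter>{I. algebra_ideal A I \<and> S \<subseteq> I}"

definition quotient_algebra :: "('k, 'a) module \<Rightarrow> 'a set \<Rightarrow> ('k, 'a set) module" where
  "quotient_algebra A I =
     ring.extend (A Quot I) (module.fields (\<lambda>c Y. \<Union>x\<in>Y. I +>\<^bsub>A\<^esub> (c \<odot>\<^bsub>A\<^esub> x)))"

text \<open>
  The grading of a quotient of a free algebra \<open>A\<close> induced by degrees of the generators:
  the component of degree \<open>\<delta>\<close> is the image of the span of all words of degree \<open>\<delta>\<close>. The set
  \<open>d x\<close> consists of all degrees of the generator \<open>x\<close>; it can be empty (\<open>x\<close> not homogeneous) or
  have several elements (\<open>x\<close> represents zero).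
\<close>

fun word_degrees :: "('x \<Rightarrow> 'g::ab_group_add set) \<Rightarrow> 'x list \<Rightarrow> 'g set" where
  "word_degrees d [] = {0}"
| "word_degrees d (x # xs) = {\<gamma> + \<delta> | \<gamma> \<delta>. \<gamma> \<in> d x \<and> \<delta> \<in> word_degrees d xs}"

definition induced_grading ::
  "('k::field, 'x word \<Rightarrow>\<^sub>0 'k) module \<Rightarrow> ('x word \<Rightarrow>\<^sub>0 'k) set \<Rightarrow> ('x \<Rightarrow> 'g::ab_group_add set) \<Rightarrow>
   'g \<Rightarrow> ('x word \<Rightarrow>\<^sub>0 'k) set set" where
  "induced_grading A I d \<delta> =
     (\<lambda>p. I +>\<^bsub>A\<^esub> p) ` {p \<in> carrier A. \<forall>w\<in>Poly_Mapping.keys p. \<delta> \<in> word_degrees d (letters w)}"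

subsection \<open>Graded Bergman algebras\<close>

text \<open>
  All matrix indices start at 0. Entries of the matrices outside the index range are irrelevant.
\<close>

record ('g, 'u, 'r) idempotent_pairs =
  index :: "'u set"
  rows :: "'u \<Rightarrow> nat"
  cols :: "'u \<Rightarrow> nat"
  row_deg :: "'u \<Rightarrow> nat \<Rightarrow> 'g"
  col_deg :: "'u \<Rightarrow> nat \<Rightarrow> 'g"
  emat :: "'u \<Rightarrow> nat \<Rightarrow> nat \<Rightarrow> 'r"
  fmat :: "'u \<Rightarrow> nat \<Rightarrow> nat \<Rightarrow> 'r"

definition homogeneous_idempotent ::
  "('k, 'r) module \<Rightarrow> ('g::ab_group_add \<Rightarrow> 'r set) \<Rightarrow> nat \<Rightarrow> (nat \<Rightarrow> 'g) \<Rightarrow> (nat \<Rightarrow> nat \<Rightarrow> 'r) \<Rightarrow> bool" where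
  "homogeneous_idempotent R G n \<alpha> x \<longleftrightarrow>
     (\<forall>i<n. \<forall>j<n. x i j \<in> G (\<alpha> j - \<alpha> i)) \<and>
     (\<forall>i<n. \<forall>j<n. (\<Oplus>\<^bsub>R\<^esub>l\<in>{..<n}. x i l \<otimes>\<^bsub>R\<^esub> x l j) = x i j)"

definition homogeneous_idempotent_pairs ::
  "('k, 'r) module \<Rightarrow> ('g::ab_group_add \<Rightarrow> 'r set) \<Rightarrow> ('g, 'u, 'r) idempotent_pairs \<Rightarrow> bool" where
  "homogeneous_idempotent_pairs R G F \<longleftrightarrow>
     (\<forall>u\<in>index F. 0 < rows F u \<and> 0 < cols F u \<and>
        homogeneous_idempotent R G (rows F u) (row_deg F u) (emat F u) \<and>
        homogeneous_idempotent R G (cols F u) (col_deg F u) (fmat F u))"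

text \<open>\<open>Sym u i j\<close> is \<open>(h\<^sub>u)\<^sub>i\<^sub>j\<close> and \<open>SymStar u j i\<close> is \<open>(h\<^sub>u\<^sup>*)\<^sub>j\<^sub>i\<close>.\<close>

datatype ('r, 'u) bergman_gen = Coef 'r | Sym 'u nat nat | SymStar 'u nat nat

definition bergman_free_algebra ::
  "('k::field, 'r) module \<Rightarrow> ('g, 'u, 'r) idempotent_pairs \<Rightarrow>
   ('k, ('r, 'u) bergman_gen word \<Rightarrow>\<^sub>0 'k) module" where
  "bergman_free_algebra R F = free_algebra
     (Coef ` carrier R \<union>
      {Sym u i j | u i j. u \<in> index F \<and> i < rows F u \<and> j < cols F u} \<union>
      {SymStar u j i | u i j. u \<in> index F \<and> i < rows F u \<and> j < cols F u})"

text \<open>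
  Dividing \<^const>\<open>bergman_free_algebra\<close> by these relations turns it into the free product over \<open>k\<close>
  of \<open>R\<close> with the free algebra on the symbols.
\<close>

definition coefficient_relations ::
  "('k::field, 'r) module \<Rightarrow> (('r, 'u) bergman_gen word \<Rightarrow>\<^sub>0 'k) set" where
  "coefficient_relations R =
     {gen (Coef (r \<oplus>\<^bsub>R\<^esub> s)) - (gen (Coef r) + gen (Coef s)) | r s. r \<in> carrier R \<and> s \<in> carrier R} \<union>
     {gen (Coef (r \<otimes>\<^bsub>R\<^esub> s)) - gen (Coef r) * gen (Coef s) | r s. r \<in> carrier R \<and> s \<in> carrier R} \<union>
     {gen (Coef (c \<odot>\<^bsub>R\<^esub> r)) - scale c (gen (Coef r)) | c r. r \<in> carrier R} \<union>
     {gen (Coef \<one>\<^bsub>R\<^esub>) - 1}"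

definition bergman_relations ::
  "('g, 'u, 'r) idempotent_pairs \<Rightarrow> (('r, 'u) bergman_gen word \<Rightarrow>\<^sub>0 'k::field) set" where
  "bergman_relations F = (\<Union>u\<in>index F.
     let m = rows F u; n = cols F u;
         e = (\<lambda>i j. gen (Coef (emat F u i j))); f = (\<lambda>i j. gen (Coef (fmat F u i j)));
         h = (\<lambda>i j. gen (Sym u i j)); hs = (\<lambda>j i. gen (SymStar u j i))
     in {(\<Sum>a<m. \<Sum>b<n. e i a * h a b * f b j) - h i j | i j. i < m \<and> j < n} \<union>
        {(\<Sum>b<n. \<Sum>a<m. f j b * hs b a * e a i) - hs j i | i j. i < m \<and> j < n} \<union>
        {(\<Sum>b<n. h i b * hs b i') - e i i' | i i'. i < m \<and> i' < m} \<union>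
        {(\<Sum>a<m. hs j a * h a j') - f j j' | j j'. j < n \<and> j' < n})"

definition bergman_ideal ::
  "('k::field, 'r) module \<Rightarrow> ('g, 'u, 'r) idempotent_pairs \<Rightarrow>
   (('r, 'u) bergman_gen word \<Rightarrow>\<^sub>0 'k) set" where
  "bergman_ideal R F =
     generated_ideal (bergman_free_algebra R F) (coefficient_relations R \<union> bergman_relations F)"

definition bergman_algebra ::
  "('k::field, 'r) module \<Rightarrow> ('g, 'u, 'r) idempotent_pairs \<Rightarrow>
   ('k, (('r, 'u) bergman_gen word \<Rightarrow>\<^sub>0 'k) set) module" where
  "bergman_algebra R F = quotient_algebra (bergman_free_algebra R F) (bergman_ideal R F)"

fun bergman_degree ::
  "('g::ab_group_add \<Rightarrow> 'r set) \<Rightarrow> ('g, 'u, 'r) idempotent_pairs \<Rightarrow> ('r, 'u) bergman_gen \<Rightarrow> 'g set" where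
  "bergman_degree G F (Coef r) = {\<gamma>. r \<in> G \<gamma>}"
| "bergman_degree G F (Sym u i j) = {col_deg F u j - row_deg F u i}"
| "bergman_degree G F (SymStar u j i) = {row_deg F u i - col_deg F u j}"

definition bergman_grading ::
  "('k::field, 'r) module \<Rightarrow> ('g::ab_group_add \<Rightarrow> 'r set) \<Rightarrow> ('g, 'u, 'r) idempotent_pairs \<Rightarrow>
   'g \<Rightarrow> (('r, 'u) bergman_gen word \<Rightarrow>\<^sub>0 'k) set set" where
  "bergman_grading R G F =
     induced_grading (bergman_free_algebra R F) (bergman_ideal R F) (bergman_degree G F)"

subsection \<open>Hyper Leavitt path algebras\<close>

record ('v, 'e, 'i, 'j) hypergraph =
  vertices :: "'v set"
  hyperedges :: "'e set"
  src_index :: "'e \<Rightarrow> 'i set"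
  rng_index :: "'e \<Rightarrow> 'j set"
  src :: "'e \<Rightarrow> 'i \<Rightarrow> 'v"
  rng :: "'e \<Rightarrow> 'j \<Rightarrow> 'v"

definition is_hypergraph :: "('v, 'e, 'i, 'j) hypergraph \<Rightarrow> bool" where
  "is_hypergraph H \<longleftrightarrow>
     (\<forall>h\<in>hyperedges H.
        finite (src_index H h) \<and> src_index H h \<noteq> {} \<and>
        finite (rng_index H h) \<and> rng_index H h \<noteq> {} \<and>
        (\<forall>i\<in>src_index H h. src H h i \<in> vertices H) \<and>
        (\<forall>j\<in>rng_index H h. rng H h j \<in> vertices H))"

text \<open>\<open>Edge h i j\<close> is \<open>h\<^sub>i\<^sub>j\<close> and \<open>EdgeStar h i j\<close> is \<open>h\<^sub>i\<^sub>j\<^sup>*\<close>.\<close>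

datatype ('v, 'e, 'i, 'j) leavitt_gen = Vertex 'v | Edge 'e 'i 'j | EdgeStar 'e 'i 'j

definition leavitt_free_algebra ::
  "('v, 'e, 'i, 'j) hypergraph \<Rightarrow>
   ('k::field, ('v, 'e, 'i, 'j) leavitt_gen word \<Rightarrow>\<^sub>0 'k) module" where
  "leavitt_free_algebra H = free_nonunital_algebra
     (Vertex ` vertices H \<union>
      {Edge h i j | h i j. h \<in> hyperedges H \<and> i \<in> src_index H h \<and> j \<in> rng_index H h} \<union>
      {EdgeStar h i j | h i j. h \<in> hyperedges H \<and> i \<in> src_index H h \<and> j \<in> rng_index H h})"

definition leavitt_relations ::
  "('v, 'e, 'i, 'j) hypergraph \<Rightarrow> (('v, 'e, 'i, 'j) leavitt_gen word \<Rightarrow>\<^sub>0 'k::field) set" where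
  "leavitt_relations H =
     {gen (Vertex u) * gen (Vertex v) - (if u = v then gen (Vertex u) else 0) | u v.
        u \<in> vertices H \<and> v \<in> vertices H} \<union>
     (\<Union>h\<in>hyperedges H.
        let I = src_index H h; J = rng_index H h;
            s = (\<lambda>i. gen (Vertex (src H h i))); r = (\<lambda>j. gen (Vertex (rng H h j)));
            x = (\<lambda>i j. gen (Edge h i j)); xs = (\<lambda>i j. gen (EdgeStar h i j))
        in {s i * x i j - x i j | i j. i \<in> I \<and> j \<in> J} \<union>
           {x i j * r j - x i j | i j. i \<in> I \<and> j \<in> J} \<union>
           {r j * xs i j - xs i j | i j. i \<in> I \<and> j \<in> J} \<union>
           {xs i j * s i - xs i j | i j. i \<in> I \<and> j \<in> J} \<union>
           {(\<Sum>j\<in>J. x i j * xs i' j) - (if i = i' then s i else 0) | i i'. i \<in> I \<and> i' \<in> I} \<union>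
           {(\<Sum>i\<in>I. xs i j * x i j') - (if j = j' then r j else 0) | j j'. j \<in> J \<and> j' \<in> J})"

definition leavitt_ideal ::
  "('v, 'e, 'i, 'j) hypergraph \<Rightarrow> (('v, 'e, 'i, 'j) leavitt_gen word \<Rightarrow>\<^sub>0 'k::field) set" where
  "leavitt_ideal H = generated_ideal (leavitt_free_algebra H) (leavitt_relations H)"

definition hyper_leavitt_algebra ::
  "('v, 'e, 'i, 'j) hypergraph \<Rightarrow>
   ('k::field, (('v, 'e, 'i, 'j) leavitt_gen word \<Rightarrow>\<^sub>0 'k) set) module" where
  "hyper_leavitt_algebra H = quotient_algebra (leavitt_free_algebra H) (leavitt_ideal H)"

text \<open>The functions \<open>i0\<close> and \<open>j0\<close> are the chosen indices \<open>i\<^sub>h\<close> and \<open>j\<^sub>h\<close>.\<close>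

definition weight_map ::
  "('v, 'e, 'i, 'j) hypergraph \<Rightarrow> ('e \<Rightarrow> 'i) \<Rightarrow> ('e \<Rightarrow> 'j) \<Rightarrow>
   ('e \<Rightarrow> 'i \<Rightarrow> 'j \<Rightarrow> 'g::ab_group_add) \<Rightarrow> bool" where
  "weight_map H i0 j0 w \<longleftrightarrow>
     (\<forall>h\<in>hyperedges H. i0 h \<in> src_index H h \<and> j0 h \<in> rng_index H h \<and>
        (\<forall>i\<in>src_index H h. \<forall>j\<in>rng_index H h.
           w h i j = w h i (j0 h) - w h (i0 h) (j0 h) + w h (i0 h) j))"

fun leavitt_degree ::
  "('e \<Rightarrow> 'i \<Rightarrow> 'j \<Rightarrow> 'g::ab_group_add) \<Rightarrow> ('v, 'e, 'i, 'j) leavitt_gen \<Rightarrow> 'g set" where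
  "leavitt_degree w (Vertex v) = {0}"
| "leavitt_degree w (Edge h i j) = {w h i j}"
| "leavitt_degree w (EdgeStar h i j) = {- w h i j}"

definition leavitt_grading ::
  "('v, 'e, 'i, 'j) hypergraph \<Rightarrow> ('e \<Rightarrow> 'i \<Rightarrow> 'j \<Rightarrow> 'g::ab_group_add) \<Rightarrow>
   'g \<Rightarrow> (('v, 'e, 'i, 'j) leavitt_gen word \<Rightarrow>\<^sub>0 'k::field) set set" where
  "leavitt_grading H w =
     induced_grading (leavitt_free_algebra H) (leavitt_ideal H) (leavitt_degree w)"

end

theory Submission
  imports Defs "HOL-Library.Function_Algebras" "HOL-Library.Countable_Set"
begin

text \<open>
  Over \<open>R = k\<^sup>n\<close> an idempotent matrix is a tuple of idempotent matrices over \<open>k\<close>, and each of these factors as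
  \<open>P Q\<close> with \<open>Q P = 1\<close>, where the columns of \<open>P\<close> and the rows of \<open>Q\<close> are supported in a single degree. So
  \<open>e\<^sub>u\<close> and \<open>f\<^sub>u\<close> amount to finite families of the \<open>n\<close> coordinates, the vertices of the hypergraph, and
  \<open>h\<^sub>u \<mapsto> P x Q'\<close> with inverse \<open>x \<mapsto> Q h\<^sub>u P'\<close> translates the Bergman relations into the Leavitt relations. If
  exactly one of \<open>e\<^sub>u\<close> and \<open>f\<^sub>u\<close> vanishes, one of the two families is empty and vertices become zero;
  discarding all vertices that are zero in the algebra leaves a proper hypergraph. Conversely the idempotents
  attached to a hypergraph with finitely many vertices are diagonal, and a unital Leavitt path algebra has
  finitely many vertices because its vertices are nonzero orthogonal idempotents.
\<close>

section \<open>Modules and algebras over a field\<close>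

text \<open>The Bergman algebra is unital by presentation, while the Leavitt path algebra is
  presented without a unit. Both are compared with a third algebra,
  \<open>unital_leavitt_algebra\<close>, whose relations also say that \<open>1\<close> is the sum
  of the vertices. For finitely many vertices this costs nothing, because that sum already is a
  unit. Elements need no normal form: isomorphisms come from substitutions that are mutually inverse
  modulo the relations, and the nonvanishing of vertices comes from a representation. The grading
  needs a proof of its own, since the images of the spans of homogeneous words need not form a
  direct sum in a quotient. Directness is shown only for \<open>unital_leavitt_algebra\<close>,
  where every generator has exactly one degree and the weight condition makes the relations
  homogeneous. Isomorphisms that match components carry it to the other algebras. In the Bergman
  algebra the direct argument meets the generator \<open>Coef\<close> of zero, which has every
  degree.\<close>

locale k_module =
  fixes sm :: "'k::field \<Rightarrow> 'm::ab_group_add \<Rightarrow> 'm"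
  assumes sm_add_right: "sm c (x + y) = sm c x + sm c y"
    and sm_add_left: "sm (c + d) x = sm c x + sm d x"
    and sm_sm: "sm c (sm d x) = sm (c * d) x"
    and sm_one: "sm 1 x = x"
begin

lemma sm_zero_right: "sm c 0 = 0"
  using sm_add_right[of c 0 0] by simp

lemma sm_zero_left: "sm 0 x = 0"
  using sm_add_left[of 0 0 x] by simp

lemma sm_sum_right: "sm c (sum f A) = (\<Sum>a\<in>A. sm c (f a))"
  by (induction A rule: infinite_finite_induct) (simp_all add: sm_zero_right sm_add_right)

lemma sm_sum_left: "sm (sum f A) x = (\<Sum>a\<in>A. sm (f a) x)"
  by (induction A rule: infinite_finite_induct) (simp_all add: sm_zero_left sm_add_left)

end

locale k_algebra = k_module sm for sm :: "'k::field \<Rightarrow> 'a::ring_1 \<Rightarrow> 'a" +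
  assumes sm_mult_left: "sm c x * y = sm c (x * y)"
    and sm_mult_right: "x * sm c y = sm c (x * y)"

section \<open>Free algebras and their actions\<close>

lemma poly_mapping_sum_singles:
  "(\<Sum>w\<in>Poly_Mapping.keys p. Poly_Mapping.single w (Poly_Mapping.lookup p w)) = p"
proof (rule poly_mapping_eqI)
  fix k
  show "Poly_Mapping.lookup
      (\<Sum>w\<in>Poly_Mapping.keys p. Poly_Mapping.single w (Poly_Mapping.lookup p w)) k =
      Poly_Mapping.lookup p k"
    by (simp add: lookup_sum lookup_single when_def in_keys_iff)
qed

lemma poly_mapping_single_induct [case_names single add]:
  assumes single: "\<And>w c. P (Poly_Mapping.single w c)"
    and add: "\<And>p q. P p \<Longrightarrow> P q \<Longrightarrow> P (p + q)"
  shows "P (p :: 'w \<Rightarrow>\<^sub>0 'k::comm_monoid_add)"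
proof -
  have "P (\<Sum>w\<in>W. Poly_Mapping.single w (Poly_Mapping.lookup p w))" if "finite W" for W
    using that
  proof (induction W)
    case empty
    \<comment> \<open>Zero is a monomial with coefficient zero, at any exponent.\<close>
    show ?case using single[of undefined 0] by simp
  qed (simp add: single add)
  from this[of "Poly_Mapping.keys p"] show ?thesis
    by (simp add: poly_mapping_sum_singles)
qed

section \<open>Words and monomials of the free algebra\<close>

lemma Word_Nil: "Word [] = 0"
  by (simp add: zero_word_def)

lemma letters_zero [simp]: "letters 0 = []"
  by (simp add: zero_word_def)

lemma letters_plus [simp]: "letters (v + w) = letters v @ letters w"
  by (simp add: plus_word_def)

lemma word_eq_zero_iff: "w = 0 \<longleftrightarrow> letters w = []"
  by (cases w) (simp add: zero_word_def)

lemma single_Cons: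
  "Poly_Mapping.single (Word (x # xs)) c = gen x * Poly_Mapping.single (Word xs) c"
  by (simp add: gen_def mult_single plus_word_def)

lemma single_snoc:
  "Poly_Mapping.single (Word (xs @ [x])) c = Poly_Mapping.single (Word xs) c * gen x"
  by (simp add: gen_def mult_single plus_word_def)

text \<open>The empty word commutes with every word, so constants are central as soon as
  coefficients commute. This makes \<open>scale\<close> compatible with products on both
  sides.\<close>

lemma single_zero_central:
  "p * Poly_Mapping.single 0 c = Poly_Mapping.single 0 c * (p :: 'w::monoid_add \<Rightarrow>\<^sub>0 'k::comm_ring_1)"
  by (induction p rule: poly_mapping_single_induct)
    (simp_all add: mult_single mult.commute distrib_left distrib_right)

lemma k_algebra_scale: "k_algebra scale"
proof
  fix c d :: "'k::field" and x y :: "'x word \<Rightarrow>\<^sub>0 'k"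
  show "scale c (x + y) = scale c x + scale c y"
    by (simp add: scale_def distrib_left)
  show "scale (c + d) x = scale c x + scale d x"
    by (simp add: scale_def distrib_right single_add)
  show "scale c (scale d x) = scale (c * d) x"
    by (simp add: scale_def mult.assoc[symmetric] mult_single)
  show "scale 1 x = x"
    by (simp add: scale_def)
  show "scale c x * y = scale c (x * y)"
    by (simp add: scale_def mult.assoc)
  show "x * scale c y = scale c (x * y)"
    by (simp add: scale_def mult.assoc[symmetric] single_zero_central)
qed

interpretation scale: k_algebra scale
  by (rule k_algebra_scale)

lemma scale_single: "scale c (Poly_Mapping.single w d) = Poly_Mapping.single w (c * d)"
  by (simp add: scale_def mult_single)

lemma lookup_scale: "Poly_Mapping.lookup (scale c p) w = c * Poly_Mapping.lookup p w"
  by (induction p rule: poly_mapping_single_induct)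
    (simp_all add: scale_single lookup_single when_def scale.sm_add_right lookup_add distrib_left)

lemma single_eq_scale: "Poly_Mapping.single 0 c = scale c 1"
  by (simp add: scale_def)

lemma keys_scale: "Poly_Mapping.keys (scale c p) \<subseteq> Poly_Mapping.keys p"
  by (auto simp: in_keys_iff lookup_scale)

text \<open>The action of the free algebra determined by one operator per letter. It has two uses:
  left multiplications yield substitution homomorphisms, and operators on functions yield the
  representation that keeps vertices away from zero. \<open>foldr\<close> lets the last letter of a
  word act before the others, as a left action must.\<close>

definition act :: "('k::field \<Rightarrow> 'm \<Rightarrow> 'm::ab_group_add) \<Rightarrow> ('x \<Rightarrow> 'm \<Rightarrow> 'm) \<Rightarrow> ('x word \<Rightarrow>\<^sub>0 'k) \<Rightarrow> 'm \<Rightarrow> 'm"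
  where "act sm ope p m =
    (\<Sum>w\<in>Poly_Mapping.keys p. sm (Poly_Mapping.lookup p w) (foldr ope (letters w) m))"

locale word_action = k_module sm for sm :: "'k::field \<Rightarrow> 'm::ab_group_add \<Rightarrow> 'm" +
  fixes ope :: "'x \<Rightarrow> 'm \<Rightarrow> 'm"
  assumes ope_add: "ope x (m + n) = ope x m + ope x n"
    and ope_sm: "ope x (sm c m) = sm c (ope x m)"
begin

lemma foldr_ope_add: "foldr ope xs (m + n) = foldr ope xs m + foldr ope xs n"
  by (induction xs) (simp_all add: ope_add)

lemma foldr_ope_sm: "foldr ope xs (sm c m) = sm c (foldr ope xs m)"
  by (induction xs) (simp_all add: ope_sm)

lemma act_superset:
  assumes "finite W" "Poly_Mapping.keys p \<subseteq> W"
  shows "act sm ope p m = (\<Sum>w\<in>W. sm (Poly_Mapping.lookup p w) (foldr ope (letters w) m))"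
  unfolding act_def
  by (rule sum.mono_neutral_left) (use assms in \<open>auto simp: in_keys_iff sm_zero_left\<close>)

lemma act_add: "act sm ope (p + q) m = act sm ope p m + act sm ope q m"
proof -
  let ?W = "Poly_Mapping.keys p \<union> Poly_Mapping.keys q"
  have "Poly_Mapping.keys (p + q) \<subseteq> ?W" by (rule keys_add)
  then show ?thesis
    by (simp add: act_superset[of ?W] lookup_add sm_add_left sum.distrib)
qed

lemma act_single: "act sm ope (Poly_Mapping.single w c) m = sm c (foldr ope (letters w) m)"
  by (subst act_superset[of "{w}"]) simp_all

lemma act_zero: "act sm ope 0 m = 0"
  by (simp add: act_def)

lemma act_minus: "act sm ope (- p) m = - act sm ope p m"
  using act_add[of p "- p" m] by (simp add: act_zero add_eq_0_iff)

lemma act_diff: "act sm ope (p - q) m = act sm ope p m - act sm ope q m"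
  using act_add[of p "- q" m] by (simp add: act_minus)

lemma act_sum: "act sm ope (sum f A) m = (\<Sum>a\<in>A. act sm ope (f a) m)"
  by (induction A rule: infinite_finite_induct) (simp_all add: act_zero act_add)

lemma act_one: "act sm ope 1 m = m"
  using act_single[of 0 1 m] by (simp add: sm_one)

lemma act_gen: "act sm ope (gen x) m = ope x m"
  by (simp add: gen_def act_single sm_one)

lemma act_add_right: "act sm ope p (m + n) = act sm ope p m + act sm ope p n"
  by (simp add: act_def foldr_ope_add sm_add_right sum.distrib)

lemma act_mult: "act sm ope (p * q) m = act sm ope p (act sm ope q m)"
proof (induction p rule: poly_mapping_single_induct)
  case (single v c)
  show ?case
  proof (induction q rule: poly_mapping_single_induct)
    case (single w d)
    show ?case
      by (simp add: mult_single act_single foldr_ope_sm sm_sm)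
  qed (simp add: distrib_left act_add act_add_right)
qed (simp add: distrib_right act_add)

lemma act_scale: "act sm ope (scale c p) m = sm c (act sm ope p m)"
  by (simp add: scale_def act_mult act_single)

lemma act_zero_right: "act sm ope p 0 = 0"
  using act_add_right[of p 0 0] by simp

end

text \<open>The algebra homomorphism prescribed on letters by \<open>t\<close>, read off as the
  image of \<open>1\<close> when letters act by left multiplication with \<open>t x\<close>. Its
  linearity is inherited from \<open>act\<close>.\<close>

definition subst :: "('x \<Rightarrow> 'y word \<Rightarrow>\<^sub>0 'k::field) \<Rightarrow> ('x word \<Rightarrow>\<^sub>0 'k) \<Rightarrow> 'y word \<Rightarrow>\<^sub>0 'k"
  where "subst t p = act scale (\<lambda>x m. t x * m) p 1"

lemma word_action_subst: "word_action scale (\<lambda>x m. t x * m)"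
  by unfold_locales (simp_all add: distrib_left scale.sm_mult_right)

text \<open>Left multiplications commute with right multiplication by \<open>m\<close>, so the
  action is known once it is known on \<open>1\<close>. Multiplicativity of \<open>subst\<close>
  follows from this.\<close>

lemma act_eq_subst_mult:
  "act scale (\<lambda>x m. t x * m) p m = subst t p * m"
proof -
  interpret word_action scale "\<lambda>x m. t x * m" by (rule word_action_subst)
  have foldr: "foldr (\<lambda>x m. t x * m) xs m = foldr (\<lambda>x m. t x * m) xs 1 * m" for xs
    by (induction xs) (simp_all add: mult.assoc)
  show ?thesis
  proof (induction p rule: poly_mapping_single_induct)
    case (single w c)
    show ?case
      using foldr[of "letters w"] by (simp add: subst_def act_single scale.sm_mult_left)
  qed (simp add: subst_def act_add distrib_right)
qed

context
  fixes t :: "'x \<Rightarrow> 'y word \<Rightarrow>\<^sub>0 'k::field"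
begin

interpretation word_action scale "\<lambda>x m. t x * m"
  by (rule word_action_subst)

lemma subst_add: "subst t (p + q) = subst t p + subst t q"
  by (simp add: subst_def act_add)

lemma subst_diff: "subst t (p - q) = subst t p - subst t q"
  by (simp add: subst_def act_diff)

lemma subst_zero: "subst t 0 = 0"
  by (simp add: subst_def act_zero)

lemma subst_sum: "subst t (sum f A) = (\<Sum>a\<in>A. subst t (f a))"
  by (simp add: subst_def act_sum)

lemma subst_one: "subst t 1 = 1"
  by (simp add: subst_def act_one)

lemma subst_gen: "subst t (gen x) = t x"
  by (simp add: subst_def act_gen)

lemma subst_scale: "subst t (scale c p) = scale c (subst t p)"
  by (simp add: subst_def act_scale)

lemma subst_mult: "subst t (p * q) = subst t p * subst t q"
  using act_mult[of p q 1] by (simp add: act_eq_subst_mult)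

lemma subst_single_Nil: "subst t (Poly_Mapping.single 0 c) = Poly_Mapping.single 0 c"
  by (simp add: single_eq_scale subst_scale subst_one)

end

lemmas subst_simps = subst_add subst_diff subst_zero subst_sum subst_one subst_gen subst_scale subst_mult

section \<open>Polynomials in a given set of letters\<close>

lemma free_algebra_sel [simp]:
  "monoid.mult (free_algebra Y) = (*)" "monoid.one (free_algebra Y) = 1"
  "ring.zero (free_algebra Y) = 0" "ring.add (free_algebra Y) = (+)"
  "module.smult (free_algebra Y) = scale"
  by (simp_all add: free_algebra_def)

lemma free_nonunital_algebra_sel [simp]:
  "monoid.mult (free_nonunital_algebra Y) = (*)"
  "ring.zero (free_nonunital_algebra Y) = 0" "ring.add (free_nonunital_algebra Y) = (+)"
  "module.smult (free_nonunital_algebra Y) = scale"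
  by (simp_all add: free_nonunital_algebra_def)

abbreviation free :: "'x set \<Rightarrow> ('x word \<Rightarrow>\<^sub>0 'k::field) set"
  where "free Y \<equiv> carrier (free_algebra Y)"

abbreviation free_nonunital :: "'x set \<Rightarrow> ('x word \<Rightarrow>\<^sub>0 'k::field) set"
  where "free_nonunital Y \<equiv> carrier (free_nonunital_algebra Y)"

lemma free_iff: "p \<in> free Y \<longleftrightarrow> (\<forall>w\<in>Poly_Mapping.keys p. set (letters w) \<subseteq> Y)"
  by (simp add: free_algebra_def)

lemma free_nonunital_iff:
  "p \<in> free_nonunital Y \<longleftrightarrow> p \<in> free Y \<and> Poly_Mapping.lookup p 0 = 0"
  by (simp add: free_nonunital_algebra_def)

lemma free_single: "set (letters w) \<subseteq> Y \<Longrightarrow> Poly_Mapping.single w c \<in> free Y"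
  by (simp add: free_iff)

lemma free_add: "p \<in> free Y \<Longrightarrow> q \<in> free Y \<Longrightarrow> p + q \<in> free Y"
  unfolding free_iff using keys_add[of p q] by blast

lemma free_mult: "p \<in> free Y \<Longrightarrow> q \<in> free Y \<Longrightarrow> p * q \<in> free Y"
  unfolding free_iff using keys_mult[of p q] by fastforce

lemma free_scale: "p \<in> free Y \<Longrightarrow> scale c p \<in> free Y"
  unfolding free_iff using keys_scale[of c p] by blast

lemma free_gen: "x \<in> Y \<Longrightarrow> gen x \<in> free Y"
  by (simp add: gen_def free_single)

lemma free_zero: "0 \<in> free Y"
  by (simp add: free_iff)

lemma free_one: "1 \<in> free Y"
  by (simp add: free_iff)

lemma free_minus: "p \<in> free Y \<Longrightarrow> - p \<in> free Y"
  by (simp add: free_iff)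

lemma free_diff: "p \<in> free Y \<Longrightarrow> q \<in> free Y \<Longrightarrow> p - q \<in> free Y"
  using free_add[of p Y "- q"] free_minus[of q Y] by simp

lemma free_sum: "(\<And>a. a \<in> A \<Longrightarrow> f a \<in> free Y) \<Longrightarrow> sum f A \<in> free Y"
  by (induction A rule: infinite_finite_induct) (simp_all add: free_zero free_add)

lemmas free_intros = free_add free_mult free_scale free_gen free_zero free_one free_diff free_sum

text \<open>Words grow from the empty word by prepending letters, and no step of the induction
  leaves \<open>free Y\<close>. Hence assumptions about the letters in \<open>Y\<close> are enough
  in later proofs.\<close>

lemma free_algebra_induct [consumes 1, case_names zero const gen_mult add]:
  assumes "p \<in> free Y"
    and zero: "P 0"
    and const: "\<And>c. P (Poly_Mapping.single 0 c)"
    and gen_mult: "\<And>x p. x \<in> Y \<Longrightarrow> p \<in> free Y \<Longrightarrow> P p \<Longrightarrow> P (gen x * p)"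
    and add: "\<And>p q. p \<in> free Y \<Longrightarrow> q \<in> free Y \<Longrightarrow> P p \<Longrightarrow> P q \<Longrightarrow> P (p + q)"
  shows "P p"
proof -
  have single: "P (Poly_Mapping.single (Word xs) c)" if "set xs \<subseteq> Y" for xs c
    using that
  proof (induction xs)
    case Nil
    show ?case using const by (simp add: Word_Nil)
  next
    case (Cons x xs)
    then show ?case
      by (simp only: single_Cons) (rule gen_mult, auto simp: free_iff)
  qed
  have "P (\<Sum>w\<in>W. Poly_Mapping.single w (Poly_Mapping.lookup p w))"
    if "finite W" "W \<subseteq> Poly_Mapping.keys p" for W
    using that
  proof (induction W)
    case (insert w W)
    have *: "set (letters v) \<subseteq> Y" if "v \<in> insert w W" for v
      using insert.prems assms(1) that by (auto simp: free_iff)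
    have "P (Poly_Mapping.single w (Poly_Mapping.lookup p w))"
      using single[OF *, of w] by simp
    with insert * show ?case
      by (simp add: add free_single free_sum)
  qed (simp add: zero)
  from this[of "Poly_Mapping.keys p"] show ?thesis
    by (simp add: poly_mapping_sum_singles)
qed

lemma subst_in_free:
  assumes "p \<in> free Y" "\<And>y. y \<in> Y \<Longrightarrow> t y \<in> free Z"
  shows "subst t p \<in> free Z"
  using assms(1)
  by (induction rule: free_algebra_induct)
    (use assms(2) in \<open>auto simp: subst_simps subst_single_Nil intro: free_intros free_single\<close>)

lemma free_UNIV: "p \<in> free UNIV"
  by (simp add: free_iff)

text \<open>A retraction of the free algebra on the whole letter type onto \<open>free Y\<close>. It
  turns computations with arbitrary letters into computations inside \<open>free Y\<close>.\<close>

definition restrict_letters :: "'x set \<Rightarrow> ('x word \<Rightarrow>\<^sub>0 'k::field) \<Rightarrow> 'x word \<Rightarrow>\<^sub>0 'k" where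
  "restrict_letters Y = subst (\<lambda>x. if x \<in> Y then gen x else 0)"

lemma restrict_letters_in_free: "restrict_letters Y p \<in> free Y"
  unfolding restrict_letters_def
  by (rule subst_in_free[OF free_UNIV]) (auto intro: free_intros)

lemma restrict_letters_id: "p \<in> free Y \<Longrightarrow> restrict_letters Y p = p"
  unfolding restrict_letters_def
  by (induction rule: free_algebra_induct)
    (simp_all add: subst_simps subst_single_Nil)

section \<open>Ideals and residue rings\<close>

text \<open>Multipliers range over the whole ring type, not over a subalgebra, so membership is a
  plain congruence of rings. Closure under scalars is a case of \<open>left\<close>, since scaling
  is multiplication by a constant.\<close>

inductive_set ideal_of :: "'a::ring_1 set \<Rightarrow> 'a set" for S where
  base: "x \<in> S \<Longrightarrow> x \<in> ideal_of S"
| zero: "0 \<in> ideal_of S"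
| add: "x \<in> ideal_of S \<Longrightarrow> y \<in> ideal_of S \<Longrightarrow> x + y \<in> ideal_of S"
| left: "x \<in> ideal_of S \<Longrightarrow> a * x \<in> ideal_of S"
| right: "x \<in> ideal_of S \<Longrightarrow> x * a \<in> ideal_of S"

lemma ideal_of_minus: "x \<in> ideal_of S \<Longrightarrow> - x \<in> ideal_of S"
  using ideal_of.left[of x S "- 1"] by simp

lemma ideal_of_diff: "x \<in> ideal_of S \<Longrightarrow> y \<in> ideal_of S \<Longrightarrow> x - y \<in> ideal_of S"
  using ideal_of.add[of x S "- y"] ideal_of_minus[of y S] by simp

lemma ideal_of_scale: "x \<in> ideal_of S \<Longrightarrow> scale c x \<in> ideal_of S"
  by (simp add: scale_def ideal_of.left)

text \<open>
  Congruences modulo an ideal become equations in an honest type of class \<^class>\<open>ring_1\<close>. A type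
  cannot depend on the set \<open>S\<close> of relations, but the product of the residue rings by all
  \<^term>\<open>ideal_of S\<close> is a type, and \<open>residue S\<close> embeds the residue ring by \<^term>\<open>ideal_of S\<close> as its factor
  at \<open>S\<close> (so that \<open>residue S 1\<close> is an idempotent different from \<open>1\<close>).
\<close>

quotient_type (overloaded) 'a residues = "'a set \<Rightarrow> 'a::ring_1" /
  "\<lambda>f g. \<forall>S. f S - g S \<in> ideal_of S"
proof (rule equivpI)
  show "reflp (\<lambda>f g :: 'a set \<Rightarrow> 'a. \<forall>S. f S - g S \<in> ideal_of S)"
    by (rule reflpI) (simp add: ideal_of.zero)
  show "symp (\<lambda>f g :: 'a set \<Rightarrow> 'a. \<forall>S. f S - g S \<in> ideal_of S)"
    by (rule sympI) (metis ideal_of_minus minus_diff_eq)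
  show "transp (\<lambda>f g :: 'a set \<Rightarrow> 'a. \<forall>S. f S - g S \<in> ideal_of S)"
  proof (rule transpI, rule allI)
    fix f g h :: "'a set \<Rightarrow> 'a" and S
    assume "\<forall>S. f S - g S \<in> ideal_of S" "\<forall>S. g S - h S \<in> ideal_of S"
    then have "(f S - g S) + (g S - h S) \<in> ideal_of S"
      by (blast intro: ideal_of.add)
    then show "f S - h S \<in> ideal_of S" by simp
  qed
qed

instantiation residues :: (ring_1) ring_1
begin

lift_definition zero_residues :: "'a residues" is "\<lambda>_. 0" .

lift_definition one_residues :: "'a residues" is "\<lambda>_. 1" .

lift_definition plus_residues :: "'a residues \<Rightarrow> 'a residues \<Rightarrow> 'a residues" is "\<lambda>f g S. f S + g S"
proof -
  fix f f' g g' :: "'a set \<Rightarrow> 'a" and S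
  assume "\<And>S. f S - f' S \<in> ideal_of S" "\<And>S. g S - g' S \<in> ideal_of S"
  then have "(f S - f' S) + (g S - g' S) \<in> ideal_of S"
    by (blast intro: ideal_of.add)
  then show "f S + g S - (f' S + g' S) \<in> ideal_of S" by (simp add: algebra_simps)
qed

lift_definition minus_residues :: "'a residues \<Rightarrow> 'a residues \<Rightarrow> 'a residues" is "\<lambda>f g S. f S - g S"
proof -
  fix f f' g g' :: "'a set \<Rightarrow> 'a" and S
  assume "\<And>S. f S - f' S \<in> ideal_of S" "\<And>S. g S - g' S \<in> ideal_of S"
  then have "(f S - f' S) - (g S - g' S) \<in> ideal_of S"
    by (blast intro: ideal_of_diff)
  then show "f S - g S - (f' S - g' S) \<in> ideal_of S" by (simp add: algebra_simps)
qed

lift_definition uminus_residues :: "'a residues \<Rightarrow> 'a residues" is "\<lambda>f S. - f S"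
proof -
  fix f f' :: "'a set \<Rightarrow> 'a" and S
  assume "\<And>S. f S - f' S \<in> ideal_of S"
  then have "- (f S - f' S) \<in> ideal_of S"
    by (blast intro: ideal_of_minus)
  then show "- f S - - f' S \<in> ideal_of S" by (simp add: algebra_simps)
qed

lift_definition times_residues :: "'a residues \<Rightarrow> 'a residues \<Rightarrow> 'a residues" is "\<lambda>f g S. f S * g S"
proof -
  fix f f' g g' :: "'a set \<Rightarrow> 'a" and S
  assume "\<And>S. f S - f' S \<in> ideal_of S" "\<And>S. g S - g' S \<in> ideal_of S"
  then have "(f S - f' S) * g S + f' S * (g S - g' S) \<in> ideal_of S"
    by (blast intro: ideal_of.intros)
  then show "f S * g S - f' S * g' S \<in> ideal_of S" by (simp add: algebra_simps)
qed

instance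
proof
  show "(0 :: 'a residues) \<noteq> 1"
  proof (transfer, rule notI)
    assume "\<forall>S. (0 :: 'a) - 1 \<in> ideal_of S"
    \<comment> \<open>The factor without relations keeps \<open>0\<close> and \<open>1\<close>
      apart, even where other factors of the product collapse.\<close>
    then have "- 1 \<in> ideal_of ({} :: 'a set)" by (metis diff_0)
    moreover have "x = 0" if "x \<in> ideal_of {}" for x :: 'a
      using that by induction simp_all
    ultimately show False by force
  qed
qed (transfer; simp add: algebra_simps ideal_of.zero)+

end

lift_definition residue :: "'a::ring_1 set \<Rightarrow> 'a \<Rightarrow> 'a residues" is
  "\<lambda>S p T. if T = S then p else 0" .

lemma residue_eq_iff: "residue S p = residue S q \<longleftrightarrow> p - q \<in> ideal_of S"
  by transfer (auto simp: ideal_of.zero)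

lemma residue_eq_zero_iff: "residue S p = 0 \<longleftrightarrow> p \<in> ideal_of S"
  by transfer (auto simp: ideal_of.zero)

lemma residue_zero: "residue S 0 = 0"
  by (simp add: residue_eq_zero_iff ideal_of.zero)

lemma residue_add: "residue S (p + q) = residue S p + residue S q"
  by transfer (auto simp: ideal_of.zero)

lemma residue_diff: "residue S (p - q) = residue S p - residue S q"
  by transfer (auto simp: ideal_of.zero)

lemma residue_mult: "residue S (p * q) = residue S p * residue S q"
  by transfer (auto simp: ideal_of.zero)

lemma residue_sum: "residue S (sum f A) = (\<Sum>a\<in>A. residue S (f a))"
  by (induction A rule: infinite_finite_induct) (simp_all add: residue_zero residue_add)

lemma residue_base: "p \<in> S \<Longrightarrow> residue S p = 0"
  by (simp add: residue_eq_zero_iff ideal_of.base)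

text \<open>The diagonal embedding, which unlike \<open>residue S\<close> preserves
  \<open>1\<close>. Scalars are taken from here so that \<open>scale_residues 1\<close> is the
  identity on the entire type.\<close>

lift_definition constant_residue :: "'a::ring_1 \<Rightarrow> 'a residues" is "\<lambda>a S. a" .

lemma constant_residue_add: "constant_residue (a + b) = constant_residue a + constant_residue b"
  by transfer (simp add: ideal_of.zero)

lemma constant_residue_mult: "constant_residue (a * b) = constant_residue a * constant_residue b"
  by transfer (simp add: ideal_of.zero)

lemma constant_residue_one: "constant_residue 1 = 1"
  by transfer (simp add: ideal_of.zero)

lemma constant_residue_central:
  "(\<And>b. b * a = a * b) \<Longrightarrow> x * constant_residue a = constant_residue a * x"
  by transfer (simp add: ideal_of.zero)

lemma residue_eq_constant: "residue S (a * p) = constant_residue a * residue S p"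
  by transfer (simp add: ideal_of.zero)

definition scale_residues ::
  "'k::field \<Rightarrow> ('x word \<Rightarrow>\<^sub>0 'k) residues \<Rightarrow> ('x word \<Rightarrow>\<^sub>0 'k) residues" where
  "scale_residues c x = constant_residue (Poly_Mapping.single 0 c) * x"

lemma residue_scale: "residue S (scale c p) = scale_residues c (residue S p)"
  by (simp add: scale_def scale_residues_def residue_eq_constant)

lemma k_algebra_scale_residues: "k_algebra scale_residues"
proof
  fix c d :: "'k::field" and x y :: "('x word \<Rightarrow>\<^sub>0 'k) residues"
  show "scale_residues c (x + y) = scale_residues c x + scale_residues c y"
    by (simp add: scale_residues_def distrib_left)
  show "scale_residues (c + d) x = scale_residues c x + scale_residues d x"
    by (simp add: scale_residues_def distrib_right single_add constant_residue_add)
  show "scale_residues c (scale_residues d x) = scale_residues (c * d) x"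
    by (simp add: scale_residues_def mult.assoc[symmetric] mult_single
        flip: constant_residue_mult)
  show "scale_residues 1 x = x"
    by (simp add: scale_residues_def constant_residue_one)
  show "scale_residues c x * y = scale_residues c (x * y)"
    by (simp add: scale_residues_def mult.assoc)
  show "x * scale_residues c y = scale_residues c (x * y)"
    using constant_residue_central[OF single_zero_central, of x c]
    by (simp add: scale_residues_def mult.assoc[symmetric])
qed

interpretation scale_residues: k_algebra scale_residues
  by (rule k_algebra_scale_residues)

lemmas residue_simps =
  residue_zero residue_add residue_diff residue_mult residue_sum residue_scale

lemma residue_one_left: "residue S 1 * residue S p = residue S p"
  by (simp flip: residue_mult)

text \<open>The polynomials that \<open>residue T\<close> kills after the substitution form an
  ideal, so checking the generators \<open>S\<close> suffices.\<close>

lemma residue_subst_zero: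
  assumes "\<And>s. s \<in> S \<Longrightarrow> residue T (subst t s) = 0" "residue S p = 0"
  shows "residue T (subst t p) = 0"
proof -
  have "p \<in> ideal_of S" using assms(2) by (simp add: residue_eq_zero_iff)
  then show ?thesis
    by induction (simp_all add: assms(1) subst_simps residue_simps)
qed

lemma residue_subst_id:
  assumes "p \<in> free Y" "\<And>y. y \<in> Y \<Longrightarrow> residue S (subst t' (t y)) = residue S (gen y)"
  shows "residue S (subst t' (subst t p)) = residue S p"
  using assms(1)
  by (induction rule: free_algebra_induct)
    (simp_all add: subst_simps subst_single_Nil residue_simps assms(2))

text \<open>A derivation in \<open>ideal_of S\<close> may multiply by letters outside
  \<open>Y\<close>. Applying \<open>restrict_letters Y\<close> to all of its steps leaves the
  generators and the final element unchanged and moves every multiplier into \<open>free Y\<close>.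
  Absorption is assumed for \<open>free Y\<close> rather than for \<open>C\<close> because in the
  nonunital case the multipliers can have constant terms that \<open>C\<close> lacks.\<close>

lemma generated_ideal_eqI:
  fixes S :: "('x word \<Rightarrow>\<^sub>0 'k::field) set"
  assumes C: "C \<subseteq> free Y"
    and ops: "carrier A = C" "monoid.mult A = (*)" "ring.zero A = 0" "ring.add A = (+)"
      "module.smult A = scale"
    and closed: "0 \<in> C" "\<And>p q. p \<in> C \<Longrightarrow> q \<in> C \<Longrightarrow> p + q \<in> C" "\<And>c p. p \<in> C \<Longrightarrow> scale c p \<in> C"
      "\<And>p q. p \<in> C \<Longrightarrow> q \<in> C \<Longrightarrow> p * q \<in> C"
    and ideal: "\<And>I p a. algebra_ideal A I \<Longrightarrow> p \<in> I \<Longrightarrow> a \<in> free Y \<Longrightarrow> a * p \<in> I \<and> p * a \<in> I"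
    and S: "S \<subseteq> C"
  shows "generated_ideal A S = ideal_of S \<inter> C"
proof (rule equalityI)
  have "algebra_ideal A (ideal_of S \<inter> C)"
    using closed by (auto simp: algebra_ideal_def ops intro: ideal_of.intros ideal_of_scale)
  moreover have "S \<subseteq> ideal_of S \<inter> C"
    using S by (auto intro: ideal_of.base)
  ultimately show "generated_ideal A S \<subseteq> ideal_of S \<inter> C"
    unfolding generated_ideal_def by blast
next
  have "p \<in> I" if p: "p \<in> ideal_of S" "p \<in> C" and I: "algebra_ideal A I" "S \<subseteq> I" for p I
  proof -
    have "restrict_letters Y p \<in> I"
      using p(1)
    proof induction
      case (base x)
      then have "x \<in> free Y" using S C by auto
      then show ?case using base I(2) by (auto simp: restrict_letters_id)
    next
      case zero
      show ?case using I(1) by (simp add: restrict_letters_def subst_simps algebra_ideal_def ops)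
    next
      case (add x y)
      then show ?case using I(1) by (simp add: restrict_letters_def subst_simps algebra_ideal_def ops)
    next
      case (left x a)
      then show ?case
        using ideal[OF I(1), of "restrict_letters Y x" "restrict_letters Y a"] restrict_letters_in_free[of Y a]
        by (simp add: restrict_letters_def subst_simps)
    next
      case (right x a)
      then show ?case
        using ideal[OF I(1), of "restrict_letters Y x" "restrict_letters Y a"] restrict_letters_in_free[of Y a]
        by (simp add: restrict_letters_def subst_simps)
    qed
    moreover have "p \<in> free Y" using p(2) C by blast
    ultimately show ?thesis by (simp add: restrict_letters_id)
  qed
  then show "ideal_of S \<inter> C \<subseteq> generated_ideal A S"
    unfolding generated_ideal_def by blast
qed

lemma generated_ideal_free:
  "S \<subseteq> free Y \<Longrightarrow> generated_ideal (free_algebra Y) S = ideal_of S \<inter> free Y"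
  by (rule generated_ideal_eqI[where Y = Y]) (auto intro: free_intros simp: algebra_ideal_def)

lemma free_nonunital_iff':
  "p \<in> free_nonunital Y \<longleftrightarrow>
     (\<forall>w\<in>Poly_Mapping.keys p. letters w \<noteq> [] \<and> set (letters w) \<subseteq> Y)"
proof -
  have "Poly_Mapping.lookup p 0 = 0 \<longleftrightarrow> (\<forall>w\<in>Poly_Mapping.keys p. letters w \<noteq> [])"
    by (metis in_keys_iff word_eq_zero_iff)
  then show ?thesis
    by (auto simp: free_nonunital_iff free_iff)
qed

lemma free_nonunital_mult:
  "p \<in> free_nonunital Y \<Longrightarrow> q \<in> free Y \<Longrightarrow> p * q \<in> free_nonunital Y"
  "p \<in> free_nonunital Y \<Longrightarrow> q \<in> free Y \<Longrightarrow> q * p \<in> free_nonunital Y"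
  subgoal unfolding free_nonunital_iff' free_iff by (fastforce dest: subsetD[OF keys_mult])
  subgoal unfolding free_nonunital_iff' free_iff by (fastforce dest: subsetD[OF keys_mult])
  done

lemma free_nonunital_add:
  "p \<in> free_nonunital Y \<Longrightarrow> q \<in> free_nonunital Y \<Longrightarrow> p + q \<in> free_nonunital Y"
  by (simp add: free_nonunital_iff lookup_add free_add)

lemma free_nonunital_scale: "p \<in> free_nonunital Y \<Longrightarrow> scale c p \<in> free_nonunital Y"
  by (simp add: free_nonunital_iff lookup_scale free_scale)

lemma free_nonunital_zero: "0 \<in> free_nonunital Y"
  by (simp add: free_nonunital_iff free_zero)

lemma free_nonunital_gen: "x \<in> Y \<Longrightarrow> gen x \<in> free_nonunital Y"
  by (simp add: free_nonunital_iff') (simp add: gen_def)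

lemma free_nonunital_sum:
  "(\<And>a. a \<in> A \<Longrightarrow> f a \<in> free_nonunital Y) \<Longrightarrow> sum f A \<in> free_nonunital Y"
  by (induction A rule: infinite_finite_induct)
    (simp_all add: free_nonunital_zero free_nonunital_add)

lemma free_nonunital_diff:
  "p \<in> free_nonunital Y \<Longrightarrow> q \<in> free_nonunital Y \<Longrightarrow> p - q \<in> free_nonunital Y"
  by (simp add: free_nonunital_iff lookup_minus free_diff)

lemma free_nonunitalD: "p \<in> free_nonunital Y \<Longrightarrow> p \<in> free Y"
  by (simp add: free_nonunital_iff)

lemmas free_nonunital_intros = free_nonunital_mult free_nonunital_add free_nonunital_scale
  free_nonunital_zero free_nonunital_gen free_nonunital_sum free_nonunital_diff

lemma free_decompose:
  assumes "a \<in> free Y"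
  obtains c n where "n \<in> free_nonunital Y" "a = scale c 1 + n"
proof
  define c where "c = Poly_Mapping.lookup a 0"
  show "a - scale c 1 \<in> free_nonunital Y"
    using assms
    by (simp add: free_nonunital_iff lookup_minus lookup_scale c_def free_intros)
  show "a = scale c 1 + (a - scale c 1)" by simp
qed

text \<open>An ideal of the nonunital free algebra is a subspace, so it absorbs constants too, and
  hence all of \<open>free Y\<close>. This is the absorption that \<open>generated_ideal_eqI\<close>
  asks for.\<close>

lemma generated_ideal_free_nonunital:
  assumes "S \<subseteq> free_nonunital Y"
  shows "generated_ideal (free_nonunital_algebra Y) S = ideal_of S \<inter> free_nonunital Y"
proof (rule generated_ideal_eqI[where Y = Y])
  fix I and p a :: "'a word \<Rightarrow>\<^sub>0 'b"
  assume I: "algebra_ideal (free_nonunital_algebra Y) I" and p: "p \<in> I" and a: "a \<in> free Y"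
  from a obtain c n where n: "n \<in> free_nonunital Y" and a: "a = scale c 1 + n"
    by (rule free_decompose)
  show "a * p \<in> I \<and> p * a \<in> I"
    using I p n
    by (auto simp: a algebra_ideal_def distrib_left distrib_right scale.sm_mult_left
        scale.sm_mult_right)
qed (use assms in \<open>auto intro: free_nonunital_intros dest: free_nonunitalD\<close>)

section \<open>Presented algebras and their gradings\<close>

locale closed_algebra = abelian_monoid A for A :: "('k, 'a) module" (structure) +
  assumes smult_closed: "x \<in> carrier A \<Longrightarrow> c \<odot> x \<in> carrier A"
    and mult_closed: "x \<in> carrier A \<Longrightarrow> y \<in> carrier A \<Longrightarrow> x \<otimes> y \<in> carrier A"

definition hom_part ::
  "('k::field, 'x word \<Rightarrow>\<^sub>0 'k) module \<Rightarrow> ('x \<Rightarrow> 'g::ab_group_add set) \<Rightarrow> 'g \<Rightarrow> ('x word \<Rightarrow>\<^sub>0 'k) set" where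
  "hom_part A d \<gamma> = {p \<in> carrier A. \<forall>w\<in>Poly_Mapping.keys p. \<gamma> \<in> word_degrees d (letters w)}"

lemma word_degrees_append:
  "\<gamma> \<in> word_degrees d xs \<Longrightarrow> \<delta> \<in> word_degrees d ys \<Longrightarrow> \<gamma> + \<delta> \<in> word_degrees d (xs @ ys)"
proof (induction xs arbitrary: \<gamma>)
  case (Cons x xs)
  then obtain \<alpha> \<beta> where "\<gamma> = \<alpha> + \<beta>" "\<alpha> \<in> d x" "\<beta> \<in> word_degrees d xs" by auto
  with Cons.IH[of \<beta>] Cons.prems(2) show ?case
    by (auto simp: add.assoc)
qed simp

text \<open>One setting for the unital and the nonunital free algebra. Both are subspaces, closed
  under products, of the free algebra on the whole letter type, so \<open>ideal_of S\<close> only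
  has to be intersected with the carrier.\<close>

locale quotient_presentation =
  fixes A :: "('k::field, 'x word \<Rightarrow>\<^sub>0 'k) module" and S :: "('x word \<Rightarrow>\<^sub>0 'k) set"
  assumes ops: "monoid.mult A = (*)" "ring.zero A = 0" "ring.add A = (+)" "module.smult A = scale"
    and closed_zero: "0 \<in> carrier A"
    and closed_add: "p \<in> carrier A \<Longrightarrow> q \<in> carrier A \<Longrightarrow> p + q \<in> carrier A"
    and closed_scale: "p \<in> carrier A \<Longrightarrow> scale c p \<in> carrier A"
    and closed_mult: "p \<in> carrier A \<Longrightarrow> q \<in> carrier A \<Longrightarrow> p * q \<in> carrier A"
begin

lemma closed_diff: "p \<in> carrier A \<Longrightarrow> q \<in> carrier A \<Longrightarrow> p - q \<in> carrier A"
  using closed_add[of p "scale (- 1) q"] closed_scale[of q "- 1"]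
  by (simp add: scale_def single_uminus)

lemma closed_sum: "(\<And>a. a \<in> N \<Longrightarrow> f a \<in> carrier A) \<Longrightarrow> sum f N \<in> carrier A"
  by (induction N rule: infinite_finite_induct) (simp_all add: closed_zero closed_add)

definition coset :: "('x word \<Rightarrow>\<^sub>0 'k) \<Rightarrow> ('x word \<Rightarrow>\<^sub>0 'k) set" where
  "coset p = (ideal_of S \<inter> carrier A) +>\<^bsub>A\<^esub> p"

definition Q :: "('k, ('x word \<Rightarrow>\<^sub>0 'k) set) module" where
  "Q = quotient_algebra A (ideal_of S \<inter> carrier A)"

lemma coset_altdef: "coset p = (\<lambda>i. i + p) ` (ideal_of S \<inter> carrier A)"
  by (auto simp: coset_def a_r_coset_def r_coset_def ops)

lemma coset_memD:
  assumes "p \<in> carrier A" "q \<in> coset p"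
  shows "q \<in> carrier A" "residue S q = residue S p"
proof -
  from assms(2) obtain i where "i \<in> ideal_of S" "i \<in> carrier A" "q = i + p"
    by (auto simp: coset_altdef)
  then show "q \<in> carrier A" "residue S q = residue S p"
    using assms(1) by (auto simp: closed_add residue_eq_iff)
qed

lemma coset_mem_self: "p \<in> carrier A \<Longrightarrow> p \<in> coset p"
  using closed_zero ideal_of.zero[of S] by (force simp: coset_altdef)

lemma coset_memI:
  assumes "p \<in> carrier A" "q \<in> carrier A" "residue S q = residue S p"
  shows "q \<in> coset p"
proof -
  have "q - p \<in> ideal_of S \<inter> carrier A" "q = (q - p) + p"
    using assms by (simp_all add: residue_eq_iff closed_diff)
  then show ?thesis unfolding coset_altdef by blast
qed

lemma mem_coset_iff:
  "p \<in> carrier A \<Longrightarrow> q \<in> coset p \<longleftrightarrow> q \<in> carrier A \<and> residue S q = residue S p"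
  using coset_memD coset_memI by blast

text \<open>The bridge from the quotient record to the ring type \<open>residues\<close>, in which
  equations can be simplified by ring laws.\<close>

lemma coset_eq_iff:
  "p \<in> carrier A \<Longrightarrow> q \<in> carrier A \<Longrightarrow> coset p = coset q \<longleftrightarrow> residue S p = residue S q"
  using mem_coset_iff[of p] mem_coset_iff[of q] coset_mem_self[of p] by auto

lemma carrier_Q: "carrier Q = coset ` carrier A"
  by (auto simp: Q_def quotient_algebra_def ring.defs module.defs FactRing_def A_RCOSETS_def
      RCOSETS_def coset_def a_r_coset_def)

lemma zero_Q: "\<zero>\<^bsub>Q\<^esub> = coset 0"
  by (simp add: Q_def quotient_algebra_def ring.defs module.defs FactRing_def coset_altdef)

lemma add_Q:
  assumes "p \<in> carrier A" "q \<in> carrier A"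
  shows "coset p \<oplus>\<^bsub>Q\<^esub> coset q = coset (p + q)"
proof -
  have "coset p \<oplus>\<^bsub>Q\<^esub> coset q = {a + b | a b. a \<in> coset p \<and> b \<in> coset q}"
    by (auto simp: Q_def quotient_algebra_def ring.defs module.defs FactRing_def set_add_def
        set_mult_def ops)
  also have "\<dots> = coset (p + q)"
  proof (rule equalityI; rule subsetI)
    fix x assume "x \<in> coset (p + q)"
    then have "x = (x - q) + q" "x - q \<in> coset p" "q \<in> coset q"
      using assms by (auto simp: mem_coset_iff closed_add closed_diff residue_simps)
    then show "x \<in> {a + b | a b. a \<in> coset p \<and> b \<in> coset q}" by blast
  qed (use assms in \<open>auto simp: mem_coset_iff closed_add residue_simps\<close>)
  finally show ?thesis .
qed

lemma mult_Q:
  assumes "p \<in> carrier A" "q \<in> carrier A"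
  shows "coset p \<otimes>\<^bsub>Q\<^esub> coset q = coset (p * q)"
proof -
  have "coset p \<otimes>\<^bsub>Q\<^esub> coset q = (\<Union>a\<in>coset p. \<Union>b\<in>coset q. coset (a * b))"
    by (simp add: Q_def quotient_algebra_def ring.defs module.defs FactRing_def rcoset_mult_def ops
        flip: coset_def)
  also have "\<dots> = (\<Union>a\<in>coset p. \<Union>b\<in>coset q. coset (p * q))"
    using assms
    by (intro SUP_cong refl) (simp add: mem_coset_iff coset_eq_iff closed_mult residue_simps)
  \<comment> \<open>Both cosets contain their representatives, so this is a union of a constant
    family over nonempty sets.\<close>
  also have "\<dots> = coset (p * q)"
    using coset_mem_self[OF assms(1)] coset_mem_self[OF assms(2)] by (auto simp only: UN_constant split: if_splits)
  finally show ?thesis .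
qed

lemma smult_Q:
  assumes "p \<in> carrier A"
  shows "c \<odot>\<^bsub>Q\<^esub> coset p = coset (scale c p)"
proof -
  have "c \<odot>\<^bsub>Q\<^esub> coset p = (\<Union>a\<in>coset p. coset (scale c a))"
    by (simp add: Q_def quotient_algebra_def ring.defs module.defs FactRing_def ops
        flip: coset_def)
  also have "\<dots> = (\<Union>a\<in>coset p. coset (scale c p))"
    using assms
    by (intro SUP_cong refl) (simp add: mem_coset_iff coset_eq_iff closed_scale residue_simps)
  also have "\<dots> = coset (scale c p)"
    using coset_mem_self[OF assms] by (auto simp only: UN_constant split: if_splits)
  finally show ?thesis .
qed

lemma closed_algebra_Q: "closed_algebra Q"
proof -
  have "abelian_monoid Q"
  proof (rule abelian_monoidI)
    fix x y z assume "x \<in> carrier Q" "y \<in> carrier Q" "z \<in> carrier Q"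
    then obtain p q r where "x = coset p" "y = coset q" "z = coset r"
      "p \<in> carrier A" "q \<in> carrier A" "r \<in> carrier A"
      by (auto simp: carrier_Q)
    then show "x \<oplus>\<^bsub>Q\<^esub> y \<oplus>\<^bsub>Q\<^esub> z = x \<oplus>\<^bsub>Q\<^esub> (y \<oplus>\<^bsub>Q\<^esub> z)"
      by (simp add: add_Q closed_add add.assoc)
  next
    fix x y assume "x \<in> carrier Q" "y \<in> carrier Q"
    then obtain p q where "x = coset p" "y = coset q" "p \<in> carrier A" "q \<in> carrier A"
      by (auto simp: carrier_Q)
    then show "x \<oplus>\<^bsub>Q\<^esub> y = y \<oplus>\<^bsub>Q\<^esub> x" "x \<oplus>\<^bsub>Q\<^esub> y \<in> carrier Q"
      by (simp_all add: add_Q closed_add carrier_Q add.commute)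
  qed (auto simp: carrier_Q zero_Q add_Q closed_zero)
  then show ?thesis
    by (auto simp: closed_algebra_def closed_algebra_axioms_def carrier_Q mult_Q smult_Q closed_mult
        closed_scale)
qed

lemma finsum_Q:
  assumes "finite N" "\<And>\<gamma>. \<gamma> \<in> N \<Longrightarrow> g \<gamma> \<in> carrier A" "\<And>\<gamma>. \<gamma> \<in> N \<Longrightarrow> f \<gamma> = coset (g \<gamma>)"
  shows "finsum Q f N = coset (sum g N)"
proof -
  interpret closed_algebra Q by (rule closed_algebra_Q)
  show ?thesis
    using assms
  proof (induction N)
    case empty
    show ?case by (simp add: zero_Q)
  next
    case (insert \<gamma> N)
    have "f \<in> N \<rightarrow> carrier Q" "f \<gamma> \<in> carrier Q"
      using insert.prems by (auto simp: carrier_Q)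
    then have "finsum Q f (insert \<gamma> N) = f \<gamma> \<oplus>\<^bsub>Q\<^esub> finsum Q f N"
      using insert.hyps by simp
    also have "\<dots> = coset (g \<gamma>) \<oplus>\<^bsub>Q\<^esub> coset (sum g N)"
      using insert by simp
    also have "\<dots> = coset (sum g (insert \<gamma> N))"
      using insert.prems insert.hyps by (simp add: add_Q closed_sum)
    finally show ?case .
  qed
qed

definition component :: "('x \<Rightarrow> 'g::ab_group_add set) \<Rightarrow> 'g \<Rightarrow> ('x word \<Rightarrow>\<^sub>0 'k) set set" where
  "component d = induced_grading A (ideal_of S \<inter> carrier A) d"

lemma component_altdef: "component d \<gamma> = coset ` hom_part A d \<gamma>"
  by (simp add: component_def induced_grading_def hom_part_def coset_def)

lemma hom_part_zero: "0 \<in> hom_part A d \<gamma>"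
  by (simp add: hom_part_def closed_zero)

lemma hom_part_add: "p \<in> hom_part A d \<gamma> \<Longrightarrow> q \<in> hom_part A d \<gamma> \<Longrightarrow> p + q \<in> hom_part A d \<gamma>"
  using keys_add[of p q] by (auto simp: hom_part_def closed_add)

lemma hom_part_scale: "p \<in> hom_part A d \<gamma> \<Longrightarrow> scale c p \<in> hom_part A d \<gamma>"
  using keys_scale[of c p] by (auto simp: hom_part_def closed_scale)

lemma hom_part_mult:
  "p \<in> hom_part A d \<gamma> \<Longrightarrow> q \<in> hom_part A d \<delta> \<Longrightarrow> p * q \<in> hom_part A d (\<gamma> + \<delta>)"
  using keys_mult[of p q] word_degrees_append by (fastforce simp: hom_part_def closed_mult)

lemma hom_part_sum:
  "(\<And>a. a \<in> N \<Longrightarrow> f a \<in> hom_part A d \<gamma>) \<Longrightarrow> sum f N \<in> hom_part A d \<gamma>"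
  by (induction N rule: infinite_finite_induct) (simp_all add: hom_part_zero hom_part_add)

lemma hom_part_carrier: "p \<in> hom_part A d \<gamma> \<Longrightarrow> p \<in> carrier A"
  by (simp add: hom_part_def)

end

lemma quotient_presentation_free: "quotient_presentation (free_algebra Y)"
  by unfold_locales (auto intro: free_intros)

lemma quotient_presentation_free_nonunital: "quotient_presentation (free_nonunital_algebra Y)"
  by unfold_locales (auto intro: free_nonunital_intros dest: free_nonunitalD)

subsection \<open>Graded isomorphisms\<close>

text \<open>In contrast to \<open>graded_isomorphic\<close>, the families of components are not yet
  known to be gradings, so this notion can be used to transport directness. Zero is mentioned
  separately because \<open>closed_algebra\<close> provides only monoids, where additivity does not
  force its preservation.\<close>

definition grading_preserving_iso ::
  "('k, 'a) module \<Rightarrow> ('g \<Rightarrow> 'a set) \<Rightarrow> ('k, 'b) module \<Rightarrow> ('g \<Rightarrow> 'b set) \<Rightarrow> ('a \<Rightarrow> 'b) \<Rightarrow> bool" where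
  "grading_preserving_iso A G B G' \<phi> \<longleftrightarrow>
     algebra_iso A B \<phi> \<and> \<phi> \<zero>\<^bsub>A\<^esub> = \<zero>\<^bsub>B\<^esub> \<and> (\<forall>\<gamma>. G \<gamma> \<subseteq> carrier A \<and> \<phi> ` G \<gamma> = G' \<gamma>)"

lemma grading_preserving_iso_trans:
  assumes "grading_preserving_iso A G B G' \<phi>" "grading_preserving_iso B G' C G'' \<psi>"
  shows "grading_preserving_iso A G C G'' (\<psi> \<circ> \<phi>)"
proof -
  have "\<phi> x \<in> carrier B" if "x \<in> carrier A" for x
    using assms(1) that unfolding grading_preserving_iso_def algebra_iso_def by (auto dest: bij_betwE)
  moreover have "(\<psi> \<circ> \<phi>) ` G \<gamma> = G'' \<gamma>" for \<gamma>
    using assms unfolding grading_preserving_iso_def by (metis image_comp)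
  moreover have "bij_betw (\<psi> \<circ> \<phi>) (carrier A) (carrier C)"
    using assms unfolding grading_preserving_iso_def algebra_iso_def by (metis bij_betw_trans)
  ultimately show ?thesis
    using assms unfolding grading_preserving_iso_def algebra_iso_def by simp
qed

lemma grading_preserving_iso_sym:
  assumes \<phi>: "grading_preserving_iso A G B G' \<phi>" and A: "closed_algebra A"
  shows "grading_preserving_iso B G' A G (the_inv_into (carrier A) \<phi>)"
proof -
  interpret A: closed_algebra A by (rule A)
  let ?\<psi> = "the_inv_into (carrier A) \<phi>"
  have bij: "bij_betw \<phi> (carrier A) (carrier B)"
    using \<phi> by (simp add: grading_preserving_iso_def algebra_iso_def)
  have inv: "?\<psi> (\<phi> x) = x" if "x \<in> carrier A" for x
    using bij that by (simp add: bij_betw_def the_inv_into_f_f)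
  have surj: "\<exists>x\<in>carrier A. y = \<phi> x" if "y \<in> carrier B" for y
    using bij that by (auto simp: bij_betw_def)
  have hom: "\<phi> (x \<oplus>\<^bsub>A\<^esub> y) = \<phi> x \<oplus>\<^bsub>B\<^esub> \<phi> y" "\<phi> (x \<otimes>\<^bsub>A\<^esub> y) = \<phi> x \<otimes>\<^bsub>B\<^esub> \<phi> y"
    "\<phi> (c \<odot>\<^bsub>A\<^esub> x) = c \<odot>\<^bsub>B\<^esub> \<phi> x"
    if "x \<in> carrier A" "y \<in> carrier A" for x y c
    using \<phi> that by (auto simp: grading_preserving_iso_def algebra_iso_def)
  have G: "G \<gamma> \<subseteq> carrier A" "G' \<gamma> = \<phi> ` G \<gamma>" for \<gamma>
    using \<phi> by (auto simp: grading_preserving_iso_def)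
  have "algebra_iso B A ?\<psi>"
    unfolding algebra_iso_def
  proof (intro conjI ballI allI)
    show "bij_betw ?\<psi> (carrier B) (carrier A)"
      using bij by (rule bij_betw_the_inv_into)
  next
    fix x y assume "x \<in> carrier B" "y \<in> carrier B"
    then obtain a b where "a \<in> carrier A" "b \<in> carrier A" "x = \<phi> a" "y = \<phi> b"
      using surj by meson
    then show "?\<psi> (x \<oplus>\<^bsub>B\<^esub> y) = ?\<psi> x \<oplus>\<^bsub>A\<^esub> ?\<psi> y" "?\<psi> (x \<otimes>\<^bsub>B\<^esub> y) = ?\<psi> x \<otimes>\<^bsub>A\<^esub> ?\<psi> y"
      by (simp_all add: inv A.mult_closed flip: hom)
  next
    fix c x assume "x \<in> carrier B"
    then obtain a where "a \<in> carrier A" "x = \<phi> a"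
      using surj by meson
    then show "?\<psi> (c \<odot>\<^bsub>B\<^esub> x) = c \<odot>\<^bsub>A\<^esub> ?\<psi> x"
      by (simp add: inv A.smult_closed flip: hom)
  qed
  moreover have "?\<psi> \<zero>\<^bsub>B\<^esub> = \<zero>\<^bsub>A\<^esub>"
    using \<phi> inv[OF A.zero_closed] by (simp add: grading_preserving_iso_def)
  moreover have "G' \<gamma> \<subseteq> carrier B" for \<gamma>
    using G[of \<gamma>] bij by (auto simp: bij_betw_def)
  moreover have "?\<psi> ` G' \<gamma> = G \<gamma>" for \<gamma>
  proof -
    have "?\<psi> ` G' \<gamma> = (\<lambda>x. ?\<psi> (\<phi> x)) ` G \<gamma>" by (simp only: G(2) image_image)
    also have "\<dots> = (\<lambda>x. x) ` G \<gamma>" using G(1) inv by (intro image_cong) auto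
    finally show ?thesis by simp
  qed
  ultimately show ?thesis by (simp add: grading_preserving_iso_def)
qed

text \<open>Being injective and preserving zero, \<phi> keeps the support of a family of components.
  Finite homogeneous decompositions of \<open>x\<close> therefore correspond to those of
  \<open>\<phi> x\<close>, and existence and uniqueness carry over.\<close>

lemma algebra_grading_transport:
  assumes \<phi>: "grading_preserving_iso A G B G' \<phi>" and A: "closed_algebra A" and B: "closed_algebra B"
    and grading: "algebra_grading B G'"
  shows "algebra_grading A G"
proof -
  interpret A: closed_algebra A by (rule A)
  interpret B: closed_algebra B by (rule B)
  have bij: "bij_betw \<phi> (carrier A) (carrier B)"
    using \<phi> by (simp add: grading_preserving_iso_def algebra_iso_def)
  have in_B: "\<phi> x \<in> carrier B" if "x \<in> carrier A" for x
    using bij that by (auto dest: bij_betwE)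
  have inj: "\<phi> x = \<phi> y \<longleftrightarrow> x = y" if "x \<in> carrier A" "y \<in> carrier A" for x y
    using bij that by (auto simp: bij_betw_def inj_on_eq_iff)
  have add: "\<phi> (x \<oplus>\<^bsub>A\<^esub> y) = \<phi> x \<oplus>\<^bsub>B\<^esub> \<phi> y" if "x \<in> carrier A" "y \<in> carrier A" for x y
    using \<phi> that by (auto simp: grading_preserving_iso_def algebra_iso_def)
  have mult: "\<phi> (x \<otimes>\<^bsub>A\<^esub> y) = \<phi> x \<otimes>\<^bsub>B\<^esub> \<phi> y" if "x \<in> carrier A" "y \<in> carrier A" for x y
    using \<phi> that by (auto simp: grading_preserving_iso_def algebra_iso_def)
  have smult: "\<phi> (c \<odot>\<^bsub>A\<^esub> x) = c \<odot>\<^bsub>B\<^esub> \<phi> x" if "x \<in> carrier A" for x c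
    using \<phi> that by (auto simp: grading_preserving_iso_def algebra_iso_def)
  have zero: "\<phi> \<zero>\<^bsub>A\<^esub> = \<zero>\<^bsub>B\<^esub>"
    using \<phi> by (simp add: grading_preserving_iso_def)
  have G: "G \<gamma> \<subseteq> carrier A" "G' \<gamma> = \<phi> ` G \<gamma>" for \<gamma>
    using \<phi> by (auto simp: grading_preserving_iso_def)
  have mem: "x \<in> G \<gamma> \<longleftrightarrow> \<phi> x \<in> G' \<gamma>" if "x \<in> carrier A" for x \<gamma>
    using that G[of \<gamma>] inj by blast
  have finsum: "\<phi> (finsum A f N) = finsum B (\<lambda>\<gamma>. \<phi> (f \<gamma>)) N"
    if "finite N" "\<And>\<gamma>. \<gamma> \<in> N \<Longrightarrow> f \<gamma> \<in> carrier A" for f and N :: "'c set"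
    using that
  proof (induction N)
    case (insert \<gamma> N)
    then have "f \<in> N \<rightarrow> carrier A" "(\<lambda>\<gamma>. \<phi> (f \<gamma>)) \<in> N \<rightarrow> carrier B"
      by (auto intro: in_B)
    with insert show ?case by (simp add: add in_B)
  qed (simp add: zero)
  define decomposition where "decomposition x f \<longleftrightarrow> (\<forall>\<gamma>. f \<gamma> \<in> G \<gamma>) \<and> finite {\<gamma>. f \<gamma> \<noteq> \<zero>\<^bsub>A\<^esub>} \<and>
    x = finsum A f {\<gamma>. f \<gamma> \<noteq> \<zero>\<^bsub>A\<^esub>}" for x f
  define decomposition' where "decomposition' x f \<longleftrightarrow> (\<forall>\<gamma>. f \<gamma> \<in> G' \<gamma>) \<and> finite {\<gamma>. f \<gamma> \<noteq> \<zero>\<^bsub>B\<^esub>} \<and>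
    x = finsum B f {\<gamma>. f \<gamma> \<noteq> \<zero>\<^bsub>B\<^esub>}" for x f
  have decomposition_iff: "decomposition x f \<longleftrightarrow> decomposition' (\<phi> x) (\<lambda>\<gamma>. \<phi> (f \<gamma>))"
    if x: "x \<in> carrier A" and f: "\<And>\<gamma>. f \<gamma> \<in> carrier A" for x f
  proof -
    have supp: "{\<gamma>. \<phi> (f \<gamma>) \<noteq> \<zero>\<^bsub>B\<^esub>} = {\<gamma>. f \<gamma> \<noteq> \<zero>\<^bsub>A\<^esub>}"
      using inj[OF f A.zero_closed] by (simp add: zero)
    have "x = finsum A f N \<longleftrightarrow> \<phi> x = finsum B (\<lambda>\<gamma>. \<phi> (f \<gamma>)) N" if "finite N" for N
    proof -
      have "finsum A f N \<in> carrier A" using f by (auto intro: A.finsum_closed)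
      then show ?thesis
        using finsum[of N f] f that inj[of x "finsum A f N"] x by simp
    qed
    then show ?thesis
      unfolding decomposition_def decomposition'_def supp using mem[OF f] by auto
  qed
  have decomposition_closed: "f \<gamma> \<in> carrier A" if "decomposition x f" for x f \<gamma>
    using that G(1) by (auto simp: decomposition_def)
  have G'_closed: "\<zero>\<^bsub>B\<^esub> \<in> G' \<gamma>" "x \<in> G' \<gamma> \<Longrightarrow> y \<in> G' \<gamma> \<Longrightarrow> x \<oplus>\<^bsub>B\<^esub> y \<in> G' \<gamma>"
    "x \<in> G' \<gamma> \<Longrightarrow> c \<odot>\<^bsub>B\<^esub> x \<in> G' \<gamma>"
    "x \<in> G' \<gamma> \<Longrightarrow> y \<in> G' \<delta> \<Longrightarrow> x \<otimes>\<^bsub>B\<^esub> y \<in> G' (\<gamma> + \<delta>)" for x y \<gamma> \<delta> c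
    using grading unfolding algebra_grading_def by blast+
  have unique': "\<exists>!f. decomposition' y f" if "y \<in> carrier B" for y
    using grading that by (simp add: algebra_grading_def decomposition'_def)
  have unique_decomposition: "f = f'"
    if "y \<in> carrier B" "decomposition' y f" "decomposition' y f'" for y f f'
    using unique'[OF that(1)] that(2,3) by (metis (no_types))
  have "\<exists>!f. decomposition x f" if x: "x \<in> carrier A" for x
  proof (rule ex_ex1I)
    from unique'[OF in_B[OF x]] obtain g where g: "decomposition' (\<phi> x) g" by blast
    then have "\<forall>\<gamma>. \<exists>a\<in>G \<gamma>. g \<gamma> = \<phi> a" using G(2) by (auto simp: decomposition'_def)
    then obtain f where f: "\<And>\<gamma>. f \<gamma> \<in> G \<gamma>" "\<And>\<gamma>. g \<gamma> = \<phi> (f \<gamma>)" by metis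
    then have "g = (\<lambda>\<gamma>. \<phi> (f \<gamma>))" by blast
    moreover have "f \<gamma> \<in> carrier A" for \<gamma> using f(1) G(1) by blast
    ultimately have "decomposition x f" using g decomposition_iff[OF x, of f] by simp
    then show "\<exists>f. decomposition x f" by blast
  next
    fix f f' assume *: "decomposition x f" "decomposition x f'"
    note closed = decomposition_closed[OF *(1)] decomposition_closed[OF *(2)]
    have "(\<lambda>\<gamma>. \<phi> (f \<gamma>)) = (\<lambda>\<gamma>. \<phi> (f' \<gamma>))"
      using * decomposition_iff[OF x, of f] decomposition_iff[OF x, of f'] closed
      by (intro unique_decomposition[OF in_B[OF x]]) simp_all
    then have "\<phi> (f \<gamma>) = \<phi> (f' \<gamma>)" for \<gamma> by (rule fun_cong)
    then show "f = f'" using inj[OF closed] by (intro ext) simp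
  qed
  moreover have "\<zero>\<^bsub>A\<^esub> \<in> G \<gamma>" for \<gamma>
    using G'_closed(1) by (simp add: mem zero)
  moreover have "x \<oplus>\<^bsub>A\<^esub> y \<in> G \<gamma>" if "x \<in> G \<gamma>" "y \<in> G \<gamma>" for x y \<gamma>
  proof -
    have "x \<in> carrier A" "y \<in> carrier A" using that G(1) by blast+
    then show ?thesis using G'_closed(2) that by (simp add: mem add)
  qed
  moreover have "c \<odot>\<^bsub>A\<^esub> x \<in> G \<gamma>" if "x \<in> G \<gamma>" for x c \<gamma>
  proof -
    have "x \<in> carrier A" using that G(1) by blast
    then show ?thesis using G'_closed(3) that by (simp add: mem smult A.smult_closed)
  qed
  moreover have "x \<otimes>\<^bsub>A\<^esub> y \<in> G (\<gamma> + \<delta>)" if "x \<in> G \<gamma>" "y \<in> G \<delta>" for x y \<gamma> \<delta>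
  proof -
    have "x \<in> carrier A" "y \<in> carrier A" using that G(1) by blast+
    then show ?thesis using G'_closed(4) that by (simp add: mem mult A.mult_closed)
  qed
  ultimately show ?thesis
    using G(1) unfolding algebra_grading_def decomposition_def by (intro conjI allI ballI) auto
qed

subsection \<open>Quotients of free algebras by homogeneous relations\<close>

text \<open>Splitting a polynomial into homogeneous parts requires a single degree per letter;
  \<open>word_degrees\<close> specializes to this by \<open>word_degrees_singleton\<close>.\<close>

definition word_degree :: "('x \<Rightarrow> 'g::ab_group_add) \<Rightarrow> 'x word \<Rightarrow> 'g" where
  "word_degree dg w = sum_list (map dg (letters w))"

lemma word_degree_plus: "word_degree dg (v + w) = word_degree dg v + word_degree dg w"
  by (simp add: word_degree_def)

lemma word_degrees_singleton:
  "\<gamma> \<in> word_degrees (\<lambda>x. {dg x}) xs \<longleftrightarrow> \<gamma> = word_degree dg (Word xs)"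
  by (induction xs arbitrary: \<gamma>) (auto simp: word_degree_def)

definition homogeneous_part ::
  "('x \<Rightarrow> 'g::ab_group_add) \<Rightarrow> 'g \<Rightarrow> ('x word \<Rightarrow>\<^sub>0 'k::field) \<Rightarrow> 'x word \<Rightarrow>\<^sub>0 'k" where
  "homogeneous_part dg \<gamma> p =
     (\<Sum>w\<in>{w \<in> Poly_Mapping.keys p. word_degree dg w = \<gamma>}.
        Poly_Mapping.single w (Poly_Mapping.lookup p w))"

lemma lookup_homogeneous_part:
  "Poly_Mapping.lookup (homogeneous_part dg \<gamma> p) w =
     (if word_degree dg w = \<gamma> then Poly_Mapping.lookup p w else 0)"
proof -
  have "Poly_Mapping.lookup (homogeneous_part dg \<gamma> p) w =
    (\<Sum>v\<in>{w \<in> Poly_Mapping.keys p. word_degree dg w = \<gamma>}.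
        if w = v then Poly_Mapping.lookup p w else 0)"
    unfolding homogeneous_part_def lookup_sum
    by (intro sum.cong) (auto simp: lookup_single when_def)
  also have "\<dots> = (if word_degree dg w = \<gamma> then Poly_Mapping.lookup p w else 0)"
    by (auto simp: in_keys_iff)
  finally show ?thesis .
qed

lemma homogeneous_part_add:
  "homogeneous_part dg \<gamma> (p + q) = homogeneous_part dg \<gamma> p + homogeneous_part dg \<gamma> q"
  by (rule poly_mapping_eqI) (simp add: lookup_homogeneous_part lookup_add)

lemma homogeneous_part_zero: "homogeneous_part dg \<gamma> 0 = 0"
  by (simp add: homogeneous_part_def)

lemma homogeneous_part_sum:
  "homogeneous_part dg \<gamma> (sum f A) = (\<Sum>a\<in>A. homogeneous_part dg \<gamma> (f a))"
  by (induction A rule: infinite_finite_induct)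
    (simp_all add: homogeneous_part_zero homogeneous_part_add)

lemma homogeneous_part_diff:
  "homogeneous_part dg \<gamma> (p - q) = homogeneous_part dg \<gamma> p - homogeneous_part dg \<gamma> q"
  by (rule poly_mapping_eqI) (simp add: lookup_homogeneous_part lookup_minus)

lemma homogeneous_part_single:
  "homogeneous_part dg \<gamma> (Poly_Mapping.single w c) =
     (if word_degree dg w = \<gamma> then Poly_Mapping.single w c else 0)"
  by (rule poly_mapping_eqI) (auto simp: lookup_homogeneous_part lookup_single when_def)

lemma homogeneous_part_of_homogeneous:
  assumes "\<And>w. w \<in> Poly_Mapping.keys p \<Longrightarrow> word_degree dg w = \<delta>"
  shows "homogeneous_part dg \<gamma> p = (if \<gamma> = \<delta> then p else 0)"
proof (rule poly_mapping_eqI)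
  fix w
  show "Poly_Mapping.lookup (homogeneous_part dg \<gamma> p) w =
    Poly_Mapping.lookup (if \<gamma> = \<delta> then p else 0) w"
    using assms[of w] by (auto simp: lookup_homogeneous_part in_keys_iff)
qed

lemma homogeneous_part_single_mult:
  "homogeneous_part dg \<gamma> (Poly_Mapping.single w c * p) =
     Poly_Mapping.single w c * homogeneous_part dg (\<gamma> - word_degree dg w) p"
proof (induction p rule: poly_mapping_single_induct)
  case (single v d)
  have "word_degree dg (w + v) = \<gamma> \<longleftrightarrow> word_degree dg v = \<gamma> - word_degree dg w"
    by (auto simp: word_degree_plus algebra_simps)
  then show ?case by (simp add: mult_single homogeneous_part_single)
qed (simp add: homogeneous_part_add distrib_left)

lemma homogeneous_part_mult_single:
  "homogeneous_part dg \<gamma> (p * Poly_Mapping.single w c) =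
     homogeneous_part dg (\<gamma> - word_degree dg w) p * Poly_Mapping.single w c"
proof (induction p rule: poly_mapping_single_induct)
  case (single v d)
  have "word_degree dg (v + w) = \<gamma> \<longleftrightarrow> word_degree dg v = \<gamma> - word_degree dg w"
    by (auto simp: word_degree_plus algebra_simps)
  then show ?case by (simp add: mult_single homogeneous_part_single)
qed (simp add: homogeneous_part_add distrib_right)

text \<open>An ideal generated by homogeneous elements is homogeneous: multiplication by a monomial
  only shifts degrees, and a general multiplier is a sum of monomials. Because of the shift, the
  induction has to cover all degrees at once.\<close>

lemma homogeneous_part_in_ideal:
  assumes homogeneous: "\<And>s. s \<in> S \<Longrightarrow> \<exists>\<delta>. \<forall>w\<in>Poly_Mapping.keys s. word_degree dg w = \<delta>"
    and p: "p \<in> ideal_of S"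
  shows "homogeneous_part dg \<gamma> p \<in> ideal_of S"
  using p
proof (induction arbitrary: \<gamma>)
  case (base s)
  then obtain \<delta> where "\<And>w. w \<in> Poly_Mapping.keys s \<Longrightarrow> word_degree dg w = \<delta>"
    using homogeneous by blast
  with base show ?case
    by (simp add: homogeneous_part_of_homogeneous ideal_of.intros)
next
  case (left x a)
  show ?case
    by (induction a rule: poly_mapping_single_induct)
      (simp_all add: homogeneous_part_single_mult distrib_right homogeneous_part_add
        ideal_of.add ideal_of.left left.IH)
next
  case (right x a)
  show ?case
    by (induction a rule: poly_mapping_single_induct)
      (simp_all add: homogeneous_part_mult_single distrib_left homogeneous_part_add
        ideal_of.add ideal_of.right right.IH)
qed (simp_all add: homogeneous_part_zero homogeneous_part_add ideal_of.intros)

lemma sum_homogeneous_parts: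
  "(\<Sum>\<gamma>\<in>word_degree dg ` Poly_Mapping.keys p. homogeneous_part dg \<gamma> p) = p"
proof (rule poly_mapping_eqI)
  fix w
  show "Poly_Mapping.lookup
      (\<Sum>\<gamma>\<in>word_degree dg ` Poly_Mapping.keys p. homogeneous_part dg \<gamma> p) w =
    Poly_Mapping.lookup p w"
    by (auto simp: lookup_sum lookup_homogeneous_part in_keys_iff)
qed

lemma keys_homogeneous_part: "Poly_Mapping.keys (homogeneous_part dg \<gamma> p) \<subseteq> Poly_Mapping.keys p"
  by (auto simp: in_keys_iff lookup_homogeneous_part split: if_splits)

text \<open>By homogeneity of the ideal, taking the part of degree \<gamma> is well defined on
  residue classes. Applied to any homogeneous decomposition it returns the component at \<gamma>,
  which gives uniqueness; the parts of a representative give existence.\<close>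

lemma algebra_grading_free_quotient:
  fixes dg :: "'x \<Rightarrow> 'g::ab_group_add" and S :: "('x word \<Rightarrow>\<^sub>0 'k::field) set"
  assumes homogeneous: "\<And>s. s \<in> S \<Longrightarrow> \<exists>\<delta>. \<forall>w\<in>Poly_Mapping.keys s. word_degree dg w = \<delta>"
  shows "algebra_grading (quotient_algebra (free_algebra Y) (ideal_of S \<inter> free Y))
    (induced_grading (free_algebra Y) (ideal_of S \<inter> free Y) (\<lambda>x. {dg x}))"
proof -
  interpret quotient_presentation "free_algebra Y" S by (rule quotient_presentation_free)
  define d where "d = (\<lambda>x. {dg x})"
  have hom_part_iff: "p \<in> hom_part (free_algebra Y) d \<gamma> \<longleftrightarrow>
      p \<in> free Y \<and> (\<forall>w\<in>Poly_Mapping.keys p. word_degree dg w = \<gamma>)" for p :: "'x word \<Rightarrow>\<^sub>0 'k" and \<gamma>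
    unfolding hom_part_def d_def word_degrees_singleton by auto
  have part: "homogeneous_part dg \<gamma> p \<in> hom_part (free_algebra Y) d \<gamma>" if "p \<in> free Y"
    for p :: "'x word \<Rightarrow>\<^sub>0 'k" and \<gamma>
    using that keys_homogeneous_part[of dg \<gamma> p]
    by (auto simp: hom_part_iff free_iff in_keys_iff lookup_homogeneous_part split: if_splits)
  have part_closed: "homogeneous_part dg \<gamma> p \<in> free Y" if "p \<in> free Y"
    for p :: "'x word \<Rightarrow>\<^sub>0 'k" and \<gamma>
    using part[OF that] by (simp add: hom_part_iff)
  have residue_part: "residue S (homogeneous_part dg \<gamma> p) = residue S (homogeneous_part dg \<gamma> q)"
    if "residue S p = residue S q" for p q \<gamma>
    using that homogeneous_part_in_ideal[OF homogeneous]
    by (simp add: residue_eq_iff flip: homogeneous_part_diff)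
  define decomposition where "decomposition x f \<longleftrightarrow>
    (\<forall>\<gamma>. f \<gamma> \<in> component d \<gamma>) \<and> finite {\<gamma>. f \<gamma> \<noteq> \<zero>\<^bsub>Q\<^esub>} \<and> x = finsum Q f {\<gamma>. f \<gamma> \<noteq> \<zero>\<^bsub>Q\<^esub>}" for x f
  have decomposition_parts: "decomposition (coset p) (\<lambda>\<gamma>. coset (homogeneous_part dg \<gamma> p))"
    if p: "p \<in> free Y" for p
  proof -
    let ?f = "\<lambda>\<gamma>. coset (homogeneous_part dg \<gamma> p)"
    let ?D = "word_degree dg ` Poly_Mapping.keys p"
    have f_zero: "?f \<gamma> = \<zero>\<^bsub>Q\<^esub> \<longleftrightarrow> residue S (homogeneous_part dg \<gamma> p) = 0" for \<gamma>
      using part_closed[OF p] by (simp add: zero_Q coset_eq_iff closed_zero residue_zero)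
    \<comment> \<open>Only an inclusion holds, since a nonzero part of \<open>p\<close> can vanish
      modulo the ideal.\<close>
    have supp: "{\<gamma>. ?f \<gamma> \<noteq> \<zero>\<^bsub>Q\<^esub>} \<subseteq> ?D"
    proof
      fix \<gamma> assume "\<gamma> \<in> {\<gamma>. ?f \<gamma> \<noteq> \<zero>\<^bsub>Q\<^esub>}"
      then have "homogeneous_part dg \<gamma> p \<noteq> 0" by (auto simp: f_zero residue_zero)
      then have "{w \<in> Poly_Mapping.keys p. word_degree dg w = \<gamma>} \<noteq> {}"
        unfolding homogeneous_part_def by (metis sum.empty)
      then show "\<gamma> \<in> ?D" by auto
    qed
    then have fin: "finite {\<gamma>. ?f \<gamma> \<noteq> \<zero>\<^bsub>Q\<^esub>}" by (rule finite_subset) simp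
    have "residue S (\<Sum>\<gamma>\<in>{\<gamma>. ?f \<gamma> \<noteq> \<zero>\<^bsub>Q\<^esub>}. homogeneous_part dg \<gamma> p) =
      residue S (\<Sum>\<gamma>\<in>?D. homogeneous_part dg \<gamma> p)"
      unfolding residue_sum by (rule sum.mono_neutral_left) (use supp in \<open>auto simp: f_zero\<close>)
    then have "coset p = coset (\<Sum>\<gamma>\<in>{\<gamma>. ?f \<gamma> \<noteq> \<zero>\<^bsub>Q\<^esub>}. homogeneous_part dg \<gamma> p)"
      using p by (subst coset_eq_iff) (simp_all add: closed_sum part_closed sum_homogeneous_parts)
    also have "\<dots> = finsum Q ?f {\<gamma>. ?f \<gamma> \<noteq> \<zero>\<^bsub>Q\<^esub>}"
      using fin part_closed[OF p] by (intro finsum_Q[symmetric]) simp_all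
    finally show ?thesis
      using fin part[OF p] by (simp add: decomposition_def component_altdef)
  qed
  have unique: "f = (\<lambda>\<gamma>. coset (homogeneous_part dg \<gamma> p))"
    if p: "p \<in> free Y" and f: "decomposition (coset p) f" for p f
  proof
    fix \<gamma>
    have "\<forall>\<gamma>. \<exists>q\<in>hom_part (free_algebra Y) d \<gamma>. f \<gamma> = coset q"
      using f unfolding decomposition_def component_altdef by blast
    then obtain g where g: "\<And>\<gamma>. g \<gamma> \<in> hom_part (free_algebra Y) d \<gamma>" "\<And>\<gamma>. f \<gamma> = coset (g \<gamma>)"
      by metis
    have g_closed: "g \<gamma> \<in> free Y" for \<gamma> using g(1) by (simp add: hom_part_iff)
    let ?N = "{\<gamma>. f \<gamma> \<noteq> \<zero>\<^bsub>Q\<^esub>}"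
    have fin: "finite ?N" using f by (simp add: decomposition_def)
    have "coset p = finsum Q f ?N" using f by (simp add: decomposition_def)
    also have "\<dots> = coset (sum g ?N)"
      using fin g_closed g(2) by (rule finsum_Q)
    finally have "residue S p = residue S (sum g ?N)"
      using p by (subst (asm) coset_eq_iff) (simp_all add: closed_sum g_closed)
    then have "residue S (homogeneous_part dg \<gamma> p) = residue S (homogeneous_part dg \<gamma> (sum g ?N))"
      by (rule residue_part)
    also have "homogeneous_part dg \<gamma> (sum g ?N) = (\<Sum>\<delta>\<in>?N. if \<gamma> = \<delta> then g \<delta> else 0)"
      unfolding homogeneous_part_sum using g(1)
      by (intro sum.cong refl homogeneous_part_of_homogeneous) (simp add: hom_part_iff)
    also have "\<dots> = (if \<gamma> \<in> ?N then g \<gamma> else 0)"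
      using fin by simp
    \<comment> \<open>Off the support the representative \<open>g \<gamma>\<close> need not be the
      zero polynomial, but its residue is zero.\<close>
    also have "residue S \<dots> = residue S (g \<gamma>)"
    proof (cases "\<gamma> \<in> ?N")
      case False
      then have "coset (g \<gamma>) = coset 0" by (simp add: zero_Q flip: g(2))
      then show ?thesis using False by (simp add: coset_eq_iff g_closed closed_zero)
    qed simp
    finally show "f \<gamma> = coset (homogeneous_part dg \<gamma> p)"
      by (simp add: g(2) coset_eq_iff g_closed part_closed p)
  qed
  have ex1: "\<exists>!f. decomposition x f" if "x \<in> carrier Q" for x
  proof -
    from that obtain p where p: "p \<in> free Y" "x = coset p" by (auto simp: carrier_Q)
    show ?thesis
      unfolding p(2) using decomposition_parts[OF p(1)] unique[OF p(1)] by (rule ex1I)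
  qed
  have "algebra_grading Q (component d)"
    unfolding algebra_grading_def
  proof (intro conjI allI ballI)
    fix \<gamma>
    show "component d \<gamma> \<subseteq> carrier Q"
      by (auto simp: component_altdef carrier_Q hom_part_carrier)
    show "\<zero>\<^bsub>Q\<^esub> \<in> component d \<gamma>"
      by (simp add: zero_Q component_altdef hom_part_zero)
  next
    fix \<gamma> x y assume "x \<in> component d \<gamma>" "y \<in> component d \<gamma>"
    then obtain p q where "x = coset p" "y = coset q" "p \<in> hom_part (free_algebra Y) d \<gamma>"
      "q \<in> hom_part (free_algebra Y) d \<gamma>"
      by (auto simp: component_altdef)
    then show "x \<oplus>\<^bsub>Q\<^esub> y \<in> component d \<gamma>"
      by (simp add: component_altdef add_Q[OF hom_part_carrier hom_part_carrier] hom_part_add)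
  next
    fix \<gamma> c x assume "x \<in> component d \<gamma>"
    then obtain p where "x = coset p" "p \<in> hom_part (free_algebra Y) d \<gamma>"
      by (auto simp: component_altdef)
    then show "c \<odot>\<^bsub>Q\<^esub> x \<in> component d \<gamma>"
      by (simp add: component_altdef smult_Q[OF hom_part_carrier] hom_part_scale)
  next
    fix \<gamma> \<delta> x y assume "x \<in> component d \<gamma>" "y \<in> component d \<delta>"
    then obtain p q where "x = coset p" "y = coset q" "p \<in> hom_part (free_algebra Y) d \<gamma>"
      "q \<in> hom_part (free_algebra Y) d \<delta>"
      by (auto simp: component_altdef)
    then show "x \<otimes>\<^bsub>Q\<^esub> y \<in> component d (\<gamma> + \<delta>)"
      by (simp add: component_altdef mult_Q[OF hom_part_carrier hom_part_carrier] hom_part_mult)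
  next
    fix x assume "x \<in> carrier Q"
    then show "\<exists>!f. (\<forall>\<gamma>. f \<gamma> \<in> component d \<gamma>) \<and> finite {\<gamma>. f \<gamma> \<noteq> \<zero>\<^bsub>Q\<^esub>} \<and>
        x = finsum Q f {\<gamma>. f \<gamma> \<noteq> \<zero>\<^bsub>Q\<^esub>}"
      using ex1 by (simp add: decomposition_def)
  qed
  then show ?thesis
    by (simp add: Q_def component_def d_def)
qed

subsection \<open>Isomorphisms between presented algebras\<close>

text \<open>The map \<open>h\<close> is arbitrary because the result is applied both to
  substitutions and to the inclusion of the nonunital free algebra. Surjectivity is also required
  degree by degree: a preimage supplied by \<open>h_surj\<close> alone may fail to be
  homogeneous.\<close>

lemma grading_preserving_iso_presentations:
  fixes d :: "'x \<Rightarrow> 'g::ab_group_add set" and d' :: "'y \<Rightarrow> 'g set"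
    and A :: "('k::field, 'x word \<Rightarrow>\<^sub>0 'k) module" and B :: "('k, 'y word \<Rightarrow>\<^sub>0 'k) module"
  assumes A: "quotient_presentation A" and B: "quotient_presentation B"
    and h_closed: "\<And>p. p \<in> carrier A \<Longrightarrow> h p \<in> carrier B"
    and h_hom: "\<And>p q. h (p + q) = h p + h q" "\<And>p q. h (p * q) = h p * h q"
      "\<And>c p. h (scale c p) = scale c (h p)" "h 0 = 0"
    and h_zero_iff: "\<And>p. p \<in> carrier A \<Longrightarrow> residue T (h p) = 0 \<longleftrightarrow> residue S p = 0"
    and h_surj: "\<And>q. q \<in> carrier B \<Longrightarrow> \<exists>p\<in>carrier A. residue T (h p) = residue T q"
    and h_deg: "\<And>p \<gamma>. p \<in> hom_part A d \<gamma> \<Longrightarrow> h p \<in> hom_part B d' \<gamma>"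
    and h_deg_surj: "\<And>q \<gamma>. q \<in> hom_part B d' \<gamma> \<Longrightarrow>
      \<exists>p\<in>hom_part A d \<gamma>. residue T (h p) = residue T q"
  shows "\<exists>\<phi>. grading_preserving_iso
    (quotient_algebra A (ideal_of S \<inter> carrier A)) (induced_grading A (ideal_of S \<inter> carrier A) d)
    (quotient_algebra B (ideal_of T \<inter> carrier B)) (induced_grading B (ideal_of T \<inter> carrier B) d') \<phi>"
proof -
  interpret A: quotient_presentation A S by (rule A)
  interpret B: quotient_presentation B T by (rule B)
  let ?QA = "A.Q" and ?QB = "B.Q"
  have h_eq_iff: "residue T (h p) = residue T (h q) \<longleftrightarrow> residue S p = residue S q"
    if "p \<in> carrier A" "q \<in> carrier A" for p q
  proof -
    have "h p = h (p - q) + h q" using h_hom(1)[of "p - q" q] by simp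
    then show ?thesis
      using h_zero_iff[of "p - q"] that
      by (simp add: residue_simps A.closed_diff)
  qed
  \<comment> \<open>A class is mapped through some representative; \<open>h_eq_iff\<close> makes the
    choice immaterial.\<close>
  define \<phi> where "\<phi> x = B.coset (h (SOME p. p \<in> carrier A \<and> A.coset p = x))" for x
  have \<phi>: "\<phi> (A.coset p) = B.coset (h p)" if "p \<in> carrier A" for p
  proof -
    define q where "q = (SOME q. q \<in> carrier A \<and> A.coset q = A.coset p)"
    have "q \<in> carrier A \<and> A.coset q = A.coset p"
      unfolding q_def by (rule someI[of _ p]) (simp add: that)
    then have "q \<in> carrier A" "residue S q = residue S p"
      using that A.coset_eq_iff[of q p] by simp_all
    then show ?thesis
      unfolding \<phi>_def q_def[symmetric] using that
      by (simp add: B.coset_eq_iff h_closed h_eq_iff)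
  qed
  have "inj_on \<phi> (carrier A.Q)"
  proof (rule inj_onI)
    fix x y assume "x \<in> carrier A.Q" "y \<in> carrier A.Q" and eq: "\<phi> x = \<phi> y"
    then obtain p q where pq: "x = A.coset p" "y = A.coset q" "p \<in> carrier A" "q \<in> carrier A"
      by (auto simp: A.carrier_Q)
    with eq show "x = y"
      by (simp add: \<phi> A.coset_eq_iff B.coset_eq_iff h_closed h_eq_iff)
  qed
  moreover have "\<phi> ` carrier A.Q = carrier B.Q"
  proof (rule equalityI; rule subsetI)
    fix y assume "y \<in> carrier B.Q"
    then obtain q where q: "q \<in> carrier B" "y = B.coset q" by (auto simp: B.carrier_Q)
    with h_surj obtain p where p: "p \<in> carrier A" "residue T (h p) = residue T q" by blast
    then have "y = \<phi> (A.coset p)" using q by (simp add: \<phi> B.coset_eq_iff h_closed)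
    then show "y \<in> \<phi> ` carrier A.Q" using p(1) by (auto simp: A.carrier_Q)
  qed (auto simp: A.carrier_Q B.carrier_Q \<phi> h_closed)
  moreover have "\<phi> ` A.component d \<gamma> = B.component d' \<gamma>" for \<gamma>
  proof (rule equalityI; rule subsetI)
    fix y assume "y \<in> B.component d' \<gamma>"
    then obtain q where q: "q \<in> hom_part B d' \<gamma>" "y = B.coset q" by (auto simp: B.component_altdef)
    with h_deg_surj obtain p where p: "p \<in> hom_part A d \<gamma>" "residue T (h p) = residue T q" by blast
    then have "y = \<phi> (A.coset p)"
      using q A.hom_part_carrier[OF p(1)] B.hom_part_carrier[OF q(1)]
      by (simp add: \<phi> B.coset_eq_iff h_closed)
    then show "y \<in> \<phi> ` A.component d \<gamma>" using p(1) by (auto simp: A.component_altdef)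
  next
    fix y assume "y \<in> \<phi> ` A.component d \<gamma>"
    then obtain p where p: "p \<in> hom_part A d \<gamma>" "y = \<phi> (A.coset p)"
      by (auto simp: A.component_altdef)
    then have "y = B.coset (h p)" by (simp add: \<phi> A.hom_part_carrier)
    then show "y \<in> B.component d' \<gamma>" using h_deg[OF p(1)] by (simp add: B.component_altdef)
  qed
  moreover have "A.component d \<gamma> \<subseteq> carrier A.Q" for \<gamma>
    by (auto simp: A.component_altdef A.carrier_Q A.hom_part_carrier)
  moreover have "\<phi> \<zero>\<^bsub>?QA\<^esub> = \<zero>\<^bsub>?QB\<^esub>"
    by (simp add: A.zero_Q B.zero_Q \<phi> A.closed_zero h_hom)
  moreover have "\<phi> (x \<oplus>\<^bsub>?QA\<^esub> y) = \<phi> x \<oplus>\<^bsub>?QB\<^esub> \<phi> y \<and> \<phi> (x \<otimes>\<^bsub>?QA\<^esub> y) = \<phi> x \<otimes>\<^bsub>?QB\<^esub> \<phi> y"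
    if xy: "x \<in> carrier A.Q" "y \<in> carrier A.Q" for x y
  proof -
    from xy obtain p q where "x = A.coset p" "y = A.coset q" "p \<in> carrier A" "q \<in> carrier A"
      by (auto simp: A.carrier_Q)
    then show ?thesis
      by (simp add: \<phi> A.add_Q B.add_Q A.mult_Q B.mult_Q h_closed h_hom A.closed_add A.closed_mult)
  qed
  moreover have "\<phi> (c \<odot>\<^bsub>?QA\<^esub> x) = c \<odot>\<^bsub>?QB\<^esub> \<phi> x" if x: "x \<in> carrier A.Q" for x c
  proof -
    from x obtain p where "x = A.coset p" "p \<in> carrier A"
      by (auto simp: A.carrier_Q)
    then show ?thesis
      by (simp add: \<phi> A.smult_Q B.smult_Q h_closed h_hom A.closed_scale)
  qed
  ultimately have "grading_preserving_iso A.Q (A.component d) B.Q (B.component d') \<phi>"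
    by (simp add: grading_preserving_iso_def algebra_iso_def bij_betw_def)
  then show ?thesis
    unfolding A.Q_def B.Q_def A.component_def B.component_def by blast
qed

text \<open>A letter with several degrees must be sent into all the corresponding spans at once.
  This is how the zero coefficient, which has every degree, is accommodated.\<close>

lemma subst_hom_part:
  assumes "p \<in> hom_part (free_algebra Y) d \<gamma>"
    and t: "\<And>y \<delta>. y \<in> Y \<Longrightarrow> \<delta> \<in> d y \<Longrightarrow> t y \<in> hom_part (free_algebra Z) d' \<delta>"
  shows "subst t p \<in> hom_part (free_algebra Z) d' \<gamma>"
proof -
  interpret Z: quotient_presentation "free_algebra Z" "{}" by (rule quotient_presentation_free)
  have single: "subst t (Poly_Mapping.single (Word xs) c) \<in> hom_part (free_algebra Z) d' \<delta>"
    if "set xs \<subseteq> Y" "\<delta> \<in> word_degrees d xs" for xs c \<delta>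
    using that
  proof (induction xs arbitrary: \<delta>)
    case Nil
    then show ?case
      by (simp add: Word_Nil subst_single_Nil hom_part_def free_single)
  next
    case (Cons x xs)
    then obtain \<alpha> \<beta> where "\<delta> = \<alpha> + \<beta>" "\<alpha> \<in> d x" "\<beta> \<in> word_degrees d xs" by auto
    with Cons show ?case
      by (simp add: single_Cons subst_mult subst_gen Z.hom_part_mult t)
  qed
  have "subst t (\<Sum>w\<in>Poly_Mapping.keys p. Poly_Mapping.single w (Poly_Mapping.lookup p w))
    \<in> hom_part (free_algebra Z) d' \<gamma>"
    unfolding subst_sum
  proof (rule Z.hom_part_sum)
    fix w assume "w \<in> Poly_Mapping.keys p"
    then have "set (letters w) \<subseteq> Y" "\<gamma> \<in> word_degrees d (letters w)"
      using assms(1) by (auto simp: hom_part_def free_iff)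
    from single[OF this] show "subst t (Poly_Mapping.single w (Poly_Mapping.lookup p w))
      \<in> hom_part (free_algebra Z) d' \<gamma>" by simp
  qed
  then show ?thesis by (simp add: poly_mapping_sum_singles)
qed

lemma gen_hom_part: "x \<in> Y \<Longrightarrow> \<gamma> \<in> d x \<Longrightarrow> gen x \<in> hom_part (free_algebra Y) d \<gamma>"
  by (simp add: hom_part_def free_gen) (simp add: gen_def)

text \<open>The substitutions descend to the quotients by \<open>rel\<close> and
  \<open>rel'\<close>. Injectivity comes from \<open>inv\<close>, surjectivity from
  \<open>inv'\<close>, and homogeneous preimages from \<open>dg'\<close>.\<close>

lemma grading_preserving_iso_subst:
  fixes d :: "'x \<Rightarrow> 'g::ab_group_add set" and d' :: "'y \<Rightarrow> 'g set"
    and t :: "'x \<Rightarrow> 'y word \<Rightarrow>\<^sub>0 'k::field" and t' :: "'y \<Rightarrow> 'x word \<Rightarrow>\<^sub>0 'k"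
  assumes t: "\<And>y. y \<in> Y \<Longrightarrow> t y \<in> free Z" and t': "\<And>z. z \<in> Z \<Longrightarrow> t' z \<in> free Y"
    and rel: "\<And>s. s \<in> S \<Longrightarrow> residue T (subst t s) = 0"
    and rel': "\<And>s. s \<in> T \<Longrightarrow> residue S (subst t' s) = 0"
    and inv: "\<And>y. y \<in> Y \<Longrightarrow> residue S (subst t' (t y)) = residue S (gen y)"
    and inv': "\<And>z. z \<in> Z \<Longrightarrow> residue T (subst t (t' z)) = residue T (gen z)"
    and dg: "\<And>y \<delta>. y \<in> Y \<Longrightarrow> \<delta> \<in> d y \<Longrightarrow> t y \<in> hom_part (free_algebra Z) d' \<delta>"
    and dg': "\<And>z \<delta>. z \<in> Z \<Longrightarrow> \<delta> \<in> d' z \<Longrightarrow> t' z \<in> hom_part (free_algebra Y) d \<delta>"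
  shows "\<exists>\<phi>. grading_preserving_iso
    (quotient_algebra (free_algebra Y) (ideal_of S \<inter> free Y))
    (induced_grading (free_algebra Y) (ideal_of S \<inter> free Y) d)
    (quotient_algebra (free_algebra Z) (ideal_of T \<inter> free Z))
    (induced_grading (free_algebra Z) (ideal_of T \<inter> free Z) d') \<phi>"
proof (rule grading_preserving_iso_presentations[where h = "subst t"])
  fix p :: "'x word \<Rightarrow>\<^sub>0 'k" assume p: "p \<in> free Y"
  show "residue T (subst t p) = 0 \<longleftrightarrow> residue S p = 0"
  proof
    assume "residue T (subst t p) = 0"
    then have "residue S (subst t' (subst t p)) = 0"
      using rel' by (rule residue_subst_zero[rotated])
    then show "residue S p = 0" using residue_subst_id[OF p, of S t' t] inv by simp
  qed (rule residue_subst_zero[OF rel])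
next
  fix q :: "'y word \<Rightarrow>\<^sub>0 'k" assume q: "q \<in> free Z"
  show "\<exists>p\<in>free Y. residue T (subst t p) = residue T q"
    using subst_in_free[OF q, of t' Y] residue_subst_id[OF q, of T t t'] t' inv' by blast
next
  fix q :: "'y word \<Rightarrow>\<^sub>0 'k" and \<gamma> assume q: "q \<in> hom_part (free_algebra Z) d' \<gamma>"
  then have "q \<in> free Z" by (simp add: hom_part_def)
  then show "\<exists>p\<in>hom_part (free_algebra Y) d \<gamma>. residue T (subst t p) = residue T q"
    using subst_hom_part[OF q, of t' Y d] residue_subst_id[of q Z T t t'] dg' inv' by blast
qed (simp_all add: quotient_presentation_free subst_simps subst_in_free t subst_hom_part dg)

section \<open>Adjoining a unit to a nonunital presentation that already has a unit
  \<open>E\<close>\<close>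

context
  fixes Y :: "'x set" and S :: "('x word \<Rightarrow>\<^sub>0 'k::field) set" and E :: "'x word \<Rightarrow>\<^sub>0 'k"
  assumes S: "S \<subseteq> free_nonunital Y" and E: "E \<in> free_nonunital Y"
    and E_left: "\<And>y. y \<in> Y \<Longrightarrow> residue S (E * gen y) = residue S (gen y)"
    and E_right: "\<And>y. y \<in> Y \<Longrightarrow> residue S (gen y * E) = residue S (gen y)"
begin

text \<open>Every word of a nonunital polynomial has an initial letter, and that letter absorbs
  \<open>E\<close>.\<close>

lemma residue_unit_nonunital:
  assumes "p \<in> free_nonunital Y"
  shows "residue S (E * p) = residue S p"
proof -
  have single: "residue S (E * Poly_Mapping.single w c) = residue S (Poly_Mapping.single w c)"
    if w: "w \<in> Poly_Mapping.keys p" for w c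
  proof -
    obtain x xs where "w = Word (x # xs)" "x \<in> Y"
      using assms w by (cases w; cases "letters w") (force simp: free_nonunital_iff')+
    then show ?thesis
      using E_left[of x] by (simp add: single_Cons residue_simps mult.assoc[symmetric])
  qed
  have "residue S (E * (\<Sum>w\<in>Poly_Mapping.keys p. Poly_Mapping.single w (Poly_Mapping.lookup p w))) =
    residue S (\<Sum>w\<in>Poly_Mapping.keys p. Poly_Mapping.single w (Poly_Mapping.lookup p w))"
    by (simp add: sum_distrib_left residue_sum single)
  then show ?thesis by (simp add: poly_mapping_sum_singles)
qed

lemma residue_unit_nonunital_right:
  assumes "p \<in> free_nonunital Y"
  shows "residue S (p * E) = residue S p"
proof -
  have single: "residue S (Poly_Mapping.single w c * E) = residue S (Poly_Mapping.single w c)"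
    if w: "w \<in> Poly_Mapping.keys p" for w c
  proof -
    obtain x xs where "w = Word (xs @ [x])" "x \<in> Y"
      using assms w by (cases w; cases "letters w" rule: rev_cases) (force simp: free_nonunital_iff')+
    then show ?thesis
      using E_right[of x] by (simp add: single_snoc residue_simps mult.assoc)
  qed
  have "residue S ((\<Sum>w\<in>Poly_Mapping.keys p. Poly_Mapping.single w (Poly_Mapping.lookup p w)) * E) =
    residue S (\<Sum>w\<in>Poly_Mapping.keys p. Poly_Mapping.single w (Poly_Mapping.lookup p w))"
    by (simp add: sum_distrib_right residue_sum single)
  then show ?thesis by (simp add: poly_mapping_sum_singles)
qed

text \<open>Multiplication by \<open>E\<close> removes the constant term, so the product can absorb
  another \<open>E\<close> on the right.\<close>

lemma residue_unit_central:
  assumes "p \<in> free Y"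
  shows "residue S (E * p) = residue S (E * p * E)"
proof -
  have "E * p \<in> free_nonunital Y" using E assms by (rule free_nonunital_mult)
  then show ?thesis by (simp add: residue_unit_nonunital_right)
qed

text \<open>Left multiplication by \<open>E\<close> maps the ideal of the enlarged relations into that of \<open>S\<close>.\<close>

lemma residue_adjoin_unit_iff:
  assumes p: "p \<in> free_nonunital Y"
  shows "residue (insert (1 - E) S) p = 0 \<longleftrightarrow> residue S p = 0"
proof
  assume "residue S p = 0"
  then have "p \<in> ideal_of S" by (simp add: residue_eq_zero_iff)
  then have "p \<in> ideal_of (insert (1 - E) S)"
    by induction (auto intro: ideal_of.intros)
  then show "residue (insert (1 - E) S) p = 0" by (simp add: residue_eq_zero_iff)
next
  let ?\<rho> = "restrict_letters Y :: ('x word \<Rightarrow>\<^sub>0 'k) \<Rightarrow> _"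
  assume "residue (insert (1 - E) S) p = 0"
  then have "p \<in> ideal_of (insert (1 - E) S)" by (simp add: residue_eq_zero_iff)
  then have "residue S (E * ?\<rho> p) = 0"
  proof induction
    case (base s)
    show ?case
    proof (cases "s = 1 - E")
      case True
      have "?\<rho> (1 - E) = 1 - E"
        using E by (intro restrict_letters_id) (auto intro: free_intros dest: free_nonunitalD)
      then show ?thesis
        using residue_unit_nonunital[OF E] by (simp add: True right_diff_distrib residue_simps)
    next
      case False
      with base have "s \<in> S" by simp
      then have "s \<in> free Y" using S free_nonunitalD by blast
      with \<open>s \<in> S\<close> show ?thesis by (simp add: restrict_letters_id residue_mult residue_base)
    qed
  next
    case (left x a)
    have "residue S (E * ?\<rho> (a * x)) = residue S (E * ?\<rho> a) * residue S (?\<rho> x)"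
      by (simp add: restrict_letters_def subst_mult residue_simps mult.assoc)
    \<comment> \<open>A second \<open>E\<close> is inserted between the factors by
      \<open>residue_unit_central\<close>, which exposes the induction hypothesis for
      \<open>x\<close>.\<close>
    also have "\<dots> = residue S (E * ?\<rho> a) * residue S (E * ?\<rho> x)"
      by (subst residue_unit_central[OF restrict_letters_in_free]) (simp add: residue_simps mult.assoc)
    finally show ?case by (simp add: left.IH)
  next
    case (right x a)
    then show ?case
      by (simp add: restrict_letters_def subst_mult residue_simps flip: mult.assoc)
  qed (simp_all add: restrict_letters_def subst_simps residue_simps distrib_left)
  then show "residue S p = 0"
    using residue_unit_nonunital[OF p] p by (simp add: restrict_letters_id free_nonunitalD)
qed

text \<open>The inclusion is onto because \<open>q\<close> and the nonunital \<open>E * q\<close>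
  agree once \<open>E\<close> equals \<open>1\<close>. As \<open>E\<close> has degree zero, this
  preimage stays in the degree of \<open>q\<close>.\<close>

lemma grading_preserving_iso_adjoin_unit:
  fixes d :: "'x \<Rightarrow> 'g::ab_group_add set"
  assumes E_deg: "E \<in> hom_part (free_algebra Y) d 0"
  shows "\<exists>\<phi>. grading_preserving_iso
    (quotient_algebra (free_nonunital_algebra Y) (ideal_of S \<inter> free_nonunital Y))
    (induced_grading (free_nonunital_algebra Y) (ideal_of S \<inter> free_nonunital Y) d)
    (quotient_algebra (free_algebra Y) (ideal_of (insert (1 - E) S) \<inter> free Y))
    (induced_grading (free_algebra Y) (ideal_of (insert (1 - E) S) \<inter> free Y) d) \<phi>"
proof (rule grading_preserving_iso_presentations[where h = "\<lambda>p. p"])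
  interpret Y: quotient_presentation "free_algebra Y" "{}" by (rule quotient_presentation_free)
  let ?T = "insert (1 - E) S"
  have "residue ?T (1 - E) = 0" by (rule residue_base) simp
  then have "residue ?T E = residue ?T 1" by (simp add: residue_diff)
  then have E_one: "residue ?T (E * q) = residue ?T q" for q
    by (simp add: residue_mult residue_one_left)
  show "\<exists>p\<in>free_nonunital Y. residue ?T p = residue ?T q" if "q \<in> free Y" for q
    using free_nonunital_mult(1)[OF E that] E_one by blast
  show "\<exists>p\<in>hom_part (free_nonunital_algebra Y) d \<gamma>. residue ?T p = residue ?T q"
    if "q \<in> hom_part (free_algebra Y) d \<gamma>" for q \<gamma>
  proof -
    have "q \<in> free Y" using that by (simp add: hom_part_def)
    then have "E * q \<in> hom_part (free_nonunital_algebra Y) d \<gamma>"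
      using Y.hom_part_mult[OF E_deg that] free_nonunital_mult(1)[OF E] by (simp add: hom_part_def)
    then show ?thesis using E_one by blast
  qed
qed (auto simp: quotient_presentation_free quotient_presentation_free_nonunital
    residue_adjoin_unit_iff hom_part_def dest: free_nonunitalD)

end

section \<open>Idempotent matrices and Leavitt relations\<close>

text \<open>
  In a frame the pairs of a column \<open>P _ a\<close> and a row \<open>Q a _\<close> with \<open>\<sigma> a = l\<close> are dual bases of the image of
  an idempotent matrix \<open>E\<^sub>l\<close> over the field, and \<open>E = \<Sum>\<^sub>l v\<^sub>l E\<^sub>l\<close>.
\<close>

locale frame = k_algebra sm for sm :: "'k::field \<Rightarrow> 'a::ring_1 \<Rightarrow> 'a" +
  fixes I :: "'i set" and \<sigma> :: "'i \<Rightarrow> 'v" and v :: "'v \<Rightarrow> 'a"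
    and P :: "nat \<Rightarrow> 'i \<Rightarrow> 'k" and Q :: "'i \<Rightarrow> nat \<Rightarrow> 'k" and m :: nat
  assumes finite_I: "finite I"
    and v_orth: "a \<in> I \<Longrightarrow> b \<in> I \<Longrightarrow> v (\<sigma> a) * v (\<sigma> b) = (if \<sigma> a = \<sigma> b then v (\<sigma> a) else 0)"
    and dual: "a \<in> I \<Longrightarrow> b \<in> I \<Longrightarrow> \<sigma> a = \<sigma> b \<Longrightarrow>
      (\<Sum>i<m. Q a i * P i b) = (if a = b then 1 else 0)"
begin

definition E :: "nat \<Rightarrow> nat \<Rightarrow> 'a" where
  "E i i' = (\<Sum>a\<in>I. sm (P i a * Q a i') (v (\<sigma> a)))"

text \<open>Duality is available only inside a fibre of \<sigma>. Between different fibres the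
  vector \<open>y\<close> itself must vanish, which the orthogonality of the
  \<open>v (\<sigma> a)\<close> provides in each application.\<close>

lemma dual_sum:
  assumes "a \<in> I" "b \<in> I" "\<sigma> a \<noteq> \<sigma> b \<Longrightarrow> y = 0"
  shows "(\<Sum>i<m. sm (Q a i * P i b) y) = (if a = b then y else 0)"
proof -
  have "(\<Sum>i<m. sm (Q a i * P i b) y) = sm (\<Sum>i<m. Q a i * P i b) y"
    by (simp add: sm_sum_left)
  also have "\<dots> = (if a = b then y else 0)"
    using assms dual[of a b] by (cases "\<sigma> a = \<sigma> b") (auto simp: sm_one sm_zero_left sm_zero_right)
  finally show ?thesis .
qed

lemma v_left:
  assumes "a \<in> I" "b \<in> I" "v (\<sigma> b) * y = y"
  shows "v (\<sigma> a) * y = (if \<sigma> a = \<sigma> b then y else 0)"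
proof -
  have "v (\<sigma> a) * y = v (\<sigma> a) * v (\<sigma> b) * y" using assms(3) by (simp add: mult.assoc)
  then show ?thesis using assms v_orth[of a b] by (auto split: if_splits)
qed

lemma v_right:
  assumes "a \<in> I" "b \<in> I" "y * v (\<sigma> b) = y"
  shows "y * v (\<sigma> a) = (if \<sigma> a = \<sigma> b then y else 0)"
proof -
  have "y * v (\<sigma> a) = y * (v (\<sigma> b) * v (\<sigma> a))" using assms(3) by (simp flip: mult.assoc)
  then show ?thesis using assms v_orth[of b a] by (auto split: if_splits)
qed

text \<open>In matrix form this is \<open>P Q P y = P y\<close>. Inside a fibre of \<sigma> it is
  duality; between different fibres \<open>v (\<sigma> a)\<close> annihilates
  \<open>y b\<close>.\<close>

lemma E_left:
  assumes y: "\<And>a. a \<in> I \<Longrightarrow> v (\<sigma> a) * y a = y a"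
  shows "(\<Sum>i'<m. E i i' * (\<Sum>b\<in>I. sm (P i' b) (y b))) = (\<Sum>a\<in>I. sm (P i a) (y a))"
proof -
  have "(\<Sum>i'<m. E i i' * (\<Sum>b\<in>I. sm (P i' b) (y b))) =
    (\<Sum>i'<m. \<Sum>a\<in>I. \<Sum>b\<in>I. sm (P i a) (sm (Q a i' * P i' b) (v (\<sigma> a) * y b)))"
    by (simp add: E_def sum_product sm_mult_left sm_mult_right sm_sm mult.assoc mult.commute
        mult.left_commute)
  also have "\<dots> = (\<Sum>a\<in>I. \<Sum>i'<m. \<Sum>b\<in>I. sm (P i a) (sm (Q a i' * P i' b) (v (\<sigma> a) * y b)))"
    by (rule sum.swap)
  also have "\<dots> = (\<Sum>a\<in>I. \<Sum>b\<in>I. \<Sum>i'<m. sm (P i a) (sm (Q a i' * P i' b) (v (\<sigma> a) * y b)))"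
    by (intro sum.cong refl sum.swap)
  also have "\<dots> = (\<Sum>a\<in>I. \<Sum>b\<in>I. if a = b then sm (P i a) (y a) else 0)"
  proof (intro sum.cong refl)
    fix a b assume ab: "a \<in> I" "b \<in> I"
    have "(\<Sum>i'<m. sm (Q a i' * P i' b) (v (\<sigma> a) * y b)) = (if a = b then v (\<sigma> a) * y b else 0)"
      using ab v_left[of a b "y b"] y by (intro dual_sum) auto
    then show "(\<Sum>i'<m. sm (P i a) (sm (Q a i' * P i' b) (v (\<sigma> a) * y b))) =
        (if a = b then sm (P i a) (y a) else 0)"
      using ab y by (auto simp: sm_zero_right simp flip: sm_sum_right)
  qed
  also have "\<dots> = (\<Sum>a\<in>I. sm (P i a) (y a))"
    using finite_I by simp
  finally show ?thesis .
qed

lemma E_right: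
  assumes y: "\<And>a. a \<in> I \<Longrightarrow> y a * v (\<sigma> a) = y a"
  shows "(\<Sum>i<m. (\<Sum>a\<in>I. sm (Q a i) (y a)) * E i i') = (\<Sum>b\<in>I. sm (Q b i') (y b))"
proof -
  have "(\<Sum>i<m. (\<Sum>a\<in>I. sm (Q a i) (y a)) * E i i') =
    (\<Sum>i<m. \<Sum>a\<in>I. \<Sum>b\<in>I. sm (Q b i') (sm (Q a i * P i b) (y a * v (\<sigma> b))))"
    by (simp add: E_def sum_product sm_mult_left sm_mult_right sm_sm mult.assoc mult.commute
        mult.left_commute)
  also have "\<dots> = (\<Sum>a\<in>I. \<Sum>i<m. \<Sum>b\<in>I. sm (Q b i') (sm (Q a i * P i b) (y a * v (\<sigma> b))))"
    by (rule sum.swap)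
  also have "\<dots> = (\<Sum>a\<in>I. \<Sum>b\<in>I. \<Sum>i<m. sm (Q b i') (sm (Q a i * P i b) (y a * v (\<sigma> b))))"
    by (intro sum.cong refl sum.swap)
  also have "\<dots> = (\<Sum>a\<in>I. \<Sum>b\<in>I. if a = b then sm (Q b i') (y b) else 0)"
  proof (intro sum.cong refl)
    fix a b assume ab: "a \<in> I" "b \<in> I"
    have "(\<Sum>i<m. sm (Q a i * P i b) (y a * v (\<sigma> b))) = (if a = b then y a * v (\<sigma> b) else 0)"
      using ab v_right[of b a "y a"] y by (intro dual_sum) auto
    then show "(\<Sum>i<m. sm (Q b i') (sm (Q a i * P i b) (y a * v (\<sigma> b)))) =
        (if a = b then sm (Q b i') (y b) else 0)"
      using ab y by (auto simp: sm_zero_right simp flip: sm_sum_right)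
  qed
  also have "\<dots> = (\<Sum>b\<in>I. sm (Q b i') (y b))"
    using finite_I by simp
  finally show ?thesis .
qed

lemma E_idempotent: "(\<Sum>i'<m. E i i' * E i' j) = E i j"
proof -
  have E: "E i j = (\<Sum>a\<in>I. sm (P i a) (sm (Q a j) (v (\<sigma> a))))" for i
    by (simp add: E_def sm_sm)
  have "(\<Sum>i'<m. E i i' * (\<Sum>b\<in>I. sm (P i' b) (sm (Q b j) (v (\<sigma> b))))) =
    (\<Sum>a\<in>I. sm (P i a) (sm (Q a j) (v (\<sigma> a))))"
    by (rule E_left) (simp add: sm_mult_right v_orth)
  then show ?thesis by (simp only: E[symmetric])
qed

lemma Q_E:
  assumes a: "a \<in> I"
  shows "(\<Sum>i<m. sm (Q a i) (v (\<sigma> a) * E i i')) = sm (Q a i') (v (\<sigma> a))"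
proof -
  have "(\<Sum>i<m. sm (Q a i) (v (\<sigma> a) * E i i')) =
    (\<Sum>i<m. \<Sum>b\<in>I. sm (Q b i') (sm (Q a i * P i b) (v (\<sigma> a) * v (\<sigma> b))))"
    by (simp add: E_def sum_distrib_left sm_sum_right sm_mult_right sm_sm mult.assoc mult.commute
        mult.left_commute)
  also have "\<dots> = (\<Sum>b\<in>I. \<Sum>i<m. sm (Q b i') (sm (Q a i * P i b) (v (\<sigma> a) * v (\<sigma> b))))"
    by (rule sum.swap)
  also have "\<dots> = (\<Sum>b\<in>I. if a = b then sm (Q b i') (v (\<sigma> a)) else 0)"
  proof (intro sum.cong refl)
    fix b assume b: "b \<in> I"
    have "(\<Sum>i<m. sm (Q a i * P i b) (v (\<sigma> a) * v (\<sigma> b))) =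
        (if a = b then v (\<sigma> a) * v (\<sigma> b) else 0)"
      using a b v_orth by (intro dual_sum) auto
    then show "(\<Sum>i<m. sm (Q b i') (sm (Q a i * P i b) (v (\<sigma> a) * v (\<sigma> b)))) =
        (if a = b then sm (Q b i') (v (\<sigma> a)) else 0)"
      using a b v_orth by (auto simp: sm_zero_right simp flip: sm_sum_right)
  qed
  also have "\<dots> = sm (Q a i') (v (\<sigma> a))"
    using finite_I a by simp
  finally show ?thesis .
qed

end

section \<open>Translation between matrices of symbols and families of edges\<close>

locale frame_pair =
  I: frame sm I \<sigma> v P Q m + J: frame sm J \<rho> v P' Q' n
  for sm :: "'k::field \<Rightarrow> 'a::ring_1 \<Rightarrow> 'a"
    and I :: "'i set" and \<sigma> :: "'i \<Rightarrow> 'v" and v P Q m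
    and J :: "'j set" and \<rho> :: "'j \<Rightarrow> 'v" and P' Q' n
begin

definition to_matrix :: "('i \<Rightarrow> 'j \<Rightarrow> 'a) \<Rightarrow> nat \<Rightarrow> nat \<Rightarrow> 'a" where
  "to_matrix x i j = (\<Sum>a\<in>I. \<Sum>b\<in>J. sm (P i a * Q' b j) (x a b))"

text \<open>The scalar product \<open>Q h P'\<close> does not separate vertices. The outer factors
  \<open>v\<close> cut out the part of \<open>h\<close> that runs between \<open>\<sigma> a\<close>
  and \<open>\<rho> b\<close>.\<close>

definition of_matrix :: "(nat \<Rightarrow> nat \<Rightarrow> 'a) \<Rightarrow> 'i \<Rightarrow> 'j \<Rightarrow> 'a" where
  "of_matrix h a b = (\<Sum>i<m. \<Sum>j<n. sm (Q a i * P' j b) (v (\<sigma> a) * h i j * v (\<rho> b)))"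

lemma to_matrix_altdef:
  "to_matrix x i j = (\<Sum>a\<in>I. sm (P i a) (\<Sum>b\<in>J. sm (Q' b j) (x a b)))"
  "to_matrix x i j = (\<Sum>b\<in>J. sm (Q' b j) (\<Sum>a\<in>I. sm (P i a) (x a b)))"
   apply (simp add: to_matrix_def I.sm_sum_right I.sm_sm)
  apply (simp add: to_matrix_def I.sm_sum_right I.sm_sm sum.swap[of _ J] mult.commute)
  done

lemma absorb_to_matrix:
  assumes "\<And>a b. a \<in> I \<Longrightarrow> b \<in> J \<Longrightarrow> v (\<sigma> a) * x a b = x a b"
    and "\<And>a b. a \<in> I \<Longrightarrow> b \<in> J \<Longrightarrow> x a b * v (\<rho> b) = x a b"
  shows "(\<Sum>i'<m. \<Sum>j'<n. I.E i i' * to_matrix x i' j' * J.E j' j) = to_matrix x i j"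
proof -
  have "(\<Sum>i'<m. \<Sum>j'<n. I.E i i' * to_matrix x i' j' * J.E j' j) =
    (\<Sum>i'<m. I.E i i' * (\<Sum>j'<n. to_matrix x i' j' * J.E j' j))"
    by (simp add: sum_distrib_left mult.assoc)
  also have "\<dots> = (\<Sum>i'<m. I.E i i' * to_matrix x i' j)"
  proof -
    have "(\<Sum>j'<n. to_matrix x i' j' * J.E j' j) = to_matrix x i' j" for i'
      unfolding to_matrix_altdef(2)
      by (rule J.E_right) (simp add: sum_distrib_right I.sm_mult_left assms)
    then show ?thesis by simp
  qed
  also have "\<dots> = to_matrix x i j"
    unfolding to_matrix_altdef(1)
    by (rule I.E_left) (simp add: sum_distrib_left I.sm_mult_right assms)
  finally show ?thesis .
qed

text \<open>In matrix form: \<open>P x Q' P' x* Q\<close> loses the middle \<open>Q' P'\<close> by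
  duality, then \<open>x x*\<close> becomes the diagonal of the \<open>v (\<sigma> a)\<close>, and
  \<open>P v Q\<close> is \<open>E\<close>. With the frames exchanged it also handles the product in
  the other order.\<close>

lemma to_matrix_mult_star:
  assumes x: "\<And>a b. a \<in> I \<Longrightarrow> b \<in> J \<Longrightarrow> x a b * v (\<rho> b) = x a b"
    and xs: "\<And>a b. a \<in> I \<Longrightarrow> b \<in> J \<Longrightarrow> v (\<rho> b) * xs a b = xs a b"
    and x_xs: "\<And>a a'. a \<in> I \<Longrightarrow> a' \<in> I \<Longrightarrow>
      (\<Sum>b\<in>J. x a b * xs a' b) = (if a = a' then v (\<sigma> a) else 0)"
  shows "(\<Sum>j<n. to_matrix x i j * (\<Sum>b\<in>J. \<Sum>a\<in>I. sm (P' j b * Q a i') (xs a b))) = I.E i i'"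
proof -
  define y where "y b = (\<Sum>a\<in>I. sm (P i a) (x a b))" for b
  define z where "z b = (\<Sum>a\<in>I. sm (Q a i') (xs a b))" for b
  have y: "y b * v (\<rho> b) = y b" and z: "v (\<rho> b) * z b = z b" if "b \<in> J" for b
    using that x xs by (simp_all add: y_def z_def sum_distrib_left sum_distrib_right
        I.sm_mult_left I.sm_mult_right)
  have "(\<Sum>j<n. to_matrix x i j * (\<Sum>b\<in>J. \<Sum>a\<in>I. sm (P' j b * Q a i') (xs a b))) =
    (\<Sum>j<n. (\<Sum>b\<in>J. sm (Q' b j) (y b)) * (\<Sum>c\<in>J. sm (P' j c) (z c)))"
    by (simp add: to_matrix_altdef(2) y_def z_def I.sm_sum_right I.sm_sm)
  also have "\<dots> = (\<Sum>j<n. \<Sum>b\<in>J. \<Sum>c\<in>J. sm (Q' b j * P' j c) (y b * z c))"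
    by (simp add: sum_product I.sm_mult_left I.sm_mult_right I.sm_sm mult.commute)
  also have "\<dots> = (\<Sum>b\<in>J. \<Sum>j<n. \<Sum>c\<in>J. sm (Q' b j * P' j c) (y b * z c))"
    by (rule sum.swap)
  also have "\<dots> = (\<Sum>b\<in>J. \<Sum>c\<in>J. \<Sum>j<n. sm (Q' b j * P' j c) (y b * z c))"
    by (intro sum.cong refl sum.swap)
  also have "\<dots> = (\<Sum>b\<in>J. \<Sum>c\<in>J. if b = c then y b * z c else 0)"
  proof (intro sum.cong refl J.dual_sum)
    fix b c assume bc: "b \<in> J" "c \<in> J" "\<rho> b \<noteq> \<rho> c"
    have "y b * z c = y b * (v (\<rho> b) * z c)" using y[OF bc(1)] by (simp flip: mult.assoc)
    then show "y b * z c = 0" using J.v_left[OF bc(1,2) z[OF bc(2)]] bc(3) by simp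
  qed
  also have "\<dots> = (\<Sum>b\<in>J. y b * z b)"
    using J.finite_I by simp
  also have "\<dots> = (\<Sum>b\<in>J. \<Sum>a\<in>I. \<Sum>a'\<in>I. sm (P i a * Q a' i') (x a b * xs a' b))"
    by (simp add: y_def z_def sum_product I.sm_mult_left I.sm_mult_right I.sm_sm mult.commute)
  also have "\<dots> = (\<Sum>a\<in>I. \<Sum>b\<in>J. \<Sum>a'\<in>I. sm (P i a * Q a' i') (x a b * xs a' b))"
    by (rule sum.swap)
  also have "\<dots> = (\<Sum>a\<in>I. \<Sum>a'\<in>I. \<Sum>b\<in>J. sm (P i a * Q a' i') (x a b * xs a' b))"
    by (intro sum.cong refl sum.swap)
  also have "\<dots> = (\<Sum>a\<in>I. \<Sum>a'\<in>I. if a = a' then sm (P i a * Q a' i') (v (\<sigma> a)) else 0)"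
    by (intro sum.cong refl) (auto simp: x_xs I.sm_zero_right simp flip: I.sm_sum_right)
  also have "\<dots> = I.E i i'"
    using I.finite_I by (simp add: I.E_def)
  finally show ?thesis .
qed

lemma of_matrix_absorb:
  assumes "a \<in> I" "b \<in> J"
  shows "v (\<sigma> a) * of_matrix h a b = of_matrix h a b" "of_matrix h a b * v (\<rho> b) = of_matrix h a b"
proof -
  have "v (\<sigma> a) * (v (\<sigma> a) * y) = v (\<sigma> a) * y" for y
    using I.v_orth[OF assms(1,1)] by (simp flip: mult.assoc)
  then show "v (\<sigma> a) * of_matrix h a b = of_matrix h a b"
    by (simp add: of_matrix_def sum_distrib_left I.sm_mult_right mult.assoc)
  show "of_matrix h a b * v (\<rho> b) = of_matrix h a b"
    using J.v_orth[OF assms(2,2)]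
    by (simp add: of_matrix_def sum_distrib_right I.sm_mult_left mult.assoc)
qed

text \<open>In matrix form, with \<open>e\<close> and \<open>f\<close> for the two matrices
  \<open>E\<close>: the product \<open>Q h P' Q' h* P\<close> has \<open>P' Q'\<close> in the
  middle, which the vertices turn into \<open>f\<close>. Since \<open>h f = h\<close>, what remains
  is \<open>Q h h* P = Q e P\<close>, and this is the identity up to vertices.\<close>

lemma of_matrix_mult_star:
  assumes h: "\<And>i j. i < m \<Longrightarrow> j < n \<Longrightarrow> (\<Sum>i'<m. \<Sum>j'<n. I.E i i' * h i' j' * J.E j' j) = h i j"
    and h_hs: "\<And>i i'. i < m \<Longrightarrow> i' < m \<Longrightarrow> (\<Sum>j<n. h i j * hs j i') = I.E i i'"
    and a: "a \<in> I" "a' \<in> I"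
  shows "(\<Sum>b\<in>J. of_matrix h a b * (\<Sum>j<n. \<Sum>i<m. sm (Q' b j * P i a') (v (\<rho> b) * hs j i * v (\<sigma> a')))) =
    (if a = a' then v (\<sigma> a) else 0)"
proof -
  \<comment> \<open>One-sided absorption follows from \<open>h = e h f\<close> because
    \<open>f\<close> is idempotent.\<close>
  have h_right: "(\<Sum>j<n. h i j * J.E j k) = h i k" if "i < m" "k < n" for i k
  proof -
    have "(\<Sum>j<n. h i j * J.E j k) = (\<Sum>j<n. (\<Sum>i'<m. \<Sum>j'<n. I.E i i' * h i' j' * J.E j' j) * J.E j k)"
      using that(1) by (intro sum.cong refl) (simp add: h)
    also have "\<dots> = (\<Sum>j<n. \<Sum>i'<m. \<Sum>j'<n. I.E i i' * h i' j' * (J.E j' j * J.E j k))"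
      by (simp add: sum_distrib_right mult.assoc)
    also have "\<dots> = (\<Sum>i'<m. \<Sum>j<n. \<Sum>j'<n. I.E i i' * h i' j' * (J.E j' j * J.E j k))"
      by (rule sum.swap)
    also have "\<dots> = (\<Sum>i'<m. \<Sum>j'<n. \<Sum>j<n. I.E i i' * h i' j' * (J.E j' j * J.E j k))"
      by (intro sum.cong refl sum.swap)
    also have "\<dots> = (\<Sum>i'<m. \<Sum>j'<n. I.E i i' * h i' j' * J.E j' k)"
      by (simp add: J.E_idempotent flip: sum_distrib_left)
    also have "\<dots> = h i k" using that by (rule h)
    finally show ?thesis .
  qed
  have h_E_hs: "(\<Sum>j<n. \<Sum>k<n. h i j * J.E j k * hs k i') = I.E i i'" if "i < m" "i' < m" for i i'
  proof -
    have "(\<Sum>j<n. \<Sum>k<n. h i j * J.E j k * hs k i') = (\<Sum>k<n. (\<Sum>j<n. h i j * J.E j k) * hs k i')"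
      by (subst sum.swap) (simp add: sum_distrib_right)
    also have "\<dots> = (\<Sum>k<n. h i k * hs k i')"
      using that by (simp add: h_right)
    finally show ?thesis using that by (simp add: h_hs)
  qed
  \<comment> \<open>The scalars \<open>P' j b\<close> and \<open>Q' b k\<close> are grouped around
    \<open>v (\<rho> b)\<close>, so that summation over \<open>b\<close> produces
    \<open>J.E j k\<close>.\<close>
  define f where "f i j k i' b = sm (Q a i * P i' a') (v (\<sigma> a) *
    (h i j * sm (P' j b * Q' b k) (v (\<rho> b)) * hs k i') * v (\<sigma> a'))" for i j k i' b
  have v_idem: "v (\<rho> b) * (v (\<rho> b) * y) = v (\<rho> b) * y" if "b \<in> J" for b y
    using J.v_orth[OF that that] by (simp flip: mult.assoc)
  have "(\<Sum>b\<in>J. of_matrix h a b * (\<Sum>j<n. \<Sum>i<m. sm (Q' b j * P i a') (v (\<rho> b) * hs j i * v (\<sigma> a')))) =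
    (\<Sum>b\<in>J. \<Sum>i<m. \<Sum>j<n. \<Sum>k<n. \<Sum>i'<m. f i j k i' b)"
    unfolding of_matrix_def sum_distrib_right unfolding sum_distrib_left
    by (intro sum.cong refl)
      (simp add: f_def I.sm_mult_left I.sm_mult_right I.sm_sm mult.assoc v_idem mult.commute
        mult.left_commute)
  also have "\<dots> = (\<Sum>i<m. \<Sum>j<n. \<Sum>k<n. \<Sum>i'<m. \<Sum>b\<in>J. f i j k i' b)"
    by (subst sum.swap[of _ _ J], rule sum.cong[OF refl],
        subst sum.swap[of _ _ J], rule sum.cong[OF refl],
        subst sum.swap[of _ _ J], rule sum.cong[OF refl],
        subst sum.swap[of _ _ J], rule refl)
  also have "\<dots> = (\<Sum>i<m. \<Sum>j<n. \<Sum>k<n. \<Sum>i'<m.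
      sm (Q a i * P i' a') (v (\<sigma> a) * (h i j * J.E j k * hs k i') * v (\<sigma> a')))"
    by (simp add: f_def J.E_def sum_distrib_left sum_distrib_right I.sm_sum_right)
  also have "\<dots> = (\<Sum>i<m. \<Sum>i'<m. \<Sum>j<n. \<Sum>k<n.
      sm (Q a i * P i' a') (v (\<sigma> a) * (h i j * J.E j k * hs k i') * v (\<sigma> a')))"
    by (rule sum.cong[OF refl]) (simp only: sum.swap[of _ "{..<m}" "{..<n}"])
  also have "\<dots> = (\<Sum>i<m. \<Sum>i'<m. sm (Q a i * P i' a') (v (\<sigma> a) * I.E i i' * v (\<sigma> a')))"
    by (intro sum.cong refl)
      (simp add: h_E_hs flip: I.sm_sum_right sum_distrib_left sum_distrib_right)
  also have "\<dots> = (\<Sum>i'<m. \<Sum>i<m. sm (P i' a') (sm (Q a i) (v (\<sigma> a) * I.E i i') * v (\<sigma> a')))"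
    by (subst sum.swap) (simp add: I.sm_mult_left I.sm_sm mult.commute)
  also have "\<dots> = (\<Sum>i'<m. sm (Q a i' * P i' a') (v (\<sigma> a) * v (\<sigma> a')))"
    by (simp only: I.Q_E[OF a(1)] I.sm_sum_right[symmetric] sum_distrib_right[symmetric])
      (simp add: I.sm_mult_left I.sm_sm mult.commute)
  also have "\<dots> = (if a = a' then v (\<sigma> a) else 0)"
    using I.dual_sum[OF a] I.v_orth[OF a] by (auto split: if_splits)
  finally show ?thesis .
qed

text \<open>The outer products \<open>P Q\<close> and \<open>P' Q'\<close>, taken together with the
  sandwiching vertices, are the two matrices \<open>E\<close>.\<close>

lemma to_matrix_of_matrix:
  "to_matrix (of_matrix h) i j = (\<Sum>i'<m. \<Sum>j'<n. I.E i i' * h i' j' * J.E j' j)"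
proof -
  define f where "f a b i' j' = sm (P i a * Q' b j) (sm (Q a i' * P' j' b) (v (\<sigma> a) * h i' j' * v (\<rho> b)))"
    for a b i' j'
  have "to_matrix (of_matrix h) i j = (\<Sum>a\<in>I. \<Sum>b\<in>J. \<Sum>i'<m. \<Sum>j'<n. f a b i' j')"
    by (simp add: to_matrix_def of_matrix_def f_def I.sm_sum_right)
  also have "\<dots> = (\<Sum>a\<in>I. \<Sum>i'<m. \<Sum>b\<in>J. \<Sum>j'<n. f a b i' j')"
    by (intro sum.cong refl sum.swap)
  also have "\<dots> = (\<Sum>a\<in>I. \<Sum>i'<m. \<Sum>j'<n. \<Sum>b\<in>J. f a b i' j')"
    by (intro sum.cong refl sum.swap)
  also have "\<dots> = (\<Sum>i'<m. \<Sum>a\<in>I. \<Sum>j'<n. \<Sum>b\<in>J. f a b i' j')"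
    by (rule sum.swap)
  also have "\<dots> = (\<Sum>i'<m. \<Sum>j'<n. \<Sum>a\<in>I. \<Sum>b\<in>J. f a b i' j')"
    by (intro sum.cong refl sum.swap)
  also have "\<dots> = (\<Sum>i'<m. \<Sum>j'<n. \<Sum>b\<in>J. \<Sum>a\<in>I. f a b i' j')"
    by (intro sum.cong refl sum.swap)
  also have "\<dots> = (\<Sum>i'<m. \<Sum>j'<n. I.E i i' * h i' j' * J.E j' j)"
    by (simp add: I.E_def J.E_def f_def sum_distrib_left sum_distrib_right I.sm_mult_left
        I.sm_mult_right I.sm_sm I.sm_sum_right mult.assoc mult.commute mult.left_commute)
  finally show ?thesis .
qed

text \<open>Here the inner products \<open>Q P\<close> and \<open>Q' P'\<close> occur. They are
  identities on each fibre, and terms with other vertices die by \<open>v_left\<close> and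
  \<open>v_right\<close>.\<close>

lemma of_matrix_to_matrix:
  assumes x: "\<And>a b. a \<in> I \<Longrightarrow> b \<in> J \<Longrightarrow> v (\<sigma> a) * x a b = x a b"
    "\<And>a b. a \<in> I \<Longrightarrow> b \<in> J \<Longrightarrow> x a b * v (\<rho> b) = x a b"
    and a: "a \<in> I" and b: "b \<in> J"
  shows "of_matrix (to_matrix x) a b = x a b"
proof -
  define f where "f i j a' b' = sm (Q' b' j * P' j b) (sm (Q a i * P i a') (v (\<sigma> a) * x a' b' * v (\<rho> b)))"
    for i j a' b'
  have "of_matrix (to_matrix x) a b = (\<Sum>i<m. \<Sum>j<n. \<Sum>a'\<in>I. \<Sum>b'\<in>J. f i j a' b')"
    by (simp add: to_matrix_def of_matrix_def f_def I.sm_sum_right sum_distrib_left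
        sum_distrib_right I.sm_mult_left I.sm_mult_right I.sm_sm)
      (simp add: mult.assoc mult.commute mult.left_commute)
  also have "\<dots> = (\<Sum>i<m. \<Sum>a'\<in>I. \<Sum>j<n. \<Sum>b'\<in>J. f i j a' b')"
    by (intro sum.cong refl sum.swap)
  also have "\<dots> = (\<Sum>i<m. \<Sum>a'\<in>I. \<Sum>b'\<in>J. \<Sum>j<n. f i j a' b')"
    by (intro sum.cong refl sum.swap)
  also have "\<dots> = (\<Sum>i<m. \<Sum>a'\<in>I. \<Sum>b'\<in>J.
      if b' = b then sm (Q a i * P i a') (v (\<sigma> a) * x a' b') else 0)"
  proof (intro sum.cong refl)
    fix i a' b' assume ab': "a' \<in> I" "b' \<in> J"
    have "(\<Sum>j<n. f i j a' b') =
        (if b' = b then sm (Q a i * P i a') (v (\<sigma> a) * x a' b' * v (\<rho> b)) else 0)"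
      unfolding f_def
      using J.v_right[of b b' "x a' b'"] x ab' b
      by (intro J.dual_sum) (auto simp: mult.assoc I.sm_zero_right)
    then show "(\<Sum>j<n. f i j a' b') =
        (if b' = b then sm (Q a i * P i a') (v (\<sigma> a) * x a' b') else 0)"
      using x ab' by (auto simp: mult.assoc)
  qed
  also have "\<dots> = (\<Sum>i<m. \<Sum>a'\<in>I. sm (Q a i * P i a') (v (\<sigma> a) * x a' b))"
    using J.finite_I b by simp
  also have "\<dots> = (\<Sum>a'\<in>I. \<Sum>i<m. sm (Q a i * P i a') (v (\<sigma> a) * x a' b))"
    by (rule sum.swap)
  also have "\<dots> = (\<Sum>a'\<in>I. if a = a' then x a' b else 0)"
  proof (intro sum.cong refl)
    fix a' assume a': "a' \<in> I"
    have "(\<Sum>i<m. sm (Q a i * P i a') (v (\<sigma> a) * x a' b)) = (if a = a' then v (\<sigma> a) * x a' b else 0)"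
      using I.v_left[of a a' "x a' b"] x a a' b by (intro I.dual_sum) auto
    then show "(\<Sum>i<m. sm (Q a i * P i a') (v (\<sigma> a) * x a' b)) = (if a = a' then x a' b else 0)"
      using x a' b by simp
  qed
  also have "\<dots> = x a b"
    using I.finite_I a by simp
  finally show ?thesis .
qed

end

text \<open>A rank one idempotent is split off at a nonzero entry \<open>(i0, j0)\<close>:
  \<open>p0\<close> is column \<open>j0\<close>, and \<open>q0\<close> is row \<open>i0\<close>
  divided by that entry, so that idempotence of \<open>x\<close> gives \<open>q0 p0 = 1\<close>. The
  remainder \<open>y = x - p0 q0\<close> is again idempotent, and its row \<open>i0\<close>
  vanishes, so the number of nonzero rows drops. Both vectors are supported in the common degree of
  \<open>i0\<close> and \<open>j0\<close>, which keeps \<open>y\<close> homogeneous.\<close>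

lemma idempotent_factorization:
  fixes x :: "nat \<Rightarrow> nat \<Rightarrow> 'k::field" and \<alpha> :: "nat \<Rightarrow> 'g"
  assumes "\<And>i j. i < n \<Longrightarrow> j < n \<Longrightarrow> (\<Sum>l<n. x i l * x l j) = x i j"
    and "\<And>i j. i < n \<Longrightarrow> j < n \<Longrightarrow> x i j \<noteq> 0 \<Longrightarrow> \<alpha> i = \<alpha> j"
  shows "\<exists>r p q \<delta>. (\<forall>i<n. \<forall>j<n. x i j = (\<Sum>a<r. p i a * q a j)) \<and>
    (\<forall>a<r. \<forall>b<r. (\<Sum>i<n. q a i * p i b) = (if a = b then 1 else 0)) \<and>
    (\<forall>i<n. \<forall>a<r. (p i a \<noteq> 0 \<longrightarrow> \<alpha> i = \<delta> a) \<and> (q a i \<noteq> 0 \<longrightarrow> \<alpha> i = \<delta> (a :: nat)))"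
  using assms
proof (induction "card {i. i < n \<and> (\<exists>j<n. x i j \<noteq> 0)}" arbitrary: x rule: less_induct)
  case less
  note idem = less.prems(1) and hom = less.prems(2)
  show ?case
  proof (cases "\<exists>i<n. \<exists>j<n. x i j \<noteq> 0")
    case False
    then have "(\<forall>i<n. \<forall>j<n. x i j = (\<Sum>a<(0::nat). 0 * 0))" by auto
    then show ?thesis by (intro exI[of _ 0]) auto
  next
    case True
    then obtain i0 j0 where ij0: "i0 < n" "j0 < n" "x i0 j0 \<noteq> 0" by blast
    define p0 where "p0 i = x i j0" for i
    define q0 where "q0 j = x i0 j / x i0 j0" for j
    define y where "y i j = x i j - p0 i * q0 j" for i j
    have x_p0: "(\<Sum>l<n. x i l * p0 l) = p0 i" if "i < n" for i
      using idem that ij0 by (simp add: p0_def)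
    have q0_x: "(\<Sum>l<n. q0 l * x l j) = q0 j" if "j < n" for j
      using idem that ij0 by (simp add: q0_def flip: sum_divide_distrib)
    have q0_p0: "(\<Sum>l<n. q0 l * p0 l) = 1"
      using q0_x[of j0] ij0 by (simp add: p0_def q0_def)
    have y_p0: "(\<Sum>l<n. y i l * p0 l) = 0" if "i < n" for i
    proof -
      have "(\<Sum>l<n. y i l * p0 l) = (\<Sum>l<n. x i l * p0 l) - p0 i * (\<Sum>l<n. q0 l * p0 l)"
        by (simp add: y_def left_diff_distrib sum_subtractf sum_distrib_left mult.assoc)
      then show ?thesis using that by (simp add: x_p0 q0_p0)
    qed
    have q0_y: "(\<Sum>l<n. q0 l * y l j) = 0" if "j < n" for j
    proof -
      have "(\<Sum>l<n. q0 l * y l j) = (\<Sum>l<n. q0 l * x l j) - (\<Sum>l<n. q0 l * p0 l) * q0 j"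
        by (simp add: y_def right_diff_distrib sum_subtractf sum_distrib_right mult.assoc)
      then show ?thesis using that by (simp add: q0_x q0_p0)
    qed
    have y_idem: "(\<Sum>l<n. y i l * y l j) = y i j" if "i < n" "j < n" for i j
    proof -
      have "(\<Sum>l<n. y i l * y l j) = (\<Sum>l<n. y i l * x l j) - (\<Sum>l<n. y i l * p0 l) * q0 j"
        by (simp add: y_def[of _ j] right_diff_distrib sum_subtractf sum_distrib_right mult.assoc)
      also have "(\<Sum>l<n. y i l * x l j) = (\<Sum>l<n. x i l * x l j) - p0 i * (\<Sum>l<n. q0 l * x l j)"
        by (simp add: y_def left_diff_distrib sum_subtractf sum_distrib_left mult.assoc)
      finally show ?thesis using that by (simp add: y_p0 q0_x idem y_def[of i j])
    qed
    have p0_deg: "\<alpha> i = \<alpha> j0" if "i < n" "p0 i \<noteq> 0" for i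
      using that hom ij0 by (simp add: p0_def)
    have q0_deg: "\<alpha> i = \<alpha> j0" if "i < n" "q0 i \<noteq> 0" for i
    proof -
      have "\<alpha> i0 = \<alpha> i" "\<alpha> i0 = \<alpha> j0"
        using that hom[of i0 i] hom[of i0 j0] ij0 by (simp_all add: q0_def)
      then show ?thesis by simp
    qed
    have y_hom: "\<alpha> i = \<alpha> j" if "i < n" "j < n" "y i j \<noteq> 0" for i j
      using that p0_deg[of i] q0_deg[of j] hom[of i j] by (fastforce simp: y_def)
    have "{i. i < n \<and> (\<exists>j<n. y i j \<noteq> 0)} \<subset> {i. i < n \<and> (\<exists>j<n. x i j \<noteq> 0)}"
    proof
      have "y i0 j = 0" for j using ij0(3) by (simp add: y_def p0_def q0_def)
      then show "{i. i < n \<and> (\<exists>j<n. y i j \<noteq> 0)} \<noteq> {i. i < n \<and> (\<exists>j<n. x i j \<noteq> 0)}"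
        using ij0 by blast
      show "{i. i < n \<and> (\<exists>j<n. y i j \<noteq> 0)} \<subseteq> {i. i < n \<and> (\<exists>j<n. x i j \<noteq> 0)}"
      proof
        fix i assume "i \<in> {i. i < n \<and> (\<exists>j<n. y i j \<noteq> 0)}"
        then obtain j where "i < n" "j < n" "y i j \<noteq> 0" by blast
        then have "x i j \<noteq> 0 \<or> x i j0 \<noteq> 0" by (auto simp: y_def p0_def)
        then show "i \<in> {i. i < n \<and> (\<exists>j<n. x i j \<noteq> 0)}"
          using \<open>i < n\<close> \<open>j < n\<close> ij0(2) by blast
      qed
    qed
    then have "card {i. i < n \<and> (\<exists>j<n. y i j \<noteq> 0)} < card {i. i < n \<and> (\<exists>j<n. x i j \<noteq> 0)}"
      by (intro psubset_card_mono) auto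
    from less.hyps[OF this y_idem y_hom] obtain r p q \<delta> where
      fact: "\<And>i j. i < n \<Longrightarrow> j < n \<Longrightarrow> y i j = (\<Sum>a<r. p i a * q a j)" and
      dual: "\<And>a b. a < r \<Longrightarrow> b < r \<Longrightarrow> (\<Sum>i<n. q a i * p i b) = (if a = b then 1 else 0)" and
      deg_p: "\<And>i a. i < n \<Longrightarrow> a < r \<Longrightarrow> p i a \<noteq> 0 \<Longrightarrow> \<alpha> i = \<delta> a" and
      deg_q: "\<And>i a. i < n \<Longrightarrow> a < r \<Longrightarrow> q a i \<noteq> 0 \<Longrightarrow> \<alpha> i = \<delta> (a :: nat)"
      by blast
    have q_y: "(\<Sum>i<n. q a i * y i j) = q a j" if "a < r" "j < n" for a j
    proof -
      have "(\<Sum>i<n. q a i * y i j) = (\<Sum>i<n. \<Sum>b<r. q a i * p i b * q b j)"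
        using that by (simp add: fact sum_distrib_left mult.assoc)
      also have "\<dots> = (\<Sum>b<r. (\<Sum>i<n. q a i * p i b) * q b j)"
        by (subst sum.swap) (simp add: sum_distrib_right)
      also have "\<dots> = (\<Sum>b<r. if a = b then q b j else 0)"
        using that by (intro sum.cong refl) (simp add: dual)
      finally show ?thesis using that by simp
    qed
    have y_p: "(\<Sum>j<n. y i j * p j b) = p i b" if "b < r" "i < n" for b i
    proof -
      have "(\<Sum>j<n. y i j * p j b) = (\<Sum>j<n. \<Sum>a<r. p i a * (q a j * p j b))"
        using that by (simp add: fact sum_distrib_right mult.assoc)
      also have "\<dots> = (\<Sum>a<r. p i a * (\<Sum>j<n. q a j * p j b))"
        by (subst sum.swap) (simp add: sum_distrib_left)
      also have "\<dots> = (\<Sum>a<r. if b = a then p i a else 0)"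
        using that by (intro sum.cong refl) (simp add: dual)
      finally show ?thesis using that by simp
    qed
    \<comment> \<open>The rows found by induction satisfy \<open>q = q y\<close>, and
      \<open>y\<close> annihilates \<open>p0\<close>. The mirror argument with
      \<open>p = y p\<close> and \<open>q0 y = 0\<close> gives the next claim.\<close>
    have q_p0: "(\<Sum>j<n. q a j * p0 j) = 0" if "a < r" for a
    proof -
      have "(\<Sum>j<n. q a j * p0 j) = (\<Sum>j<n. (\<Sum>i<n. q a i * y i j) * p0 j)"
        using that by (intro sum.cong refl) (simp add: q_y)
      also have "\<dots> = (\<Sum>j<n. \<Sum>i<n. q a i * (y i j * p0 j))"
        by (simp add: sum_distrib_right mult.assoc)
      also have "\<dots> = (\<Sum>i<n. q a i * (\<Sum>j<n. y i j * p0 j))"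
        by (subst sum.swap) (simp add: sum_distrib_left)
      finally show ?thesis by (simp add: y_p0)
    qed
    have q0_p: "(\<Sum>i<n. q0 i * p i b) = 0" if "b < r" for b
    proof -
      have "(\<Sum>i<n. q0 i * p i b) = (\<Sum>i<n. q0 i * (\<Sum>j<n. y i j * p j b))"
        using that by (intro sum.cong refl) (simp add: y_p)
      also have "\<dots> = (\<Sum>i<n. \<Sum>j<n. q0 i * y i j * p j b)"
        by (simp add: sum_distrib_left mult.assoc)
      also have "\<dots> = (\<Sum>j<n. (\<Sum>i<n. q0 i * y i j) * p j b)"
        by (subst sum.swap) (simp add: sum_distrib_right)
      finally show ?thesis by (simp add: q0_y)
    qed
    define p' where "p' i a = (if a = r then p0 i else p i a)" for i a
    define q' where "q' a i = (if a = r then q0 i else q a i)" for i a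
    define \<delta>' where "\<delta>' a = (if a = r then \<alpha> j0 else \<delta> a)" for a
    have "\<forall>i<n. \<forall>j<n. x i j = (\<Sum>a<Suc r. p' i a * q' a j)"
    proof (intro allI impI)
      fix i j assume "i < n" "j < n"
      then have "x i j = (\<Sum>a<r. p i a * q a j) + p0 i * q0 j"
        using fact[of i j] by (simp add: y_def diff_eq_eq)
      then show "x i j = (\<Sum>a<Suc r. p' i a * q' a j)" by (simp add: p'_def q'_def)
    qed
    moreover have "\<forall>a<Suc r. \<forall>b<Suc r. (\<Sum>i<n. q' a i * p' i b) = (if a = b then 1 else 0)"
      by (auto simp: p'_def q'_def less_Suc_eq q0_p0 q_p0 q0_p dual)
    moreover have "\<forall>i<n. \<forall>a<Suc r.
        (p' i a \<noteq> 0 \<longrightarrow> \<alpha> i = \<delta>' a) \<and> (q' a i \<noteq> 0 \<longrightarrow> \<alpha> i = \<delta>' a)"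
      using p0_deg q0_deg deg_p deg_q by (auto simp: p'_def q'_def \<delta>'_def less_Suc_eq)
    ultimately show ?thesis by blast
  qed
qed

section \<open>Bergman algebras and Leavitt path algebras\<close>

definition bergman_gens :: "('k, 'r) module \<Rightarrow> ('g, 'u, 'r) idempotent_pairs \<Rightarrow> ('r, 'u) bergman_gen set" where
  "bergman_gens R F = Coef ` carrier R \<union>
      {Sym u i j | u i j. u \<in> index F \<and> i < rows F u \<and> j < cols F u} \<union>
      {SymStar u j i | u i j. u \<in> index F \<and> i < rows F u \<and> j < cols F u}"

definition leavitt_gens :: "('v, 'e, 'i, 'j) hypergraph \<Rightarrow> ('v, 'e, 'i, 'j) leavitt_gen set" where
  "leavitt_gens H = Vertex ` vertices H \<union>
      {Edge h i j | h i j. h \<in> hyperedges H \<and> i \<in> src_index H h \<and> j \<in> rng_index H h} \<union>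
      {EdgeStar h i j | h i j. h \<in> hyperedges H \<and> i \<in> src_index H h \<and> j \<in> rng_index H h}"

text \<open>The added relation has its intended meaning for a finite vertex set; over an infinite
  set the sum is zero by convention.\<close>

definition unital_leavitt_relations ::
  "('v, 'e, 'i, 'j) hypergraph \<Rightarrow> (('v, 'e, 'i, 'j) leavitt_gen word \<Rightarrow>\<^sub>0 'k::field) set" where
  "unital_leavitt_relations H =
     insert (1 - (\<Sum>v\<in>vertices H. gen (Vertex v))) (leavitt_relations H)"

definition unital_leavitt_ideal ::
  "('v, 'e, 'i, 'j) hypergraph \<Rightarrow> (('v, 'e, 'i, 'j) leavitt_gen word \<Rightarrow>\<^sub>0 'k::field) set" where
  "unital_leavitt_ideal H = ideal_of (unital_leavitt_relations H) \<inter> free (leavitt_gens H)"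

definition unital_leavitt_algebra ::
  "('v, 'e, 'i, 'j) hypergraph \<Rightarrow>
   ('k::field, (('v, 'e, 'i, 'j) leavitt_gen word \<Rightarrow>\<^sub>0 'k) set) module" where
  "unital_leavitt_algebra H = quotient_algebra (free_algebra (leavitt_gens H)) (unital_leavitt_ideal H)"

definition unital_leavitt_grading ::
  "('v, 'e, 'i, 'j) hypergraph \<Rightarrow> ('e \<Rightarrow> 'i \<Rightarrow> 'j \<Rightarrow> 'g::ab_group_add) \<Rightarrow>
   'g \<Rightarrow> (('v, 'e, 'i, 'j) leavitt_gen word \<Rightarrow>\<^sub>0 'k::field) set set" where
  "unital_leavitt_grading H w =
     induced_grading (free_algebra (leavitt_gens H)) (unital_leavitt_ideal H) (leavitt_degree w)"

text \<open>Any larger set \<open>T\<close> of relations is allowed, so that the equations serve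
  both the nonunital and the unital presentation.\<close>

lemma leavitt_relationsD:
  fixes H :: "('v, 'e, 'i, 'j) hypergraph"
    and T :: "(('v, 'e, 'i, 'j) leavitt_gen word \<Rightarrow>\<^sub>0 'k::field) set"
  assumes T: "leavitt_relations H \<subseteq> T"
  shows "u \<in> vertices H \<Longrightarrow> v \<in> vertices H \<Longrightarrow>
      residue T (gen (Vertex u)) * residue T (gen (Vertex v)) =
        (if u = v then residue T (gen (Vertex u)) else 0)"
    and "h \<in> hyperedges H \<Longrightarrow> i \<in> src_index H h \<Longrightarrow> j \<in> rng_index H h \<Longrightarrow>
      residue T (gen (Vertex (src H h i))) * residue T (gen (Edge h i j)) = residue T (gen (Edge h i j))"
    and "h \<in> hyperedges H \<Longrightarrow> i \<in> src_index H h \<Longrightarrow> j \<in> rng_index H h \<Longrightarrow>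
      residue T (gen (Edge h i j)) * residue T (gen (Vertex (rng H h j))) = residue T (gen (Edge h i j))"
    and "h \<in> hyperedges H \<Longrightarrow> i \<in> src_index H h \<Longrightarrow> j \<in> rng_index H h \<Longrightarrow>
      residue T (gen (Vertex (rng H h j))) * residue T (gen (EdgeStar h i j)) =
        residue T (gen (EdgeStar h i j))"
    and "h \<in> hyperedges H \<Longrightarrow> i \<in> src_index H h \<Longrightarrow> j \<in> rng_index H h \<Longrightarrow>
      residue T (gen (EdgeStar h i j)) * residue T (gen (Vertex (src H h i))) =
        residue T (gen (EdgeStar h i j))"
    and "h \<in> hyperedges H \<Longrightarrow> i \<in> src_index H h \<Longrightarrow> i' \<in> src_index H h \<Longrightarrow>
      (\<Sum>j\<in>rng_index H h. residue T (gen (Edge h i j)) * residue T (gen (EdgeStar h i' j))) =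
        (if i = i' then residue T (gen (Vertex (src H h i))) else 0)"
    and "h \<in> hyperedges H \<Longrightarrow> j \<in> rng_index H h \<Longrightarrow> j' \<in> rng_index H h \<Longrightarrow>
      (\<Sum>i\<in>src_index H h. residue T (gen (EdgeStar h i j)) * residue T (gen (Edge h i j'))) =
        (if j = j' then residue T (gen (Vertex (rng H h j))) else 0)"
proof -
  have eq: "residue T p = residue T q" if "p - q \<in> leavitt_relations H" for p q
    using that T by (auto simp: residue_eq_iff intro: ideal_of.base)
  have if_residue: "(if b then residue T p else 0) = residue T (if b then p else 0)" for b p
    by (simp add: residue_zero)
  show "residue T (gen (Vertex u)) * residue T (gen (Vertex v)) =
        (if u = v then residue T (gen (Vertex u)) else 0)" if "u \<in> vertices H" "v \<in> vertices H"
    unfolding if_residue residue_mult[symmetric]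
    by (rule eq) (use that in \<open>simp add: leavitt_relations_def, blast\<close>)
  {
    assume h: "h \<in> hyperedges H"
    have mem: "p \<in> leavitt_relations H" if "p \<in> (let I = src_index H h; J = rng_index H h;
            s = (\<lambda>i. gen (Vertex (src H h i))); r = (\<lambda>j. gen (Vertex (rng H h j)));
            x = (\<lambda>i j. gen (Edge h i j)); xs = (\<lambda>i j. gen (EdgeStar h i j))
        in {s i * x i j - x i j | i j. i \<in> I \<and> j \<in> J} \<union>
           {x i j * r j - x i j | i j. i \<in> I \<and> j \<in> J} \<union>
           {r j * xs i j - xs i j | i j. i \<in> I \<and> j \<in> J} \<union>
           {xs i j * s i - xs i j | i j. i \<in> I \<and> j \<in> J} \<union>
           {(\<Sum>j\<in>J. x i j * xs i' j) - (if i = i' then s i else 0) | i i'. i \<in> I \<and> i' \<in> I} \<union>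
           {(\<Sum>i\<in>I. xs i j * x i j') - (if j = j' then r j else 0) | j j'. j \<in> J \<and> j' \<in> J})"
      for p :: "('v, 'e, 'i, 'j) leavitt_gen word \<Rightarrow>\<^sub>0 'k"
      unfolding leavitt_relations_def using h that by (intro UnI2 UN_I)
    note eq' = eq[OF mem, unfolded Let_def]
    show "residue T (gen (Vertex (src H h i))) * residue T (gen (Edge h i j)) = residue T (gen (Edge h i j))"
      if "i \<in> src_index H h" "j \<in> rng_index H h"
      unfolding residue_mult[symmetric] by (rule eq') (use that in blast)
    show "residue T (gen (Edge h i j)) * residue T (gen (Vertex (rng H h j))) = residue T (gen (Edge h i j))"
      if "i \<in> src_index H h" "j \<in> rng_index H h"
      unfolding residue_mult[symmetric] by (rule eq') (use that in blast)
    show "residue T (gen (Vertex (rng H h j))) * residue T (gen (EdgeStar h i j)) =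
        residue T (gen (EdgeStar h i j))"
      if "i \<in> src_index H h" "j \<in> rng_index H h"
      unfolding residue_mult[symmetric] by (rule eq') (use that in blast)
    show "residue T (gen (EdgeStar h i j)) * residue T (gen (Vertex (src H h i))) =
        residue T (gen (EdgeStar h i j))"
      if "i \<in> src_index H h" "j \<in> rng_index H h"
      unfolding residue_mult[symmetric] by (rule eq') (use that in blast)
    show "(\<Sum>j\<in>rng_index H h. residue T (gen (Edge h i j)) * residue T (gen (EdgeStar h i' j))) =
        (if i = i' then residue T (gen (Vertex (src H h i))) else 0)"
      if "i \<in> src_index H h" "i' \<in> src_index H h"
      unfolding if_residue residue_mult[symmetric] residue_sum[symmetric]
      by (rule eq') (use that in blast)
    show "(\<Sum>i\<in>src_index H h. residue T (gen (EdgeStar h i j)) * residue T (gen (Edge h i j'))) =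
        (if j = j' then residue T (gen (Vertex (rng H h j))) else 0)"
      if "j \<in> rng_index H h" "j' \<in> rng_index H h"
      unfolding if_residue residue_mult[symmetric] residue_sum[symmetric]
      by (rule eq') (use that in blast)
  }
qed

lemma subst_leavitt_relations_zero:
  fixes H :: "('v, 'e, 'i, 'j) hypergraph"
    and t :: "('v, 'e, 'i, 'j) leavitt_gen \<Rightarrow> 'x word \<Rightarrow>\<^sub>0 'k::field"
  assumes "\<And>u v. u \<in> vertices H \<Longrightarrow> v \<in> vertices H \<Longrightarrow>
      residue S (t (Vertex u)) * residue S (t (Vertex v)) =
        (if u = v then residue S (t (Vertex u)) else 0)"
    and "\<And>h i j. h \<in> hyperedges H \<Longrightarrow> i \<in> src_index H h \<Longrightarrow> j \<in> rng_index H h \<Longrightarrow>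
      residue S (t (Vertex (src H h i))) * residue S (t (Edge h i j)) = residue S (t (Edge h i j))"
    and "\<And>h i j. h \<in> hyperedges H \<Longrightarrow> i \<in> src_index H h \<Longrightarrow> j \<in> rng_index H h \<Longrightarrow>
      residue S (t (Edge h i j)) * residue S (t (Vertex (rng H h j))) = residue S (t (Edge h i j))"
    and "\<And>h i j. h \<in> hyperedges H \<Longrightarrow> i \<in> src_index H h \<Longrightarrow> j \<in> rng_index H h \<Longrightarrow>
      residue S (t (Vertex (rng H h j))) * residue S (t (EdgeStar h i j)) = residue S (t (EdgeStar h i j))"
    and "\<And>h i j. h \<in> hyperedges H \<Longrightarrow> i \<in> src_index H h \<Longrightarrow> j \<in> rng_index H h \<Longrightarrow>
      residue S (t (EdgeStar h i j)) * residue S (t (Vertex (src H h i))) = residue S (t (EdgeStar h i j))"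
    and "\<And>h i i'. h \<in> hyperedges H \<Longrightarrow> i \<in> src_index H h \<Longrightarrow> i' \<in> src_index H h \<Longrightarrow>
      (\<Sum>j\<in>rng_index H h. residue S (t (Edge h i j)) * residue S (t (EdgeStar h i' j))) =
        (if i = i' then residue S (t (Vertex (src H h i))) else 0)"
    and "\<And>h j j'. h \<in> hyperedges H \<Longrightarrow> j \<in> rng_index H h \<Longrightarrow> j' \<in> rng_index H h \<Longrightarrow>
      (\<Sum>i\<in>src_index H h. residue S (t (EdgeStar h i j)) * residue S (t (Edge h i j'))) =
        (if j = j' then residue S (t (Vertex (rng H h j))) else 0)"
    and s: "s \<in> leavitt_relations H"
  shows "residue S (subst t s) = 0"
  using s unfolding leavitt_relations_def Let_def
  by (elim UnE UN_E CollectE exE conjE; simp add: subst_simps residue_simps assms(1-7))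

lemma (in k_algebra) sum_fibres:
  assumes "finite I" "finite V" "\<sigma> ` I \<subseteq> V"
  shows "(\<Sum>v\<in>V. sm (\<Sum>a\<in>{a \<in> I. \<sigma> a = v}. g a) (y v)) = (\<Sum>a\<in>I. sm (g a) (y (\<sigma> a)))"
proof -
  have "(\<Sum>v\<in>V. sm (\<Sum>a\<in>{a \<in> I. \<sigma> a = v}. g a) (y v)) =
    (\<Sum>v\<in>V. \<Sum>a\<in>{a \<in> I. \<sigma> a = v}. sm (g a) (y (\<sigma> a)))"
    by (intro sum.cong refl) (simp add: sm_sum_left)
  then show ?thesis using sum.group[OF assms, of "\<lambda>a. sm (g a) (y (\<sigma> a))"] by simp
qed

lemma subst_coefficient_relations_zero:
  assumes "\<And>r s. r \<in> carrier R \<Longrightarrow> s \<in> carrier R \<Longrightarrow>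
      residue T (t (Coef (r \<oplus>\<^bsub>R\<^esub> s))) = residue T (t (Coef r)) + residue T (t (Coef s))"
    and "\<And>r s. r \<in> carrier R \<Longrightarrow> s \<in> carrier R \<Longrightarrow>
      residue T (t (Coef (r \<otimes>\<^bsub>R\<^esub> s))) = residue T (t (Coef r)) * residue T (t (Coef s))"
    and "\<And>c r. r \<in> carrier R \<Longrightarrow>
      residue T (t (Coef (c \<odot>\<^bsub>R\<^esub> r))) = scale_residues c (residue T (t (Coef r)))"
    and "residue T (t (Coef \<one>\<^bsub>R\<^esub>)) = residue T 1"
    and s: "s \<in> coefficient_relations R"
  shows "residue T (subst t s) = 0"
  using s unfolding coefficient_relations_def
  by (elim UnE CollectE exE conjE; simp add: subst_simps residue_simps assms(1-4))

lemma subst_bergman_relations_zero: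
  assumes "\<And>u i j. u \<in> index F \<Longrightarrow> i < rows F u \<Longrightarrow> j < cols F u \<Longrightarrow>
      (\<Sum>a<rows F u. \<Sum>b<cols F u. residue T (t (Coef (emat F u i a))) * residue T (t (Sym u a b)) *
        residue T (t (Coef (fmat F u b j)))) = residue T (t (Sym u i j))"
    and "\<And>u i j. u \<in> index F \<Longrightarrow> i < rows F u \<Longrightarrow> j < cols F u \<Longrightarrow>
      (\<Sum>b<cols F u. \<Sum>a<rows F u. residue T (t (Coef (fmat F u j b))) * residue T (t (SymStar u b a)) *
        residue T (t (Coef (emat F u a i)))) = residue T (t (SymStar u j i))"
    and "\<And>u i i'. u \<in> index F \<Longrightarrow> i < rows F u \<Longrightarrow> i' < rows F u \<Longrightarrow>
      (\<Sum>b<cols F u. residue T (t (Sym u i b)) * residue T (t (SymStar u b i'))) =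
        residue T (t (Coef (emat F u i i')))"
    and "\<And>u j j'. u \<in> index F \<Longrightarrow> j < cols F u \<Longrightarrow> j' < cols F u \<Longrightarrow>
      (\<Sum>a<rows F u. residue T (t (SymStar u j a)) * residue T (t (Sym u a j'))) =
        residue T (t (Coef (fmat F u j j')))"
    and s: "s \<in> bergman_relations F"
  shows "residue T (subst t s) = 0"
  using s unfolding bergman_relations_def Let_def
  by (elim UnE UN_E CollectE exE conjE; simp add: subst_simps residue_simps assms(1-4))

text \<open>Common ground for both directions. The maps \<open>co v\<close> identify
  \<open>R\<close> with the functions on the vertices, and each matrix is given by dual bases
  attached to vertices. The index sets of an edge may be empty here: that is the state in which a
  zero matrix leaves them, before vanishing vertices are discarded.\<close>

locale bergman_leavitt =
  fixes R :: "('k::field, 'r) module" and co :: "'v \<Rightarrow> 'r \<Rightarrow> 'k"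
    and F :: "('g::ab_group_add, 'u, 'r) idempotent_pairs"
    and H :: "('v, 'u, 'i, 'j) hypergraph"
    and P :: "'u \<Rightarrow> nat \<Rightarrow> 'i \<Rightarrow> 'k" and Q :: "'u \<Rightarrow> 'i \<Rightarrow> nat \<Rightarrow> 'k"
    and P' :: "'u \<Rightarrow> nat \<Rightarrow> 'j \<Rightarrow> 'k" and Q' :: "'u \<Rightarrow> 'j \<Rightarrow> nat \<Rightarrow> 'k"
    and src_deg :: "'u \<Rightarrow> 'i \<Rightarrow> 'g" and rng_deg :: "'u \<Rightarrow> 'j \<Rightarrow> 'g"
    and w :: "'u \<Rightarrow> 'i \<Rightarrow> 'j \<Rightarrow> 'g"
  assumes finite_vertices: "finite (vertices H)"
    and R_closed: "r \<in> carrier R \<Longrightarrow> s \<in> carrier R \<Longrightarrow> r \<oplus>\<^bsub>R\<^esub> s \<in> carrier R"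
      "r \<in> carrier R \<Longrightarrow> s \<in> carrier R \<Longrightarrow> r \<otimes>\<^bsub>R\<^esub> s \<in> carrier R"
      "r \<in> carrier R \<Longrightarrow> c \<odot>\<^bsub>R\<^esub> r \<in> carrier R" "\<zero>\<^bsub>R\<^esub> \<in> carrier R" "\<one>\<^bsub>R\<^esub> \<in> carrier R"
    and co_hom: "v \<in> vertices H \<Longrightarrow> r \<in> carrier R \<Longrightarrow> s \<in> carrier R \<Longrightarrow> co v (r \<oplus>\<^bsub>R\<^esub> s) = co v r + co v s"
      "v \<in> vertices H \<Longrightarrow> r \<in> carrier R \<Longrightarrow> s \<in> carrier R \<Longrightarrow> co v (r \<otimes>\<^bsub>R\<^esub> s) = co v r * co v s"
      "v \<in> vertices H \<Longrightarrow> r \<in> carrier R \<Longrightarrow> co v (c \<odot>\<^bsub>R\<^esub> r) = c * co v r"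
      "v \<in> vertices H \<Longrightarrow> co v \<zero>\<^bsub>R\<^esub> = 0" "v \<in> vertices H \<Longrightarrow> co v \<one>\<^bsub>R\<^esub> = 1"
    and co_inj: "r \<in> carrier R \<Longrightarrow> s \<in> carrier R \<Longrightarrow> (\<And>v. v \<in> vertices H \<Longrightarrow> co v r = co v s) \<Longrightarrow> r = s"
    and co_surj: "\<exists>r\<in>carrier R. \<forall>v\<in>vertices H. co v r = g v"
    and hyperedges_eq: "hyperedges H = index F"
    and finite_src: "u \<in> index F \<Longrightarrow> finite (src_index H u)"
    and finite_rng: "u \<in> index F \<Longrightarrow> finite (rng_index H u)"
    and src_vertex: "u \<in> index F \<Longrightarrow> a \<in> src_index H u \<Longrightarrow> src H u a \<in> vertices H"
    and rng_vertex: "u \<in> index F \<Longrightarrow> b \<in> rng_index H u \<Longrightarrow> rng H u b \<in> vertices H"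
    and emat_closed: "u \<in> index F \<Longrightarrow> i < rows F u \<Longrightarrow> j < rows F u \<Longrightarrow> emat F u i j \<in> carrier R"
    and fmat_closed: "u \<in> index F \<Longrightarrow> i < cols F u \<Longrightarrow> j < cols F u \<Longrightarrow> fmat F u i j \<in> carrier R"
    and emat_eq: "u \<in> index F \<Longrightarrow> i < rows F u \<Longrightarrow> j < rows F u \<Longrightarrow> v \<in> vertices H \<Longrightarrow>
      co v (emat F u i j) = (\<Sum>a\<in>{a \<in> src_index H u. src H u a = v}. P u i a * Q u a j)"
    and fmat_eq: "u \<in> index F \<Longrightarrow> i < cols F u \<Longrightarrow> j < cols F u \<Longrightarrow> v \<in> vertices H \<Longrightarrow>
      co v (fmat F u i j) = (\<Sum>b\<in>{b \<in> rng_index H u. rng H u b = v}. P' u i b * Q' u b j)"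
    and src_dual: "u \<in> index F \<Longrightarrow> a \<in> src_index H u \<Longrightarrow> a' \<in> src_index H u \<Longrightarrow> src H u a = src H u a' \<Longrightarrow>
      (\<Sum>i<rows F u. Q u a i * P u i a') = (if a = a' then 1 else 0)"
    and rng_dual: "u \<in> index F \<Longrightarrow> b \<in> rng_index H u \<Longrightarrow> b' \<in> rng_index H u \<Longrightarrow> rng H u b = rng H u b' \<Longrightarrow>
      (\<Sum>j<cols F u. Q' u b j * P' u j b') = (if b = b' then 1 else 0)"
    and src_homogeneous: "u \<in> index F \<Longrightarrow> a \<in> src_index H u \<Longrightarrow> i < rows F u \<Longrightarrow>
      P u i a \<noteq> 0 \<or> Q u a i \<noteq> 0 \<Longrightarrow> row_deg F u i = src_deg u a"
    and rng_homogeneous: "u \<in> index F \<Longrightarrow> b \<in> rng_index H u \<Longrightarrow> j < cols F u \<Longrightarrow>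
      P' u j b \<noteq> 0 \<or> Q' u b j \<noteq> 0 \<Longrightarrow> col_deg F u j = rng_deg u b"
    and weight: "u \<in> index F \<Longrightarrow> a \<in> src_index H u \<Longrightarrow> b \<in> rng_index H u \<Longrightarrow>
      w u a b = rng_deg u b - src_deg u a"
begin

abbreviation "V \<equiv> vertices H"

text \<open>For a vertex \<open>v\<close>, the primitive idempotent of \<open>R\<close> at the
  coordinate \<open>v\<close>.\<close>

definition eps :: "'v \<Rightarrow> 'r" where
  "eps v = (SOME r. r \<in> carrier R \<and> (\<forall>u\<in>V. co u r = (if u = v then 1 else 0)))"

lemma eps: "eps v \<in> carrier R" "u \<in> V \<Longrightarrow> co u (eps v) = (if u = v then 1 else 0)"
proof -
  have "\<exists>r. r \<in> carrier R \<and> (\<forall>u\<in>V. co u r = (if u = v then 1 else 0))"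
    using co_surj[of "\<lambda>u. if u = v then 1 else 0"] by blast
  from someI_ex[OF this] show "eps v \<in> carrier R" "u \<in> V \<Longrightarrow> co u (eps v) = (if u = v then 1 else 0)"
    unfolding eps_def by blast+
qed

definition S :: "(('r, 'u) bergman_gen word \<Rightarrow>\<^sub>0 'k) set" where
  "S = coefficient_relations R \<union> bergman_relations F"

definition T :: "(('v, 'u, 'i, 'j) leavitt_gen word \<Rightarrow>\<^sub>0 'k) set" where
  "T = unital_leavitt_relations H"

definition rS :: "('r, 'u) bergman_gen \<Rightarrow> (('r, 'u) bergman_gen word \<Rightarrow>\<^sub>0 'k) residues" where
  "rS x = residue S (gen x)"

definition rT :: "('v, 'u, 'i, 'j) leavitt_gen \<Rightarrow> (('v, 'u, 'i, 'j) leavitt_gen word \<Rightarrow>\<^sub>0 'k) residues" where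
  "rT x = residue T (gen x)"

definition c :: "'r \<Rightarrow> (('r, 'u) bergman_gen word \<Rightarrow>\<^sub>0 'k) residues" where
  "c r = residue S (gen (Coef r))"

lemma S_eq: "p - q \<in> S \<Longrightarrow> residue S p = residue S q"
  by (simp add: residue_eq_iff ideal_of.base)

lemma c_add: "r \<in> carrier R \<Longrightarrow> s \<in> carrier R \<Longrightarrow> c (r \<oplus>\<^bsub>R\<^esub> s) = c r + c s"
  unfolding c_def residue_add[symmetric]
  by (rule S_eq) (unfold S_def coefficient_relations_def, blast)

lemma c_mult: "r \<in> carrier R \<Longrightarrow> s \<in> carrier R \<Longrightarrow> c (r \<otimes>\<^bsub>R\<^esub> s) = c r * c s"
  unfolding c_def residue_mult[symmetric]
  by (rule S_eq) (unfold S_def coefficient_relations_def, blast)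

lemma c_scale: "r \<in> carrier R \<Longrightarrow> c (k \<odot>\<^bsub>R\<^esub> r) = scale_residues k (c r)"
  unfolding c_def residue_scale[symmetric]
  by (rule S_eq) (unfold S_def coefficient_relations_def, blast)

lemma c_one: "c \<one>\<^bsub>R\<^esub> = residue S 1"
  unfolding c_def
  by (rule S_eq) (unfold S_def coefficient_relations_def, blast)

lemma c_zero: "c \<zero>\<^bsub>R\<^esub> = 0"
proof -
  have "\<zero>\<^bsub>R\<^esub> = 0 \<odot>\<^bsub>R\<^esub> \<zero>\<^bsub>R\<^esub>" by (rule co_inj) (simp_all add: R_closed co_hom)
  then show ?thesis using c_scale[of "\<zero>\<^bsub>R\<^esub>" 0] by (simp add: R_closed scale_residues.sm_zero_left)
qed

text \<open>The coefficient relations speak of binary sums only, so coordinates are peeled off one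
  at a time: subtracting \<open>co u r\<close> times \<open>eps u\<close> empties coordinate
  \<open>u\<close> and leaves the others unchanged.\<close>

lemma c_expansion:
  assumes r: "r \<in> carrier R"
  shows "c r = (\<Sum>v\<in>V. scale_residues (co v r) (c (eps v)))"
proof -
  have "c r = (\<Sum>v\<in>W. scale_residues (co v r) (c (eps v)))"
    if "finite W" "W \<subseteq> V" "r \<in> carrier R" "\<forall>v\<in>V - W. co v r = 0" for W r
    using that
  proof (induction W arbitrary: r)
    case empty
    then have "r = \<zero>\<^bsub>R\<^esub>" by (intro co_inj) (simp_all add: R_closed co_hom)
    then show ?case by (simp add: c_zero)
  next
    case (insert u W)
    define s where "s = r \<oplus>\<^bsub>R\<^esub> ((- co u r) \<odot>\<^bsub>R\<^esub> eps u)"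
    have s: "s \<in> carrier R" using insert.prems by (simp add: s_def R_closed eps)
    have co_s: "co v s = (if v = u then 0 else co v r)" if "v \<in> V" for v
      using that insert.prems by (simp add: s_def co_hom R_closed eps)
    have "\<forall>v\<in>V - W. co v s = 0" using insert.prems co_s by auto
    with insert s have "c s = (\<Sum>v\<in>W. scale_residues (co v s) (c (eps v)))" by blast
    also have "\<dots> = (\<Sum>v\<in>W. scale_residues (co v r) (c (eps v)))"
      using insert.hyps insert.prems co_s by (intro sum.cong refl) auto
    finally have "c s = (\<Sum>v\<in>W. scale_residues (co v r) (c (eps v)))" .
    moreover have "c s = c r - scale_residues (co u r) (c (eps u))"
      using insert.prems scale_residues.sm_add_left[of "co u r" "- co u r" "c (eps u)"]
      by (simp add: s_def c_add c_scale R_closed eps scale_residues.sm_zero_left add_eq_0_iff)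
    ultimately show ?case using insert.hyps by (simp add: algebra_simps)
  qed
  from this[OF finite_vertices order.refl r] show ?thesis by simp
qed

lemma c_eps_mult:
  assumes "u \<in> V" "v \<in> V"
  shows "c (eps u) * c (eps v) = (if u = v then c (eps u) else 0)"
proof -
  have "eps u \<otimes>\<^bsub>R\<^esub> eps v = (if u = v then eps u else \<zero>\<^bsub>R\<^esub>)"
    using assms by (intro co_inj) (auto simp: R_closed eps co_hom)
  then show ?thesis by (simp add: c_zero eps flip: c_mult)
qed

lemma c_eps_sum: "(\<Sum>v\<in>V. c (eps v)) = residue S 1"
  using c_expansion[OF R_closed(5)] by (simp add: co_hom scale_residues.sm_one c_one cong: sum.cong)

lemma T_leavitt: "leavitt_relations H \<subseteq> T"
  by (auto simp: T_def unital_leavitt_relations_def)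

lemmas T_relations = leavitt_relationsD[OF T_leavitt, folded rT_def, unfolded hyperedges_eq]

lemma T_one: "residue T 1 = (\<Sum>v\<in>V. rT (Vertex v))"
proof -
  have "1 - (\<Sum>v\<in>V. gen (Vertex v)) \<in> T"
    by (simp add: T_def unital_leavitt_relations_def)
  then have "residue T 1 = residue T (\<Sum>v\<in>V. gen (Vertex v))"
    by (simp add: residue_eq_iff ideal_of.base)
  then show ?thesis by (simp add: residue_sum rT_def)
qed

lemma frame_src_T: "u \<in> index F \<Longrightarrow>
  frame scale_residues (src_index H u) (src H u) (\<lambda>v. rT (Vertex v)) (P u) (Q u) (rows F u)"
  by (intro frame.intro k_algebra_scale_residues frame_axioms.intro)
    (simp_all add: finite_src T_relations src_vertex src_dual)

lemma frame_rng_T: "u \<in> index F \<Longrightarrow>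
  frame scale_residues (rng_index H u) (rng H u) (\<lambda>v. rT (Vertex v)) (P' u) (Q' u) (cols F u)"
  by (intro frame.intro k_algebra_scale_residues frame_axioms.intro)
    (simp_all add: finite_rng T_relations rng_vertex rng_dual)

lemma frame_src_S: "u \<in> index F \<Longrightarrow>
  frame scale_residues (src_index H u) (src H u) (\<lambda>v. c (eps v)) (P u) (Q u) (rows F u)"
  by (intro frame.intro k_algebra_scale_residues frame_axioms.intro)
    (simp_all add: finite_src c_eps_mult src_vertex src_dual)

lemma frame_rng_S: "u \<in> index F \<Longrightarrow>
  frame scale_residues (rng_index H u) (rng H u) (\<lambda>v. c (eps v)) (P' u) (Q' u) (cols F u)"
  by (intro frame.intro k_algebra_scale_residues frame_axioms.intro)
    (simp_all add: finite_rng c_eps_mult rng_vertex rng_dual)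

lemmas pair_T = frame_pair.intro[OF frame_src_T frame_rng_T]
lemmas pair_T_star = frame_pair.intro[OF frame_rng_T frame_src_T]
lemmas pair_S = frame_pair.intro[OF frame_src_S frame_rng_S]
lemmas pair_S_star = frame_pair.intro[OF frame_rng_S frame_src_S]

text \<open>The starred symbols go to \<open>P' x* Q\<close>, so that exchanging the two frames
  exchanges the roles of \<open>Sym\<close> and \<open>SymStar\<close>.\<close>

definition t :: "('r, 'u) bergman_gen \<Rightarrow> ('v, 'u, 'i, 'j) leavitt_gen word \<Rightarrow>\<^sub>0 'k" where
  "t x = (case x of
      Coef r \<Rightarrow> \<Sum>v\<in>V. scale (co v r) (gen (Vertex v))
    | Sym u i j \<Rightarrow> \<Sum>a\<in>src_index H u. \<Sum>b\<in>rng_index H u. scale (P u i a * Q' u b j) (gen (Edge u a b))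
    | SymStar u j i \<Rightarrow>
        \<Sum>b\<in>rng_index H u. \<Sum>a\<in>src_index H u. scale (P' u j b * Q u a i) (gen (EdgeStar u a b)))"

definition t' :: "('v, 'u, 'i, 'j) leavitt_gen \<Rightarrow> ('r, 'u) bergman_gen word \<Rightarrow>\<^sub>0 'k" where
  "t' x = (case x of
      Vertex v \<Rightarrow> gen (Coef (eps v))
    | Edge u a b \<Rightarrow> \<Sum>i<rows F u. \<Sum>j<cols F u. scale (Q u a i * P' u j b)
        (gen (Coef (eps (src H u a))) * gen (Sym u i j) * gen (Coef (eps (rng H u b))))
    | EdgeStar u a b \<Rightarrow> \<Sum>j<cols F u. \<Sum>i<rows F u. scale (Q' u b j * P u i a)
        (gen (Coef (eps (rng H u b))) * gen (SymStar u j i) * gen (Coef (eps (src H u a)))))"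

abbreviation "vS \<equiv> \<lambda>v. c (eps v)"
abbreviation "vT \<equiv> \<lambda>v. rT (Vertex v)"

lemma residue_t_Sym:
  assumes "u \<in> index F"
  shows "residue T (t (Sym u i j)) = frame_pair.to_matrix scale_residues (src_index H u) (P u)
    (rng_index H u) (Q' u) (\<lambda>a b. rT (Edge u a b)) i j"
  by (simp add: t_def frame_pair.to_matrix_def[OF pair_T[OF assms assms]] residue_simps rT_def)

lemma residue_t_SymStar:
  assumes "u \<in> index F"
  shows "residue T (t (SymStar u j i)) = frame_pair.to_matrix scale_residues (rng_index H u) (P' u)
    (src_index H u) (Q u) (\<lambda>b a. rT (EdgeStar u a b)) j i"
  by (simp add: t_def frame_pair.to_matrix_def[OF pair_T_star[OF assms assms]] residue_simps rT_def)

lemma residue_t'_Edge: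
  assumes "u \<in> index F"
  shows "residue S (t' (Edge u a b)) = frame_pair.of_matrix scale_residues (src H u) vS (Q u) (rows F u)
    (rng H u) (P' u) (cols F u) (\<lambda>i j. rS (Sym u i j)) a b"
  unfolding frame_pair.of_matrix_def[OF pair_S[OF assms assms]]
  by (simp add: t'_def residue_simps rS_def c_def)

lemma residue_t'_EdgeStar:
  assumes "u \<in> index F"
  shows "residue S (t' (EdgeStar u a b)) = frame_pair.of_matrix scale_residues (rng H u) vS (Q' u)
    (cols F u) (src H u) (P u) (rows F u) (\<lambda>j i. rS (SymStar u j i)) b a"
  unfolding frame_pair.of_matrix_def[OF pair_S_star[OF assms assms]]
  by (simp add: t'_def residue_simps rS_def c_def)


abbreviation "eS u \<equiv> frame.E scale_residues (src_index H u) (src H u) vS (P u) (Q u)"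
abbreviation "fS u \<equiv> frame.E scale_residues (rng_index H u) (rng H u) vS (P' u) (Q' u)"
abbreviation "eT u \<equiv> frame.E scale_residues (src_index H u) (src H u) vT (P u) (Q u)"
abbreviation "fT u \<equiv> frame.E scale_residues (rng_index H u) (rng H u) vT (P' u) (Q' u)"

text \<open>Merging the coordinates of an entry along the fibres of the source map gives the frame
  matrix. Here matrices over \<open>R\<close> meet the frames.\<close>

lemma c_emat: "u \<in> index F \<Longrightarrow> i < rows F u \<Longrightarrow> j < rows F u \<Longrightarrow> c (emat F u i j) = eS u i j"
  using src_vertex finite_src finite_vertices
  by (simp add: c_expansion emat_closed emat_eq frame.E_def[OF frame_src_S] cong: sum.cong)
    (subst scale_residues.sum_fibres; auto)

lemma c_fmat: "u \<in> index F \<Longrightarrow> i < cols F u \<Longrightarrow> j < cols F u \<Longrightarrow> c (fmat F u i j) = fS u i j"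
  using rng_vertex finite_rng finite_vertices
  by (simp add: c_expansion fmat_closed fmat_eq frame.E_def[OF frame_rng_S] cong: sum.cong)
    (subst scale_residues.sum_fibres; auto)

lemma residue_t_Coef: "residue T (t (Coef r)) = (\<Sum>v\<in>V. scale_residues (co v r) (vT v))"
  by (simp add: t_def residue_simps rT_def)

lemma t_emat: "u \<in> index F \<Longrightarrow> i < rows F u \<Longrightarrow> j < rows F u \<Longrightarrow>
    residue T (t (Coef (emat F u i j))) = eT u i j"
  using src_vertex finite_src finite_vertices
  by (simp add: residue_t_Coef emat_eq frame.E_def[OF frame_src_T] cong: sum.cong)
    (subst scale_residues.sum_fibres; auto)

lemma t_fmat: "u \<in> index F \<Longrightarrow> i < cols F u \<Longrightarrow> j < cols F u \<Longrightarrow>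
    residue T (t (Coef (fmat F u i j))) = fT u i j"
  using rng_vertex finite_rng finite_vertices
  by (simp add: residue_t_Coef fmat_eq frame.E_def[OF frame_rng_T] cong: sum.cong)
    (subst scale_residues.sum_fibres; auto)

lemma S_relations:
  assumes u: "u \<in> index F"
  shows "i < rows F u \<Longrightarrow> j < cols F u \<Longrightarrow>
      (\<Sum>a<rows F u. \<Sum>b<cols F u. eS u i a * rS (Sym u a b) * fS u b j) = rS (Sym u i j)"
    and "i < rows F u \<Longrightarrow> j < cols F u \<Longrightarrow>
      (\<Sum>b<cols F u. \<Sum>a<rows F u. fS u j b * rS (SymStar u b a) * eS u a i) = rS (SymStar u j i)"
    and "i < rows F u \<Longrightarrow> i' < rows F u \<Longrightarrow>
      (\<Sum>b<cols F u. rS (Sym u i b) * rS (SymStar u b i')) = eS u i i'"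
    and "j < cols F u \<Longrightarrow> j' < cols F u \<Longrightarrow>
      (\<Sum>a<rows F u. rS (SymStar u j a) * rS (Sym u a j')) = fS u j j'"
proof -
  have eq: "residue S p = residue S q" if "p - q \<in> (let m = rows F u; n = cols F u;
         e = (\<lambda>i j. gen (Coef (emat F u i j))); f = (\<lambda>i j. gen (Coef (fmat F u i j)));
         h = (\<lambda>i j. gen (Sym u i j)); hs = (\<lambda>j i. gen (SymStar u j i))
     in {(\<Sum>a<m. \<Sum>b<n. e i a * h a b * f b j) - h i j | i j. i < m \<and> j < n} \<union>
        {(\<Sum>b<n. \<Sum>a<m. f j b * hs b a * e a i) - hs j i | i j. i < m \<and> j < n} \<union>
        {(\<Sum>b<n. h i b * hs b i') - e i i' | i i'. i < m \<and> i' < m} \<union>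
        {(\<Sum>a<m. hs j a * h a j') - f j j' | j j'. j < n \<and> j' < n})"
    for p q :: "('r, 'u) bergman_gen word \<Rightarrow>\<^sub>0 'k"
    by (rule S_eq) (use u that in \<open>unfold S_def bergman_relations_def, intro UnI2 UN_I\<close>)
  note eq' = eq[unfolded Let_def]
  have coefs: "eS u i j = residue S (gen (Coef (emat F u i j)))" if "i < rows F u" "j < rows F u" for i j
    using c_emat[OF u that] by (simp add: c_def)
  have coefs': "fS u i j = residue S (gen (Coef (fmat F u i j)))" if "i < cols F u" "j < cols F u" for i j
    using c_fmat[OF u that] by (simp add: c_def)
  show "(\<Sum>a<rows F u. \<Sum>b<cols F u. eS u i a * rS (Sym u a b) * fS u b j) = rS (Sym u i j)"
    if "i < rows F u" "j < cols F u"
  proof -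
    have "residue S (\<Sum>a<rows F u. \<Sum>b<cols F u. gen (Coef (emat F u i a)) * gen (Sym u a b) *
        gen (Coef (fmat F u b j))) = residue S (gen (Sym u i j))"
      by (rule eq') (use that in blast)
    then show ?thesis
      using that by (simp add: coefs coefs' rS_def residue_simps)
  qed
  show "(\<Sum>b<cols F u. \<Sum>a<rows F u. fS u j b * rS (SymStar u b a) * eS u a i) = rS (SymStar u j i)"
    if "i < rows F u" "j < cols F u"
  proof -
    have "residue S (\<Sum>b<cols F u. \<Sum>a<rows F u. gen (Coef (fmat F u j b)) * gen (SymStar u b a) *
        gen (Coef (emat F u a i))) = residue S (gen (SymStar u j i))"
      by (rule eq') (use that in blast)
    then show ?thesis
      using that by (simp add: coefs coefs' rS_def residue_simps)
  qed
  show "(\<Sum>b<cols F u. rS (Sym u i b) * rS (SymStar u b i')) = eS u i i'"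
    if "i < rows F u" "i' < rows F u"
  proof -
    have "residue S (\<Sum>b<cols F u. gen (Sym u i b) * gen (SymStar u b i')) =
        residue S (gen (Coef (emat F u i i')))"
      by (rule eq') (use that in blast)
    then show ?thesis using that by (simp add: coefs rS_def residue_simps)
  qed
  show "(\<Sum>a<rows F u. rS (SymStar u j a) * rS (Sym u a j')) = fS u j j'"
    if "j < cols F u" "j' < cols F u"
  proof -
    have "residue S (\<Sum>a<rows F u. gen (SymStar u j a) * gen (Sym u a j')) =
        residue S (gen (Coef (fmat F u j j')))"
      by (rule eq') (use that in blast)
    then show ?thesis using that by (simp add: coefs' rS_def residue_simps)
  qed
qed

lemma t_relations:
  assumes "s \<in> S"
  shows "residue T (subst t s) = 0"
proof (cases "s \<in> coefficient_relations R")
  case True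
  show ?thesis
  proof (rule subst_coefficient_relations_zero[OF _ _ _ _ True])
    fix r s assume rs: "r \<in> carrier R" "s \<in> carrier R"
    show "residue T (t (Coef (r \<oplus>\<^bsub>R\<^esub> s))) = residue T (t (Coef r)) + residue T (t (Coef s))"
      using rs by (simp add: residue_t_Coef co_hom scale_residues.sm_add_left sum.distrib)
    have "residue T (t (Coef r)) * residue T (t (Coef s)) =
      (\<Sum>v\<in>V. \<Sum>u\<in>V. scale_residues (co v r * co u s) (vT v * vT u))"
      by (simp add: residue_t_Coef sum_product scale_residues.sm_mult_left scale_residues.sm_mult_right
          scale_residues.sm_sm mult.commute)
    also have "\<dots> = (\<Sum>v\<in>V. \<Sum>u\<in>V. if v = u then scale_residues (co v r * co v s) (vT v) else 0)"
      by (intro sum.cong refl) (auto simp: T_relations scale_residues.sm_zero_right)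
    also have "\<dots> = residue T (t (Coef (r \<otimes>\<^bsub>R\<^esub> s)))"
      using rs finite_vertices by (simp add: residue_t_Coef co_hom)
    finally show "residue T (t (Coef (r \<otimes>\<^bsub>R\<^esub> s))) = residue T (t (Coef r)) * residue T (t (Coef s))" ..
  next
    fix k r assume "r \<in> carrier R"
    then show "residue T (t (Coef (k \<odot>\<^bsub>R\<^esub> r))) = scale_residues k (residue T (t (Coef r)))"
      by (simp add: residue_t_Coef co_hom scale_residues.sm_sum_right scale_residues.sm_sm)
  next
    show "residue T (t (Coef \<one>\<^bsub>R\<^esub>)) = residue T 1"
      by (simp add: residue_t_Coef co_hom scale_residues.sm_one T_one)
  qed
next
  case False
  then have s: "s \<in> bergman_relations F" using assms by (simp add: S_def)
  show ?thesis
  proof (rule subst_bergman_relations_zero[OF _ _ _ _ s])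
    fix u assume u: "u \<in> index F"
    interpret A: frame_pair scale_residues "src_index H u" "src H u" vT "P u" "Q u" "rows F u"
      "rng_index H u" "rng H u" "P' u" "Q' u" "cols F u"
      using u u by (rule pair_T)
    \<comment> \<open>The same data with the frames exchanged, so that starred symbols are treated
      as the unstarred ones are in \<open>A\<close>.\<close>
    interpret B: frame_pair scale_residues "rng_index H u" "rng H u" vT "P' u" "Q' u" "cols F u"
      "src_index H u" "src H u" "P u" "Q u" "rows F u"
      using u u by (rule pair_T_star)
    fix i j i' j'
    show "(\<Sum>a<rows F u. \<Sum>b<cols F u. residue T (t (Coef (emat F u i a))) * residue T (t (Sym u a b)) *
        residue T (t (Coef (fmat F u b j)))) = residue T (t (Sym u i j))"
      if "i < rows F u" "j < cols F u"
      using that u A.absorb_to_matrix[of "\<lambda>a b. rT (Edge u a b)" i j]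
      by (simp add: t_emat t_fmat residue_t_Sym T_relations)
    show "(\<Sum>b<cols F u. \<Sum>a<rows F u. residue T (t (Coef (fmat F u j b))) *
        residue T (t (SymStar u b a)) * residue T (t (Coef (emat F u a i)))) = residue T (t (SymStar u j i))"
      if "i < rows F u" "j < cols F u"
      using that u B.absorb_to_matrix[of "\<lambda>b a. rT (EdgeStar u a b)" j i]
      by (simp add: t_emat t_fmat residue_t_SymStar T_relations)
    show "(\<Sum>b<cols F u. residue T (t (Sym u i b)) * residue T (t (SymStar u b i'))) =
        residue T (t (Coef (emat F u i i')))"
      if "i < rows F u" "i' < rows F u"
      using that u A.to_matrix_mult_star[of "\<lambda>a b. rT (Edge u a b)" "\<lambda>a b. rT (EdgeStar u a b)" i i']
      by (simp add: t_emat residue_t_Sym residue_t_SymStar B.to_matrix_def T_relations)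
    show "(\<Sum>a<rows F u. residue T (t (SymStar u j a)) * residue T (t (Sym u a j'))) =
        residue T (t (Coef (fmat F u j j')))"
      if "j < cols F u" "j' < cols F u"
      using that u B.to_matrix_mult_star[of "\<lambda>b a. rT (EdgeStar u a b)" "\<lambda>b a. rT (Edge u a b)" j j']
      by (simp add: t_fmat residue_t_Sym residue_t_SymStar A.to_matrix_def T_relations)
  qed
qed

lemma residue_t'_Vertex: "residue S (t' (Vertex v)) = vS v"
  by (simp add: t'_def c_def)

lemma t'_relations:
  assumes "s \<in> T"
  shows "residue S (subst t' s) = 0"
proof (cases "s \<in> leavitt_relations H")
  case False
  then have "s = 1 - (\<Sum>v\<in>V. gen (Vertex v))"
    using assms by (simp add: T_def unital_leavitt_relations_def)
  then show ?thesis
    by (simp add: subst_simps residue_simps residue_t'_Vertex c_eps_sum)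
next
  case True
  show ?thesis
  proof (rule subst_leavitt_relations_zero[OF _ _ _ _ _ _ _ True])
    fix u v assume "u \<in> V" "v \<in> V"
    then show "residue S (t' (Vertex u)) * residue S (t' (Vertex v)) =
        (if u = v then residue S (t' (Vertex u)) else 0)"
      by (simp add: residue_t'_Vertex c_eps_mult)
  next
    fix u assume "u \<in> hyperedges H"
    then have u: "u \<in> index F" by (simp add: hyperedges_eq)
    interpret A: frame_pair scale_residues "src_index H u" "src H u" vS "P u" "Q u" "rows F u"
      "rng_index H u" "rng H u" "P' u" "Q' u" "cols F u"
      using u u by (rule pair_S)
    interpret B: frame_pair scale_residues "rng_index H u" "rng H u" vS "P' u" "Q' u" "cols F u"
      "src_index H u" "src H u" "P u" "Q u" "rows F u"
      using u u by (rule pair_S_star)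
    note t' = residue_t'_Vertex residue_t'_Edge[OF u] residue_t'_EdgeStar[OF u]
    fix a a' b b'
    show "residue S (t' (Vertex (src H u a))) * residue S (t' (Edge u a b)) = residue S (t' (Edge u a b))"
      if "a \<in> src_index H u" "b \<in> rng_index H u"
      using that by (simp add: t' A.of_matrix_absorb)
    show "residue S (t' (Edge u a b)) * residue S (t' (Vertex (rng H u b))) = residue S (t' (Edge u a b))"
      if "a \<in> src_index H u" "b \<in> rng_index H u"
      using that by (simp add: t' A.of_matrix_absorb)
    show "residue S (t' (Vertex (rng H u b))) * residue S (t' (EdgeStar u a b)) =
        residue S (t' (EdgeStar u a b))"
      if "a \<in> src_index H u" "b \<in> rng_index H u"
      using that by (simp add: t' B.of_matrix_absorb)
    show "residue S (t' (EdgeStar u a b)) * residue S (t' (Vertex (src H u a))) =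
        residue S (t' (EdgeStar u a b))"
      if "a \<in> src_index H u" "b \<in> rng_index H u"
      using that by (simp add: t' B.of_matrix_absorb)
    show "(\<Sum>b\<in>rng_index H u. residue S (t' (Edge u a b)) * residue S (t' (EdgeStar u a' b))) =
        (if a = a' then residue S (t' (Vertex (src H u a))) else 0)"
      if "a \<in> src_index H u" "a' \<in> src_index H u"
      unfolding t' B.of_matrix_def
      by (rule A.of_matrix_mult_star) (use that in \<open>simp_all add: S_relations[OF u]\<close>)
    show "(\<Sum>a\<in>src_index H u. residue S (t' (EdgeStar u a b)) * residue S (t' (Edge u a b'))) =
        (if b = b' then residue S (t' (Vertex (rng H u b))) else 0)"
      if "b \<in> rng_index H u" "b' \<in> rng_index H u"
      unfolding t' A.of_matrix_def
      by (rule B.of_matrix_mult_star) (use that in \<open>simp_all add: S_relations[OF u]\<close>)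
  qed
qed

lemma bergman_gens_cases:
  assumes "x \<in> bergman_gens R F"
  obtains r where "x = Coef r" "r \<in> carrier R"
  | u i j where "x = Sym u i j" "u \<in> index F" "i < rows F u" "j < cols F u"
  | u i j where "x = SymStar u j i" "u \<in> index F" "i < rows F u" "j < cols F u"
  using assms unfolding bergman_gens_def by blast

lemma leavitt_gens_cases:
  assumes "x \<in> leavitt_gens H"
  obtains v where "x = Vertex v" "v \<in> V"
  | u a b where "x = Edge u a b" "u \<in> index F" "a \<in> src_index H u" "b \<in> rng_index H u"
  | u a b where "x = EdgeStar u a b" "u \<in> index F" "a \<in> src_index H u" "b \<in> rng_index H u"
  using assms unfolding leavitt_gens_def hyperedges_eq by blast

text \<open>On symbols the composite is \<open>P Q h P' Q' = e h f\<close>, which the defining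
  relation returns to \<open>h\<close>. On coefficients it is the coordinate expansion.\<close>

lemma t_t':
  assumes "x \<in> bergman_gens R F"
  shows "residue S (subst t' (t x)) = residue S (gen x)"
  using assms
proof (cases rule: bergman_gens_cases)
  case (1 r)
  then show ?thesis
    using c_expansion[of r] by (simp add: t_def subst_simps residue_simps residue_t'_Vertex c_def)
next
  case (2 u i j)
  note u = 2(2)
  interpret A: frame_pair scale_residues "src_index H u" "src H u" vS "P u" "Q u" "rows F u"
    "rng_index H u" "rng H u" "P' u" "Q' u" "cols F u"
    using u u by (rule pair_S)
  have "residue S (subst t' (t x)) = A.to_matrix (A.of_matrix (\<lambda>i j. rS (Sym u i j))) i j"
    by (simp add: 2(1) t_def subst_simps residue_simps residue_t'_Edge[OF u] A.to_matrix_def)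
  also have "\<dots> = residue S (gen x)"
    unfolding A.to_matrix_of_matrix using 2 by (simp add: S_relations[OF u]) (simp add: rS_def)
  finally show ?thesis .
next
  case (3 u i j)
  note u = 3(2)
  interpret B: frame_pair scale_residues "rng_index H u" "rng H u" vS "P' u" "Q' u" "cols F u"
    "src_index H u" "src H u" "P u" "Q u" "rows F u"
    using u u by (rule pair_S_star)
  have "residue S (subst t' (t x)) = B.to_matrix (B.of_matrix (\<lambda>j i. rS (SymStar u j i))) j i"
    by (simp add: 3(1) t_def subst_simps residue_simps residue_t'_EdgeStar[OF u] B.to_matrix_def)
  also have "\<dots> = residue S (gen x)"
    unfolding B.to_matrix_of_matrix using 3 by (simp add: S_relations[OF u]) (simp add: rS_def)
  finally show ?thesis .
qed

lemma residue_t_eps: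
  assumes "v \<in> V"
  shows "residue T (t (Coef (eps v))) = vT v"
proof -
  have "residue T (t (Coef (eps v))) = (\<Sum>u\<in>V. if u = v then vT v else 0)"
    unfolding residue_t_Coef
    by (intro sum.cong refl) (auto simp: eps scale_residues.sm_one scale_residues.sm_zero_left)
  then show ?thesis using assms finite_vertices by simp
qed

text \<open>On edges the composite is \<open>Q P x Q' P'\<close>, which is \<open>x\<close> because
  edges are absorbed by their end vertices.\<close>

lemma t'_t:
  assumes "x \<in> leavitt_gens H"
  shows "residue T (subst t (t' x)) = residue T (gen x)"
  using assms
proof (cases rule: leavitt_gens_cases)
  case (1 v)
  then show ?thesis by (simp add: t'_def subst_simps residue_t_eps) (simp add: rT_def)
next
  case (2 u a b)
  note u = 2(2)
  interpret A: frame_pair scale_residues "src_index H u" "src H u" vT "P u" "Q u" "rows F u"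
    "rng_index H u" "rng H u" "P' u" "Q' u" "cols F u"
    using u u by (rule pair_T)
  have "residue T (subst t (t' x)) = A.of_matrix (A.to_matrix (\<lambda>a b. rT (Edge u a b))) a b"
    using 2 by (simp add: t'_def subst_simps residue_simps residue_t_Sym residue_t_eps src_vertex
        rng_vertex A.of_matrix_def)
  also have "\<dots> = rT (Edge u a b)"
    using 2 by (intro A.of_matrix_to_matrix) (simp_all add: T_relations)
  finally show ?thesis by (simp add: 2(1) rT_def)
next
  case (3 u a b)
  note u = 3(2)
  interpret B: frame_pair scale_residues "rng_index H u" "rng H u" vT "P' u" "Q' u" "cols F u"
    "src_index H u" "src H u" "P u" "Q u" "rows F u"
    using u u by (rule pair_T_star)
  have "residue T (subst t (t' x)) = B.of_matrix (B.to_matrix (\<lambda>b a. rT (EdgeStar u a b))) b a"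
    using 3 by (simp add: t'_def subst_simps residue_simps residue_t_SymStar residue_t_eps src_vertex
        rng_vertex B.of_matrix_def)
  also have "\<dots> = rT (EdgeStar u a b)"
    using 3 by (intro B.of_matrix_to_matrix) (simp_all add: T_relations)
  finally show ?thesis by (simp add: 3(1) rT_def)
qed

text \<open>A nonzero coefficient \<open>P u i a * Q' u b j\<close> forces the row degree at
  \<open>i\<close> and the column degree at \<open>j\<close> to be those of \<open>a\<close> and
  \<open>b\<close>, whose difference is the weight. Terms with coefficient zero impose no
  condition.\<close>

lemma t_degree:
  assumes "x \<in> bergman_gens R F" "\<gamma> \<in> bergman_degree (concentrated_in_zero R) F x"
  shows "t x \<in> hom_part (free_algebra (leavitt_gens H)) (leavitt_degree w) \<gamma>"
proof -
  let ?hom = "hom_part (free_algebra (leavitt_gens H)) (leavitt_degree w) ::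
    'g \<Rightarrow> (('v, 'u, 'i, 'j) leavitt_gen word \<Rightarrow>\<^sub>0 'k) set"
  interpret Z: quotient_presentation "free_algebra (leavitt_gens H) ::
    ('k, ('v, 'u, 'i, 'j) leavitt_gen word \<Rightarrow>\<^sub>0 'k) module" "{}"
    by (rule quotient_presentation_free)
  have scale_hom: "scale k p \<in> ?hom \<delta>"
    if "k \<noteq> 0 \<Longrightarrow> p \<in> ?hom \<delta>" for k p \<delta>
    using that by (cases "k = 0") (simp_all add: scale.sm_zero_left Z.hom_part_zero Z.hom_part_scale)
  from assms(1) show ?thesis
  proof (cases rule: bergman_gens_cases)
    case (1 r)
    have "gen (Vertex v) \<in> ?hom \<gamma>"
      if "v \<in> V" "co v r \<noteq> 0" for v
    proof -
      \<comment> \<open>Zero has every degree but no nonzero coordinate, so it contributes no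
        vertex; a nonzero \<open>r\<close> has degree zero only.\<close>
      have "r \<noteq> \<zero>\<^bsub>R\<^esub>" using that by (auto simp: co_hom)
      then have "\<gamma> = 0" using assms(2) 1 by (auto simp: concentrated_in_zero_def split: if_splits)
      then show ?thesis using that by (intro gen_hom_part) (auto simp: leavitt_gens_def)
    qed
    then show ?thesis
      unfolding 1(1) t_def by (auto intro!: Z.hom_part_sum scale_hom)
  next
    case (2 u i j)
    have "gen (Edge u a b) \<in> ?hom \<gamma>"
      if "a \<in> src_index H u" "b \<in> rng_index H u" "P u i a * Q' u b j \<noteq> 0" for a b
      using that 2 assms(2) src_homogeneous[of u a i] rng_homogeneous[of u b j]
      by (intro gen_hom_part) (auto simp: leavitt_gens_def hyperedges_eq weight)
    then show ?thesis
      unfolding 2(1) t_def by (auto intro!: Z.hom_part_sum scale_hom)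
  next
    case (3 u i j)
    have "gen (EdgeStar u a b) \<in> ?hom \<gamma>"
      if "a \<in> src_index H u" "b \<in> rng_index H u" "P' u j b * Q u a i \<noteq> 0" for a b
      using that 3 assms(2) src_homogeneous[of u a i] rng_homogeneous[of u b j]
      by (intro gen_hom_part) (auto simp: leavitt_gens_def hyperedges_eq weight)
    then show ?thesis
      unfolding 3(1) t_def by (auto intro!: Z.hom_part_sum scale_hom)
  qed
qed

lemma t'_degree:
  assumes "x \<in> leavitt_gens H" "\<gamma> \<in> leavitt_degree w x"
  shows "t' x \<in> hom_part (free_algebra (bergman_gens R F)) (bergman_degree (concentrated_in_zero R) F) \<gamma>"
proof -
  let ?hom = "hom_part (free_algebra (bergman_gens R F)) (bergman_degree (concentrated_in_zero R) F) ::
    'g \<Rightarrow> (('r, 'u) bergman_gen word \<Rightarrow>\<^sub>0 'k) set"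
  interpret Y: quotient_presentation "free_algebra (bergman_gens R F) ::
    ('k, ('r, 'u) bergman_gen word \<Rightarrow>\<^sub>0 'k) module" "{}"
    by (rule quotient_presentation_free)
  have scale_hom: "scale k p \<in> ?hom \<delta>" if "k \<noteq> 0 \<Longrightarrow> p \<in> ?hom \<delta>" for k p \<delta>
    using that by (cases "k = 0") (simp_all add: scale.sm_zero_left Y.hom_part_zero Y.hom_part_scale)
  have coef: "gen (Coef (eps v)) \<in> ?hom 0" for v
    by (intro gen_hom_part) (auto simp: bergman_gens_def eps concentrated_in_zero_def)
  have sandwich: "gen (Coef (eps v)) * p * gen (Coef (eps v')) \<in> ?hom \<delta>" if "p \<in> ?hom \<delta>" for v p v' \<delta>
    using Y.hom_part_mult[OF Y.hom_part_mult[OF coef that] coef] by simp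
  from assms(1) show ?thesis
  proof (cases rule: leavitt_gens_cases)
    case (1 v)
    then show ?thesis using assms(2) coef by (simp add: t'_def)
  next
    case (2 u a b)
    have "gen (Sym u i j) \<in> ?hom \<gamma>"
      if "i < rows F u" "j < cols F u" "Q u a i * P' u j b \<noteq> 0" for i j
      using that 2 assms(2) src_homogeneous[of u a i] rng_homogeneous[of u b j]
      by (intro gen_hom_part) (auto simp: bergman_gens_def weight)
    then show ?thesis
      unfolding 2(1) t'_def by (auto intro!: Y.hom_part_sum scale_hom sandwich)
  next
    case (3 u a b)
    have "gen (SymStar u j i) \<in> ?hom \<gamma>"
      if "i < rows F u" "j < cols F u" "Q' u b j * P u i a \<noteq> 0" for i j
      using that 3 assms(2) src_homogeneous[of u a i] rng_homogeneous[of u b j]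
      by (intro gen_hom_part) (auto simp: bergman_gens_def weight)
    then show ?thesis
      unfolding 3(1) t'_def by (auto intro!: Y.hom_part_sum scale_hom sandwich)
  qed
qed

lemma t_free:
  assumes "x \<in> bergman_gens R F"
  shows "t x \<in> free (leavitt_gens H)"
  using assms
  by (cases rule: bergman_gens_cases)
    (auto simp: t_def leavitt_gens_def hyperedges_eq intro!: free_sum free_scale free_gen)

lemma t'_free:
  assumes "x \<in> leavitt_gens H"
  shows "t' x \<in> free (bergman_gens R F)"
  using assms
  by (cases rule: leavitt_gens_cases)
    (auto simp: t'_def bergman_gens_def eps intro!: free_sum free_scale free_mult free_gen)

lemma S_free: "S \<subseteq> free (bergman_gens R F)"
proof -
  have "coefficient_relations R \<subseteq> free (bergman_gens R F)"
    unfolding coefficient_relations_def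
    by (auto intro!: free_diff free_add free_mult free_scale free_gen free_one
        simp: bergman_gens_def R_closed)
  moreover have "bergman_relations F \<subseteq> free (bergman_gens R F)"
    unfolding bergman_relations_def Let_def
    by (auto intro!: free_diff free_add free_mult free_sum free_gen
        simp: bergman_gens_def emat_closed fmat_closed)
  ultimately show ?thesis by (simp add: S_def)
qed

lemma bergman_free_algebra_eq: "bergman_free_algebra R F = free_algebra (bergman_gens R F)"
  by (simp add: bergman_free_algebra_def bergman_gens_def)

lemma bergman_ideal_eq: "bergman_ideal R F = ideal_of S \<inter> free (bergman_gens R F)"
  unfolding bergman_ideal_def bergman_free_algebra_eq S_def[symmetric]
  by (rule generated_ideal_free[OF S_free])

lemma bergman_iso_leavitt:
  "\<exists>\<phi>. grading_preserving_iso
     (bergman_algebra R F) (bergman_grading R (concentrated_in_zero R) F)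
     (unital_leavitt_algebra H) (unital_leavitt_grading H w) \<phi>"
proof -
  have "unital_leavitt_ideal H = ideal_of T \<inter> free (leavitt_gens H)"
    by (simp add: unital_leavitt_ideal_def T_def)
  then show ?thesis
    unfolding bergman_algebra_def bergman_grading_def unital_leavitt_algebra_def
      unital_leavitt_grading_def bergman_free_algebra_eq bergman_ideal_eq
    by (simp only:) (rule grading_preserving_iso_subst[of _ t _ t'];
        simp add: t_free t'_free t_relations t'_relations t_t' t'_t t_degree t'_degree)
qed

end

section \<open>Unital Leavitt path algebras\<close>

lemma leavitt_free_algebra_eq: "leavitt_free_algebra H = free_nonunital_algebra (leavitt_gens H)"
  by (simp add: leavitt_free_algebra_def leavitt_gens_def)

lemma leavitt_relations_free_nonunital:
  fixes H :: "('v, 'e, 'i, 'j) hypergraph"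
  assumes "is_hypergraph H"
  shows "leavitt_relations H \<subseteq> (free_nonunital (leavitt_gens H) ::
    (('v, 'e, 'i, 'j) leavitt_gen word \<Rightarrow>\<^sub>0 'k::field) set)"
proof -
  let ?A = "free_nonunital (leavitt_gens H) :: (('v, 'e, 'i, 'j) leavitt_gen word \<Rightarrow>\<^sub>0 'k) set"
  have mult: "p * q \<in> ?A" if "p \<in> ?A" "q \<in> ?A" for p q
    using that by (intro free_nonunital_mult(1) free_nonunitalD)
  have "gen (Vertex v) \<in> ?A" if "v \<in> vertices H" for v
    using that by (intro free_nonunital_gen) (auto simp: leavitt_gens_def)
  moreover have "gen (Vertex (src H h i)) \<in> ?A" if "h \<in> hyperedges H" "i \<in> src_index H h" for h i
    using that assms by (intro free_nonunital_gen) (auto simp: leavitt_gens_def is_hypergraph_def)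
  moreover have "gen (Vertex (rng H h j)) \<in> ?A" if "h \<in> hyperedges H" "j \<in> rng_index H h" for h j
    using that assms by (intro free_nonunital_gen) (auto simp: leavitt_gens_def is_hypergraph_def)
  moreover have "gen (Edge h i j) \<in> ?A" "gen (EdgeStar h i j) \<in> ?A"
    if "h \<in> hyperedges H" "i \<in> src_index H h" "j \<in> rng_index H h" for h i j
    using that by (auto intro!: free_nonunital_gen simp: leavitt_gens_def)
  ultimately show ?thesis
    unfolding leavitt_relations_def Let_def
    by (auto intro!: free_nonunital_diff mult free_nonunital_sum simp: free_nonunital_zero)
qed

lemma leavitt_ideal_eq:
  "is_hypergraph H \<Longrightarrow>
    leavitt_ideal H = ideal_of (leavitt_relations H) \<inter> free_nonunital (leavitt_gens H)"
  unfolding leavitt_ideal_def leavitt_free_algebra_eq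
  by (rule generated_ideal_free_nonunital[OF leavitt_relations_free_nonunital])

context
  fixes H :: "('v, 'e, 'i, 'j) hypergraph"
  assumes H: "is_hypergraph H" and finite_vertices: "finite (vertices H)"
begin

definition vertex_sum :: "('v, 'e, 'i, 'j) leavitt_gen word \<Rightarrow>\<^sub>0 'k::field" where
  "vertex_sum = (\<Sum>v\<in>vertices H. gen (Vertex v))"

lemma vertex_sum_nonunital: "vertex_sum \<in> free_nonunital (leavitt_gens H)"
  unfolding vertex_sum_def by (auto intro!: free_nonunital_sum free_nonunital_gen simp: leavitt_gens_def)

text \<open>A generator is absorbed by one vertex on each side, and the remaining vertices are
  orthogonal to that one.\<close>

lemma residue_vertex_sum:
  fixes y
  defines "T \<equiv> leavitt_relations H :: (('v, 'e, 'i, 'j) leavitt_gen word \<Rightarrow>\<^sub>0 'k::field) set"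
  assumes y: "y \<in> leavitt_gens H"
  shows "residue T (vertex_sum * gen y) = residue T (gen y)"
    and "residue T (gen y * vertex_sum) = residue T (gen y)"
proof -
  note rel = leavitt_relationsD[of H T, unfolded T_def, OF order.refl, folded T_def]
  let ?r = "\<lambda>x. residue T (gen x)"
  have absorb_left: "(\<Sum>u\<in>vertices H. ?r (Vertex u)) * z = z"
    if "v \<in> vertices H" "?r (Vertex v) * z = z" for v z
  proof -
    have "?r (Vertex u) * z = (if u = v then z else 0)" if u: "u \<in> vertices H" for u
    proof -
      have "?r (Vertex u) * z = ?r (Vertex u) * ?r (Vertex v) * z"
        using \<open>?r (Vertex v) * z = z\<close> by (simp add: mult.assoc)
      then show ?thesis
        using rel(1)[OF u \<open>v \<in> vertices H\<close>] \<open>?r (Vertex v) * z = z\<close> by auto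
    qed
    then show ?thesis using that(1) finite_vertices by (simp add: sum_distrib_right)
  qed
  have absorb_right: "z * (\<Sum>u\<in>vertices H. ?r (Vertex u)) = z"
    if "v \<in> vertices H" "z * ?r (Vertex v) = z" for v z
  proof -
    have "z * ?r (Vertex u) = (if u = v then z else 0)" if u: "u \<in> vertices H" for u
    proof -
      have "z * ?r (Vertex u) = z * (?r (Vertex v) * ?r (Vertex u))"
        using \<open>z * ?r (Vertex v) = z\<close> by (simp flip: mult.assoc)
      then show ?thesis
        using rel(1)[OF \<open>v \<in> vertices H\<close> u] \<open>z * ?r (Vertex v) = z\<close> by auto
    qed
    then show ?thesis using that(1) finite_vertices by (simp add: sum_distrib_left)
  qed
  have vertices: "src H h i \<in> vertices H" "rng H h j \<in> vertices H"
    if "h \<in> hyperedges H" "i \<in> src_index H h" "j \<in> rng_index H h" for h i j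
    using H that by (auto simp: is_hypergraph_def)
  have "\<exists>u v. u \<in> vertices H \<and> v \<in> vertices H \<and> ?r (Vertex u) * ?r y = ?r y \<and> ?r y * ?r (Vertex v) = ?r y"
  proof -
    from y consider v where "y = Vertex v" "v \<in> vertices H"
      | h i j where "y = Edge h i j" "h \<in> hyperedges H" "i \<in> src_index H h" "j \<in> rng_index H h"
      | h i j where "y = EdgeStar h i j" "h \<in> hyperedges H" "i \<in> src_index H h" "j \<in> rng_index H h"
      unfolding leavitt_gens_def by blast
    then show ?thesis
    proof cases
      case (1 v)
      then show ?thesis using rel(1)[of v v] by (intro exI[of _ v]) simp
    next
      case (2 h i j)
      then show ?thesis
        using rel(2)[of h i j] rel(3)[of h i j] vertices[of h i j]
        by (intro exI[of _ "src H h i"] exI[of _ "rng H h j"]) simp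
    next
      case (3 h i j)
      then show ?thesis
        using rel(4)[of h i j] rel(5)[of h i j] vertices[of h i j]
        by (intro exI[of _ "rng H h j"] exI[of _ "src H h i"]) simp
    qed
  qed
  then obtain u v where "u \<in> vertices H" "?r (Vertex u) * ?r y = ?r y"
    "v \<in> vertices H" "?r y * ?r (Vertex v) = ?r y"
    by blast
  then show "residue T (vertex_sum * gen y) = residue T (gen y)"
    "residue T (gen y * vertex_sum) = residue T (gen y)"
    using absorb_left[of u "?r y"] absorb_right[of v "?r y"]
    by (simp_all add: vertex_sum_def residue_mult residue_sum)
qed

lemma leavitt_iso_unital_leavitt:
  "\<exists>\<phi>. grading_preserving_iso
     (hyper_leavitt_algebra H :: ('k::field, _) module) (leavitt_grading H w)
     (unital_leavitt_algebra H) (unital_leavitt_grading H w) \<phi>"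
proof -
  interpret Y: quotient_presentation "free_algebra (leavitt_gens H) ::
    ('k, ('v, 'e, 'i, 'j) leavitt_gen word \<Rightarrow>\<^sub>0 'k) module" "{}"
    by (rule quotient_presentation_free)
  have "vertex_sum \<in> hom_part (free_algebra (leavitt_gens H) ::
    ('k, ('v, 'e, 'i, 'j) leavitt_gen word \<Rightarrow>\<^sub>0 'k) module) (leavitt_degree w) 0"
    unfolding vertex_sum_def
    by (intro Y.hom_part_sum gen_hom_part) (auto simp: leavitt_gens_def)
  from grading_preserving_iso_adjoin_unit[OF leavitt_relations_free_nonunital[OF H]
      vertex_sum_nonunital residue_vertex_sum this]
  show ?thesis
    unfolding hyper_leavitt_algebra_def leavitt_grading_def unital_leavitt_algebra_def
      unital_leavitt_grading_def unital_leavitt_ideal_def unital_leavitt_relations_def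
      leavitt_ideal_eq[OF H] leavitt_free_algebra_eq vertex_sum_def by blast
qed

lemma unital_leavitt: "unital (hyper_leavitt_algebra H :: ('k::field, _) module)"
proof -
  interpret A: quotient_presentation "free_nonunital_algebra (leavitt_gens H) ::
    ('k, ('v, 'e, 'i, 'j) leavitt_gen word \<Rightarrow>\<^sub>0 'k) module" "leavitt_relations H"
    by (rule quotient_presentation_free_nonunital)
  note unit = leavitt_relations_free_nonunital[OF H] vertex_sum_nonunital residue_vertex_sum
  have "A.coset vertex_sum \<otimes>\<^bsub>A.Q\<^esub> x = x \<and> x \<otimes>\<^bsub>A.Q\<^esub> A.coset vertex_sum = x" if "x \<in> carrier A.Q" for x
  proof -
    from that obtain p where p: "p \<in> free_nonunital (leavitt_gens H)" "x = A.coset p"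
      by (auto simp: A.carrier_Q)
    then show ?thesis
      using residue_unit_nonunital[OF unit p(1)] residue_unit_nonunital_right[OF unit p(1)]
      by (simp add: A.mult_Q A.coset_eq_iff A.closed_mult vertex_sum_nonunital)
  qed
  moreover have "A.coset vertex_sum \<in> carrier A.Q"
    using vertex_sum_nonunital by (auto simp: A.carrier_Q)
  ultimately have "unital A.Q"
    unfolding unital_def by blast
  then show ?thesis
    by (simp add: A.Q_def hyper_leavitt_algebra_def leavitt_free_algebra_eq leavitt_ideal_eq[OF H])
qed

end

text \<open>The weight condition makes \<open>w h i j - w h i' j\<close> independent of
  \<open>j\<close>, so all terms of the sum over \<open>j\<close> in the third relation have one
  degree; the sum over \<open>i\<close> is symmetric. For equal indices this degree is zero, the
  degree of the vertex on the other side.\<close>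

lemma unital_leavitt_graded:
  fixes H :: "('v, 'e, 'i, 'j) hypergraph" and w :: "'e \<Rightarrow> 'i \<Rightarrow> 'j \<Rightarrow> 'g::ab_group_add"
  assumes w: "weight_map H i0 j0 w"
  shows "algebra_grading (unital_leavitt_algebra H :: ('k::field, _) module) (unital_leavitt_grading H w)"
proof -
  define dg :: "('v, 'e, 'i, 'j) leavitt_gen \<Rightarrow> 'g" where
    "dg x = (case x of Vertex v \<Rightarrow> 0 | Edge h i j \<Rightarrow> w h i j | EdgeStar h i j \<Rightarrow> - w h i j)" for x
  have dg: "leavitt_degree w = (\<lambda>x. {dg x})"
  proof
    fix x show "leavitt_degree w x = {dg x}" by (cases x) (simp_all add: dg_def)
  qed
  let ?A = "free_algebra UNIV :: ('k, ('v, 'e, 'i, 'j) leavitt_gen word \<Rightarrow>\<^sub>0 'k) module"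
  let ?hom = "hom_part ?A (leavitt_degree w)"
  interpret A: quotient_presentation ?A "{}"
    by (rule quotient_presentation_free)
  have diff: "p - q \<in> ?hom \<delta>" if "p \<in> ?hom \<delta>" "q \<in> ?hom \<delta>" for p q \<delta>
    using A.hom_part_add[OF that(1) A.hom_part_scale[OF that(2), of "- 1"]]
    by (simp add: scale_def single_uminus)
  have gens: "gen (Vertex v) \<in> ?hom 0" "gen (Edge h i j) \<in> ?hom (w h i j)"
    "gen (EdgeStar h i j) \<in> ?hom (- w h i j)" for v h i j
    by (auto intro!: gen_hom_part)
  have mult: "p * q \<in> ?hom \<epsilon>" if "p \<in> ?hom \<gamma>" "q \<in> ?hom \<delta>" "\<epsilon> = \<gamma> + \<delta>" for p q \<gamma> \<delta> \<epsilon>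
    using A.hom_part_mult[OF that(1,2)] that(3) by simp
  have weight: "w h i j - w h i' j = w h i (j0 h) - w h i' (j0 h)"
    "w h i j' - w h i j = w h (i0 h) j' - w h (i0 h) j"
    if "h \<in> hyperedges H" "i \<in> src_index H h" "i' \<in> src_index H h" "j \<in> rng_index H h"
      "j' \<in> rng_index H h" for h i i' j j'
  proof -
    have "w h i j = w h i (j0 h) - w h (i0 h) (j0 h) + w h (i0 h) j"
      if "i \<in> src_index H h" "j \<in> rng_index H h" for i j
      using w \<open>h \<in> hyperedges H\<close> that unfolding weight_map_def by blast
    note eq = this[OF that(2,4)] this[OF that(3,4)] this[OF that(2,5)]
    show "w h i j - w h i' j = w h i (j0 h) - w h i' (j0 h)"
      "w h i j' - w h i j = w h (i0 h) j' - w h (i0 h) j"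
      unfolding eq by (simp_all add: algebra_simps)
  qed
  have "\<exists>\<delta>. s \<in> ?hom \<delta>" if s: "s \<in> unital_leavitt_relations H" for s
  proof (cases "s \<in> leavitt_relations H")
    case False
    then have "s = 1 - (\<Sum>v\<in>vertices H. gen (Vertex v))"
      using s by (simp add: unital_leavitt_relations_def)
    moreover have "1 \<in> ?hom 0" by (simp add: hom_part_def free_one)
    ultimately show ?thesis
      by (auto intro!: exI[of _ 0] diff A.hom_part_sum gens)
  next
    case True
    then consider u v where "s = gen (Vertex u) * gen (Vertex v) - (if u = v then gen (Vertex u) else 0)"
      | h i j where "s = gen (Vertex (src H h i)) * gen (Edge h i j) - gen (Edge h i j)"
      | h i j where "s = gen (Edge h i j) * gen (Vertex (rng H h j)) - gen (Edge h i j)"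
      | h i j where "s = gen (Vertex (rng H h j)) * gen (EdgeStar h i j) - gen (EdgeStar h i j)"
      | h i j where "s = gen (EdgeStar h i j) * gen (Vertex (src H h i)) - gen (EdgeStar h i j)"
      | h i i' where "h \<in> hyperedges H" "i \<in> src_index H h" "i' \<in> src_index H h"
        "s = (\<Sum>j\<in>rng_index H h. gen (Edge h i j) * gen (EdgeStar h i' j)) -
          (if i = i' then gen (Vertex (src H h i)) else 0)"
      | h j j' where "h \<in> hyperedges H" "j \<in> rng_index H h" "j' \<in> rng_index H h"
        "s = (\<Sum>i\<in>src_index H h. gen (EdgeStar h i j) * gen (Edge h i j')) -
          (if j = j' then gen (Vertex (rng H h j)) else 0)"
      unfolding leavitt_relations_def Let_def by blast
    then show ?thesis
    proof cases
      case (1 u v)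
      then show ?thesis
        by (auto intro!: exI[of _ 0] diff mult[OF gens(1) gens(1)] gens A.hom_part_zero)
    next
      case (2 h i j)
      show ?thesis
        unfolding 2 by (rule exI[of _ "w h i j"]) (auto intro!: diff mult[OF gens(1) gens(2)] gens)
    next
      case (3 h i j)
      show ?thesis
        unfolding 3 by (rule exI[of _ "w h i j"]) (auto intro!: diff mult[OF gens(2) gens(1)] gens)
    next
      case (4 h i j)
      show ?thesis
        unfolding 4 by (rule exI[of _ "- w h i j"]) (auto intro!: diff mult[OF gens(1) gens(3)] gens)
    next
      case (5 h i j)
      show ?thesis
        unfolding 5 by (rule exI[of _ "- w h i j"]) (auto intro!: diff mult[OF gens(3) gens(1)] gens)
    next
      case (6 h i i')
      have "(if i = i' then gen (Vertex (src H h i)) else 0) \<in> ?hom (w h i (j0 h) - w h i' (j0 h))"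
        by (simp add: gens A.hom_part_zero)
      moreover have "gen (Edge h i j) * gen (EdgeStar h i' j) \<in> ?hom (w h i (j0 h) - w h i' (j0 h))"
        if "j \<in> rng_index H h" for j
        using weight(1)[OF 6(1,2,3) that that] by (intro mult[OF gens(2) gens(3)]) simp
      ultimately show ?thesis
        unfolding 6(4) by (intro exI diff A.hom_part_sum)
    next
      case (7 h j j')
      have "(if j = j' then gen (Vertex (rng H h j)) else 0) \<in> ?hom (w h (i0 h) j' - w h (i0 h) j)"
        by (simp add: gens A.hom_part_zero)
      moreover have "gen (EdgeStar h i j) * gen (Edge h i j') \<in> ?hom (w h (i0 h) j' - w h (i0 h) j)"
        if "i \<in> src_index H h" for i
        using weight(2)[OF 7(1) that that 7(2,3)] by (intro mult[OF gens(3) gens(2)]) simp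
      ultimately show ?thesis
        unfolding 7(4) by (intro exI diff A.hom_part_sum)
    qed
  qed
  moreover have "word_degree dg v = \<delta>" if "p \<in> ?hom \<delta>" "v \<in> Poly_Mapping.keys p" for p \<delta> v
    using that unfolding hom_part_def dg word_degrees_singleton by simp
  ultimately have "\<exists>\<delta>. \<forall>v\<in>Poly_Mapping.keys s. word_degree dg v = \<delta>"
    if "s \<in> unital_leavitt_relations H" for s :: "('v, 'e, 'i, 'j) leavitt_gen word \<Rightarrow>\<^sub>0 'k"
    using that by blast
  from algebra_grading_free_quotient[OF this] show ?thesis
    unfolding unital_leavitt_algebra_def unital_leavitt_grading_def unital_leavitt_ideal_def dg .
qed

subsection \<open>Discarding vertices that vanish\<close>

text \<open>The type argument names the field, which occurs neither in \<open>H\<close> nor in the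
  result, although vanishing is tested over it.\<close>

definition killed ::
  "'k::field itself \<Rightarrow> ('v, 'e, 'i, 'j) hypergraph \<Rightarrow> 'v set" where
  "killed _ H = {v \<in> vertices H. residue (unital_leavitt_relations H ::
     (('v, 'e, 'i, 'j) leavitt_gen word \<Rightarrow>\<^sub>0 'k) set) (gen (Vertex v)) = 0}"

text \<open>An edge is kept if one of its sources survives. For the killed vertices,
  \<open>killed_sources_iff\<close> shows that a test on ranges would select the same edges.\<close>

definition discard :: "'v set \<Rightarrow> ('v, 'e, 'i, 'j) hypergraph \<Rightarrow> ('v, 'e, 'i, 'j) hypergraph" where
  "discard K H = H\<lparr>vertices := vertices H - K,
     hyperedges := {h \<in> hyperedges H. \<exists>i\<in>src_index H h. src H h i \<notin> K},
     src_index := (\<lambda>h. {i \<in> src_index H h. src H h i \<notin> K}),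
     rng_index := (\<lambda>h. {j \<in> rng_index H h. rng H h j \<notin> K})\<rparr>"

context
  fixes H :: "('v, 'e, 'i, 'j) hypergraph" and K :: "'v set"
    and T :: "(('v, 'e, 'i, 'j) leavitt_gen word \<Rightarrow>\<^sub>0 'k::field) set"
  defines "T \<equiv> unital_leavitt_relations H" and "K \<equiv> killed TYPE('k) H"
  assumes finite_vertices: "finite (vertices H)"
    and finite_src: "h \<in> hyperedges H \<Longrightarrow> finite (src_index H h)"
    and finite_rng: "h \<in> hyperedges H \<Longrightarrow> finite (rng_index H h)"
    and src_vertex: "h \<in> hyperedges H \<Longrightarrow> i \<in> src_index H h \<Longrightarrow> src H h i \<in> vertices H"
    and rng_vertex: "h \<in> hyperedges H \<Longrightarrow> j \<in> rng_index H h \<Longrightarrow> rng H h j \<in> vertices H"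
begin

lemma K_iff: "v \<in> K \<longleftrightarrow> v \<in> vertices H \<and> residue T (gen (Vertex v)) = 0"
  by (simp add: K_def T_def killed_def)

lemma leavitt_relations_T: "leavitt_relations H \<subseteq> T"
  by (auto simp: T_def unital_leavitt_relations_def)

lemmas T_rel = leavitt_relationsD[OF leavitt_relations_T]

lemma killed_edges:
  assumes "h \<in> hyperedges H" "i \<in> src_index H h" "j \<in> rng_index H h" "src H h i \<in> K \<or> rng H h j \<in> K"
  shows "residue T (gen (Edge h i j)) = 0" "residue T (gen (EdgeStar h i j)) = 0"
  using assms(4) T_rel(2,3,4,5)[OF assms(1-3)] by (auto simp: K_iff)

text \<open>If all range vertices of \<open>h\<close> vanish, so do all its edge generators, and
  then every source vanishes, being a sum of products of them. The converse is symmetric.\<close>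

lemma killed_sources_iff:
  assumes h: "h \<in> hyperedges H"
  shows "(\<exists>i\<in>src_index H h. src H h i \<notin> K) \<longleftrightarrow> (\<exists>j\<in>rng_index H h. rng H h j \<notin> K)"
proof
  assume "\<exists>i\<in>src_index H h. src H h i \<notin> K"
  then obtain i where i: "i \<in> src_index H h" "src H h i \<notin> K" by blast
  show "\<exists>j\<in>rng_index H h. rng H h j \<notin> K"
  proof (rule ccontr)
    assume "\<not> (\<exists>j\<in>rng_index H h. rng H h j \<notin> K)"
    then have "residue T (gen (Vertex (src H h i))) = 0"
      using T_rel(6)[OF h i(1) i(1)] killed_edges[OF h i(1)] by simp
    then show False using i src_vertex[OF h] by (simp add: K_iff)
  qed
next
  assume "\<exists>j\<in>rng_index H h. rng H h j \<notin> K"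
  then obtain j where j: "j \<in> rng_index H h" "rng H h j \<notin> K" by blast
  show "\<exists>i\<in>src_index H h. src H h i \<notin> K"
  proof (rule ccontr)
    assume "\<not> (\<exists>i\<in>src_index H h. src H h i \<notin> K)"
    then have "residue T (gen (Vertex (rng H h j))) = 0"
      using T_rel(7)[OF h j(1) j(1)] killed_edges[OF h _ j(1)] by simp
    then show False using j rng_vertex[OF h] by (simp add: K_iff)
  qed
qed

lemma discard_hypergraph: "is_hypergraph (discard K H)"
  unfolding is_hypergraph_def
proof (intro ballI)
  fix h assume "h \<in> hyperedges (discard K H)"
  then have h: "h \<in> hyperedges H" "\<exists>i\<in>src_index H h. src H h i \<notin> K" by (auto simp: discard_def)
  with killed_sources_iff have "\<exists>j\<in>rng_index H h. rng H h j \<notin> K" by blast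
  with h show "finite (src_index (discard K H) h) \<and> src_index (discard K H) h \<noteq> {} \<and>
      finite (rng_index (discard K H) h) \<and> rng_index (discard K H) h \<noteq> {} \<and>
      (\<forall>i\<in>src_index (discard K H) h. src (discard K H) h i \<in> vertices (discard K H)) \<and>
      (\<forall>j\<in>rng_index (discard K H) h. rng (discard K H) h j \<in> vertices (discard K H))"
    using finite_src finite_rng src_vertex rng_vertex by (auto simp: discard_def)
qed

text \<open>Every discarded generator is already zero modulo the relations of \<open>H\<close>.
  Hence sending these generators to zero is inverse to the inclusion of the others.\<close>

lemma discard_iso:
  "\<exists>\<phi>. grading_preserving_iso
     (unital_leavitt_algebra H :: ('k, _) module) (unital_leavitt_grading H w)
     (unital_leavitt_algebra (discard K H)) (unital_leavitt_grading (discard K H) w) \<phi>"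
proof -
  let ?H = "discard K H"
  define T' :: "(('v, 'e, 'i, 'j) leavitt_gen word \<Rightarrow>\<^sub>0 'k) set" where
    "T' = unital_leavitt_relations ?H"
  have "leavitt_relations ?H \<subseteq> T'" by (auto simp: T'_def unital_leavitt_relations_def)
  note T'_rel = leavitt_relationsD[OF this]
  have H_sel: "vertices ?H = vertices H - K"
    "hyperedges ?H = {h \<in> hyperedges H. \<exists>i\<in>src_index H h. src H h i \<notin> K}"
    "src_index ?H h = {i \<in> src_index H h. src H h i \<notin> K}"
    "rng_index ?H h = {j \<in> rng_index H h. rng H h j \<notin> K}"
    "src ?H = src H" "rng ?H = rng H" for h
    by (simp_all add: discard_def)
  define t :: "('v, 'e, 'i, 'j) leavitt_gen \<Rightarrow> ('v, 'e, 'i, 'j) leavitt_gen word \<Rightarrow>\<^sub>0 'k" where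
    "t x = (case x of
        Vertex v \<Rightarrow> if v \<in> K then 0 else gen x
      | Edge h i j \<Rightarrow> if src H h i \<in> K \<or> rng H h j \<in> K then 0 else gen x
      | EdgeStar h i j \<Rightarrow> if src H h i \<in> K \<or> rng H h j \<in> K then 0 else gen x)" for x
  have t: "t (Vertex v) = (if v \<in> K then 0 else gen (Vertex v))"
    "t (Edge h i j) = (if src H h i \<in> K \<or> rng H h j \<in> K then 0 else gen (Edge h i j))"
    "t (EdgeStar h i j) = (if src H h i \<in> K \<or> rng H h j \<in> K then 0 else gen (EdgeStar h i j))"
    for v h i j by (simp_all add: t_def)
  have t_cases: "t x = gen x \<and> x \<in> leavitt_gens ?H \<or> t x = 0 \<and> residue T (gen x) = 0"
    if "x \<in> leavitt_gens H" for x
  proof -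
    have vertex: "residue T (gen (Vertex v)) = 0" if "v \<in> K" for v
      using that by (simp add: K_iff)
    show ?thesis
      using that unfolding leavitt_gens_def H_sel
      by (elim UnE imageE CollectE exE conjE) (auto simp: t intro: vertex killed_edges)
  qed
  have one: "residue T (\<Sum>v\<in>vertices H. gen (Vertex v)) = residue T 1"
    "residue T' (\<Sum>v\<in>vertices H - K. gen (Vertex v)) = residue T' 1"
    using residue_base[of "1 - (\<Sum>v\<in>vertices H. gen (Vertex v))" T]
      residue_base[of "1 - (\<Sum>v\<in>vertices ?H. gen (Vertex v))" T']
    by (simp_all add: T_def T'_def unital_leavitt_relations_def residue_diff H_sel)
  have vertex_eq: "(\<Sum>v\<in>vertices H. residue T (gen (Vertex v))) =
      (\<Sum>v\<in>vertices H - K. residue T (gen (Vertex v)))"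
    using finite_vertices by (intro sum.mono_neutral_right) (auto simp: K_iff)
  have t_rel: "residue T' (subst t s) = 0" if s: "s \<in> T" for s
  proof (cases "s \<in> leavitt_relations H")
    case False
    then have "s = 1 - (\<Sum>v\<in>vertices H. gen (Vertex v))"
      using s by (simp add: T_def unital_leavitt_relations_def)
    moreover have "(\<Sum>v\<in>vertices H. t (Vertex v)) = (\<Sum>v\<in>vertices H - K. gen (Vertex v))"
      using finite_vertices by (intro sum.mono_neutral_cong_right) (auto simp: t)
    ultimately show ?thesis using one(2) by (simp add: subst_simps residue_diff)
  next
    case True
    show ?thesis
    proof (rule subst_leavitt_relations_zero[OF _ _ _ _ _ _ _ True])
      fix u v assume "u \<in> vertices H" "v \<in> vertices H"
      then show "residue T' (t (Vertex u)) * residue T' (t (Vertex v)) =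
          (if u = v then residue T' (t (Vertex u)) else 0)"
        using T'_rel(1)[of u v] by (auto simp: t residue_zero H_sel)
    next
      fix h assume h: "h \<in> hyperedges H"
      fix i i' j j'
      have mem: "h \<in> hyperedges ?H \<and> i \<in> src_index ?H h"
        if "i \<in> src_index H h" "src H h i \<notin> K" for i
        using h that by (auto simp: H_sel)
      \<comment> \<open>\<open>discard\<close> tests sources, so a surviving range vertex keeps its
        edge only through \<open>killed_sources_iff\<close>.\<close>
      have mem': "h \<in> hyperedges ?H \<and> j \<in> rng_index ?H h"
        if "j \<in> rng_index H h" "rng H h j \<notin> K" for j
        using h that killed_sources_iff[OF h] by (auto simp: H_sel)
      show "residue T' (t (Vertex (src H h i))) * residue T' (t (Edge h i j)) = residue T' (t (Edge h i j))"
        if "i \<in> src_index H h" "j \<in> rng_index H h"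
        using T'_rel(2)[of h i j] mem[of i] mem'[of j] that by (auto simp: t residue_zero H_sel)
      show "residue T' (t (Edge h i j)) * residue T' (t (Vertex (rng H h j))) = residue T' (t (Edge h i j))"
        if "i \<in> src_index H h" "j \<in> rng_index H h"
        using T'_rel(3)[of h i j] mem[of i] mem'[of j] that by (auto simp: t residue_zero H_sel)
      show "residue T' (t (Vertex (rng H h j))) * residue T' (t (EdgeStar h i j)) =
          residue T' (t (EdgeStar h i j))"
        if "i \<in> src_index H h" "j \<in> rng_index H h"
        using T'_rel(4)[of h i j] mem[of i] mem'[of j] that by (auto simp: t residue_zero H_sel)
      show "residue T' (t (EdgeStar h i j)) * residue T' (t (Vertex (src H h i))) =
          residue T' (t (EdgeStar h i j))"
        if "i \<in> src_index H h" "j \<in> rng_index H h"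
        using T'_rel(5)[of h i j] mem[of i] mem'[of j] that by (auto simp: t residue_zero H_sel)
      show "(\<Sum>j\<in>rng_index H h. residue T' (t (Edge h i j)) * residue T' (t (EdgeStar h i' j))) =
          (if i = i' then residue T' (t (Vertex (src H h i))) else 0)"
        if i: "i \<in> src_index H h" "i' \<in> src_index H h"
      proof (cases "src H h i \<in> K \<or> src H h i' \<in> K")
        case True
        then show ?thesis by (auto simp: t residue_zero)
      next
        case False
        have "(\<Sum>j\<in>rng_index H h. residue T' (t (Edge h i j)) * residue T' (t (EdgeStar h i' j))) =
          (\<Sum>j\<in>rng_index ?H h. residue T' (gen (Edge h i j)) * residue T' (gen (EdgeStar h i' j)))"
          using False finite_rng[OF h]
          by (intro sum.mono_neutral_cong_right) (auto simp: t residue_zero H_sel)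
        then show ?thesis
          using T'_rel(6)[of h i i'] mem i False by (simp add: t H_sel)
      qed
      show "(\<Sum>i\<in>src_index H h. residue T' (t (EdgeStar h i j)) * residue T' (t (Edge h i j'))) =
          (if j = j' then residue T' (t (Vertex (rng H h j))) else 0)"
        if j: "j \<in> rng_index H h" "j' \<in> rng_index H h"
      proof (cases "rng H h j \<in> K \<or> rng H h j' \<in> K")
        case True
        then show ?thesis by (auto simp: t residue_zero)
      next
        case False
        have "(\<Sum>i\<in>src_index H h. residue T' (t (EdgeStar h i j)) * residue T' (t (Edge h i j'))) =
          (\<Sum>i\<in>src_index ?H h. residue T' (gen (EdgeStar h i j)) * residue T' (gen (Edge h i j')))"
          using False finite_src[OF h]
          by (intro sum.mono_neutral_cong_right) (auto simp: t residue_zero H_sel)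
        then show ?thesis
          using T'_rel(7)[of h j j'] mem' j False by (simp add: t H_sel)
      qed
    qed
  qed
  have t'_rel: "residue T (subst gen s) = 0" if s: "s \<in> T'" for s
  proof (cases "s \<in> leavitt_relations ?H")
    case False
    then have "s = 1 - (\<Sum>v\<in>vertices H - K. gen (Vertex v))"
      using s by (simp add: T'_def unital_leavitt_relations_def H_sel)
    then show ?thesis using one(1) vertex_eq by (simp add: subst_simps residue_diff residue_sum)
  next
    case True
    show ?thesis
    proof (rule subst_leavitt_relations_zero[OF _ _ _ _ _ _ _ True])
      fix h assume "h \<in> hyperedges ?H"
      then have h: "h \<in> hyperedges H" by (simp add: H_sel)
      fix i i' j j'
      show "(\<Sum>j\<in>rng_index ?H h. residue T (gen (Edge h i j)) * residue T (gen (EdgeStar h i' j))) =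
          (if i = i' then residue T (gen (Vertex (src ?H h i))) else 0)"
        if i: "i \<in> src_index ?H h" "i' \<in> src_index ?H h"
      proof -
        have "(\<Sum>j\<in>rng_index ?H h. residue T (gen (Edge h i j)) * residue T (gen (EdgeStar h i' j))) =
            (\<Sum>j\<in>rng_index H h. residue T (gen (Edge h i j)) * residue T (gen (EdgeStar h i' j)))"
          using i finite_rng[OF h]
          by (intro sum.mono_neutral_left) (auto simp: H_sel killed_edges[OF h])
        then show ?thesis using T_rel(6)[OF h, of i i'] i by (simp add: H_sel)
      qed
      show "(\<Sum>i\<in>src_index ?H h. residue T (gen (EdgeStar h i j)) * residue T (gen (Edge h i j'))) =
          (if j = j' then residue T (gen (Vertex (rng ?H h j))) else 0)"
        if j: "j \<in> rng_index ?H h" "j' \<in> rng_index ?H h"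
      proof -
        have "(\<Sum>i\<in>src_index ?H h. residue T (gen (EdgeStar h i j)) * residue T (gen (Edge h i j'))) =
            (\<Sum>i\<in>src_index H h. residue T (gen (EdgeStar h i j)) * residue T (gen (Edge h i j')))"
          using j finite_src[OF h]
          by (intro sum.mono_neutral_left) (auto simp: H_sel killed_edges[OF h])
        then show ?thesis using T_rel(7)[OF h, of j j'] j by (simp add: H_sel)
      qed
    qed (simp_all add: H_sel T_rel)
  qed
  have gens_subset: "leavitt_gens ?H \<subseteq> leavitt_gens H"
    by (auto simp: leavitt_gens_def H_sel)
  have t_gen: "t x = gen x" if "x \<in> leavitt_gens ?H" for x
    using that by (auto simp: leavitt_gens_def H_sel t)
  interpret Z: quotient_presentation "free_algebra (leavitt_gens ?H) ::
    ('k, ('v, 'e, 'i, 'j) leavitt_gen word \<Rightarrow>\<^sub>0 'k) module" "{}"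
    by (rule quotient_presentation_free)
  show ?thesis
    unfolding unital_leavitt_algebra_def unital_leavitt_grading_def unital_leavitt_ideal_def
      T_def[symmetric] T'_def[symmetric]
  proof (rule grading_preserving_iso_subst[of _ t _ gen])
    fix x assume x: "x \<in> leavitt_gens H"
    show "t x \<in> free (leavitt_gens ?H)"
      using t_cases[OF x] by (auto intro: free_gen free_zero)
    show "residue T (subst gen (t x)) = residue T (gen x)"
      using t_cases[OF x] by (auto simp: subst_simps residue_zero)
    show "t x \<in> hom_part (free_algebra (leavitt_gens ?H)) (leavitt_degree w) \<gamma>"
      if "\<gamma> \<in> leavitt_degree w x" for \<gamma>
      using t_cases[OF x] that by (auto intro: gen_hom_part Z.hom_part_zero)
  next
    fix x assume x: "x \<in> leavitt_gens ?H"
    show "gen x \<in> free (leavitt_gens H)" using x gens_subset by (auto intro: free_gen)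
    show "residue T' (subst t (gen x)) = residue T' (gen x)" using x by (simp add: subst_gen t_gen)
    show "gen x \<in> hom_part (free_algebra (leavitt_gens H)) (leavitt_degree w) \<gamma>"
      if "\<gamma> \<in> leavitt_degree w x" for \<gamma>
      using x that gens_subset by (auto intro: gen_hom_part)
  qed (simp_all add: t_rel t'_rel)
qed

end

subsection \<open>A unital Leavitt path algebra has finitely many vertices\<close>

text \<open>
  The algebra acts on functions on \<open>vertices \<times> \<nat>\<close>: since \<open>I\<^sub>h\<close> and \<open>J\<^sub>h\<close> are finite and nonempty,
  \<open>I\<^sub>h \<times> \<nat>\<close> and \<open>J\<^sub>h \<times> \<nat>\<close> are in bijection, and \<open>h\<^sub>i\<^sub>j\<close> acts as the corresponding block of that
  bijection. In particular no vertex vanishes.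
\<close>

context
  fixes H :: "('v, 'e, 'i, 'j) hypergraph"
  assumes H: "is_hypergraph H"
begin

definition src_code :: "'e \<Rightarrow> 'i \<times> nat \<Rightarrow> nat" where
  "src_code h = to_nat_on (src_index H h \<times> UNIV)"

definition rng_code :: "'e \<Rightarrow> 'j \<times> nat \<Rightarrow> nat" where
  "rng_code h = to_nat_on (rng_index H h \<times> UNIV)"

definition src_decode :: "'e \<Rightarrow> nat \<Rightarrow> 'i \<times> nat" where
  "src_decode h = from_nat_into (src_index H h \<times> UNIV)"

definition rng_decode :: "'e \<Rightarrow> nat \<Rightarrow> 'j \<times> nat" where
  "rng_decode h = from_nat_into (rng_index H h \<times> UNIV)"

lemma product_nat:
  assumes "finite A" "A \<noteq> {}"
  shows "countable (A \<times> (UNIV :: nat set))" "infinite (A \<times> (UNIV :: nat set))"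
  using assms by (auto simp: countable_finite finite_cartesian_product_iff)

lemma src_decode_code:
  "h \<in> hyperedges H \<Longrightarrow> i \<in> src_index H h \<Longrightarrow> src_decode h (src_code h (i, k)) = (i, k)"
  using H product_nat[of "src_index H h"]
  by (simp add: src_decode_def src_code_def is_hypergraph_def)

lemma rng_decode_code:
  "h \<in> hyperedges H \<Longrightarrow> j \<in> rng_index H h \<Longrightarrow> rng_decode h (rng_code h (j, k)) = (j, k)"
  using H product_nat[of "rng_index H h"]
  by (simp add: rng_decode_def rng_code_def is_hypergraph_def)

lemma src_code_decode: "h \<in> hyperedges H \<Longrightarrow> src_code h (src_decode h k) = k"
  using H product_nat[of "src_index H h"]
  by (simp add: src_decode_def src_code_def is_hypergraph_def)

lemma rng_code_decode: "h \<in> hyperedges H \<Longrightarrow> rng_code h (rng_decode h k) = k"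
  using H product_nat[of "rng_index H h"]
  by (simp add: rng_decode_def rng_code_def is_hypergraph_def)

lemma fst_src_decode: "h \<in> hyperedges H \<Longrightarrow> fst (src_decode h k) \<in> src_index H h"
  using H from_nat_into[of "src_index H h \<times> (UNIV :: nat set)" k]
  by (auto simp: src_decode_def is_hypergraph_def mem_Times_iff)

lemma fst_rng_decode: "h \<in> hyperedges H \<Longrightarrow> fst (rng_decode h k) \<in> rng_index H h"
  using H from_nat_into[of "rng_index H h \<times> (UNIV :: nat set)" k]
  by (auto simp: rng_decode_def is_hypergraph_def mem_Times_iff)

text \<open>Functions are pulled back along the bijection between the two index products:
  \<open>Edge h i j\<close> reads at \<open>rng H h j\<close> and writes at
  \<open>src H h i\<close>, in agreement with the absorption of these vertices on the right and on
  the left.\<close>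

fun ope :: "('v, 'e, 'i, 'j) leavitt_gen \<Rightarrow> ('v \<times> nat \<Rightarrow> 'k::field) \<Rightarrow> 'v \<times> nat \<Rightarrow> 'k" where
  "ope (Vertex u) f = (\<lambda>(v, k). if v = u then f (v, k) else 0)"
| "ope (Edge h i j) f = (\<lambda>(v, k). let z = rng_decode h (src_code h (i, k)) in
     if v = src H h i \<and> fst z = j then f (rng H h j, snd z) else 0)"
| "ope (EdgeStar h i j) f = (\<lambda>(v, k). let z = src_decode h (rng_code h (j, k)) in
     if v = rng H h j \<and> fst z = i then f (src H h i, snd z) else 0)"

text \<open>The only vertex at which the operator of a generator reads its argument. A function
  supported at any other vertex is sent to zero.\<close>

fun input_vertex :: "('v, 'e, 'i, 'j) leavitt_gen \<Rightarrow> 'v" where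
  "input_vertex (Vertex u) = u"
| "input_vertex (Edge h i j) = rng H h j"
| "input_vertex (EdgeStar h i j) = src H h i"

definition fun_scale :: "'k::field \<Rightarrow> ('v \<times> nat \<Rightarrow> 'k) \<Rightarrow> 'v \<times> nat \<Rightarrow> 'k" where
  "fun_scale c f = (\<lambda>z. c * f z)"

lemma word_action_ope: "word_action (fun_scale :: 'k::field \<Rightarrow> _) ope"
proof
  fix x and f g :: "'v \<times> nat \<Rightarrow> 'k" and c
  show "ope x (f + g) = ope x f + ope x g"
    by (cases x) (auto simp: fun_eq_iff Let_def)
  show "ope x (fun_scale c f) = fun_scale c (ope x f)"
    by (cases x) (auto simp: fun_eq_iff Let_def fun_scale_def)
qed (auto simp: fun_eq_iff fun_scale_def algebra_simps)

lemma sum_fun_apply: "(\<Sum>a\<in>A. f a) z = (\<Sum>a\<in>A. f a z)"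
  for f :: "'a \<Rightarrow> 'b \<Rightarrow> 'c::comm_monoid_add"
  by (induction A rule: infinite_finite_induct) simp_all

lemma leavitt_ideal_acts_trivially:
  fixes p :: "('v, 'e, 'i, 'j) leavitt_gen word \<Rightarrow>\<^sub>0 'k::field"
  assumes "p \<in> ideal_of (leavitt_relations H)"
  shows "act fun_scale ope p f = 0"
proof -
  interpret word_action "fun_scale :: 'k \<Rightarrow> _" ope by (rule word_action_ope)
  note act = act_diff act_mult act_gen act_sum act_zero
  have edge_star: "(\<Sum>j\<in>rng_index H h. ope (Edge h i j) (ope (EdgeStar h i' j) f)) =
      (if i = i' then ope (Vertex (src H h i)) f else 0)"
    if "h \<in> hyperedges H" "i \<in> src_index H h" for h i i' and f :: "'v \<times> nat \<Rightarrow> 'k"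
  proof
    fix z :: "'v \<times> nat"
    obtain v k where z: "z = (v, k)" by (cases z)
    \<comment> \<open>The pair \<open>(y, l)\<close> is the image of \<open>(i, k)\<close> under the
      bijection. Only the summand \<open>j = y\<close> survives, and the starred operator leads back
      to \<open>(i, k)\<close>.\<close>
    obtain y l where eq: "rng_decode h (src_code h (i, k)) = (y, l)" by (metis prod.exhaust)
    have y: "y \<in> rng_index H h" "src_decode h (rng_code h (y, l)) = (i, k)"
      using that fst_rng_decode[of h "src_code h (i, k)"]
      by (simp_all add: eq) (simp add: rng_code_decode src_decode_code flip: eq)
    have "(\<Sum>j\<in>rng_index H h. ope (Edge h i j) (ope (EdgeStar h i' j) f)) z =
      (\<Sum>j\<in>rng_index H h. if j = y then (if v = src H h i \<and> i = i' then f (v, k) else 0) else 0)"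
      unfolding sum_fun_apply
    proof (intro sum.cong refl)
      fix j
      show "ope (Edge h i j) (ope (EdgeStar h i' j) f) z =
        (if j = y then (if v = src H h i \<and> i = i' then f (v, k) else 0) else 0)"
        by (cases "j = y"; cases "i' = i"; cases "v = src H h i"; simp add: z Let_def eq y(2); auto)
    qed
    also have "\<dots> = (if i = i' then ope (Vertex (src H h i)) f else 0) z"
      using y(1) that H by (auto simp: z is_hypergraph_def)
    finally show "(\<Sum>j\<in>rng_index H h. ope (Edge h i j) (ope (EdgeStar h i' j) f)) z =
      (if i = i' then ope (Vertex (src H h i)) f else 0) z" .
  qed
  have star_edge: "(\<Sum>i\<in>src_index H h. ope (EdgeStar h i j) (ope (Edge h i j') f)) =
      (if j = j' then ope (Vertex (rng H h j)) f else 0)"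
    if "h \<in> hyperedges H" "j \<in> rng_index H h" for h j j' and f :: "'v \<times> nat \<Rightarrow> 'k"
  proof
    fix z :: "'v \<times> nat"
    obtain v k where z: "z = (v, k)" by (cases z)
    obtain y l where eq: "src_decode h (rng_code h (j, k)) = (y, l)" by (metis prod.exhaust)
    have y: "y \<in> src_index H h" "rng_decode h (src_code h (y, l)) = (j, k)"
      using that fst_src_decode[of h "rng_code h (j, k)"]
      by (simp_all add: eq) (simp add: src_code_decode rng_decode_code flip: eq)
    have "(\<Sum>i\<in>src_index H h. ope (EdgeStar h i j) (ope (Edge h i j') f)) z =
      (\<Sum>i\<in>src_index H h. if i = y then (if v = rng H h j \<and> j = j' then f (v, k) else 0) else 0)"
      unfolding sum_fun_apply
    proof (intro sum.cong refl)
      fix i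
      show "ope (EdgeStar h i j) (ope (Edge h i j') f) z =
        (if i = y then (if v = rng H h j \<and> j = j' then f (v, k) else 0) else 0)"
        by (cases "i = y"; cases "j' = j"; cases "v = rng H h j"; simp add: z Let_def eq y(2); auto)
    qed
    also have "\<dots> = (if j = j' then ope (Vertex (rng H h j)) f else 0) z"
      using y(1) that H by (auto simp: z is_hypergraph_def)
    finally show "(\<Sum>i\<in>src_index H h. ope (EdgeStar h i j) (ope (Edge h i j') f)) z =
      (if j = j' then ope (Vertex (rng H h j)) f else 0) z" .
  qed
  have absorb: "ope (Vertex u) (ope (Vertex v) f) = (if u = v then ope (Vertex u) f else 0)"
    "ope (Vertex (src H h i)) (ope (Edge h i j) f) = ope (Edge h i j) f"
    "ope (Edge h i j) (ope (Vertex (rng H h j)) f) = ope (Edge h i j) f"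
    "ope (Vertex (rng H h j)) (ope (EdgeStar h i j) f) = ope (EdgeStar h i j) f"
    "ope (EdgeStar h i j) (ope (Vertex (src H h i)) f) = ope (EdgeStar h i j) f"
    for u v h i j and f :: "'v \<times> nat \<Rightarrow> 'k"
    by (auto simp: fun_eq_iff Let_def)
  have act_if: "act fun_scale ope (if b then gen x else 0) f = (if b then ope x f else 0)"
    for b x and f :: "'v \<times> nat \<Rightarrow> 'k"
    by (simp add: act)
  have base: "act fun_scale ope s f = 0" if "s \<in> leavitt_relations H" for s and f :: "'v \<times> nat \<Rightarrow> 'k"
    using that unfolding leavitt_relations_def Let_def
    by (elim UnE UN_E CollectE exE conjE;
        simp only: act act_if absorb edge_star star_edge diff_self)
  show ?thesis
    using assms
  \<comment> \<open>The function varies because a multiplier on the right acts on it before the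
    ideal element does.\<close>
  proof (induction arbitrary: f)
    case (left x a)
    then show ?case by (simp only: act_mult act_zero_right)
  qed (simp_all add: base act_zero act_add act_mult)
qed

text \<open>A left unit \<open>p\<close> has finitely many words, and the last letter of each acts
  before the others. With infinitely many vertices, some \<open>v\<close> is read by none of these
  letters, so \<open>p\<close> annihilates the indicator function at \<open>(v, 0)\<close>. But
  \<open>p\<close> times \<open>v\<close> equals \<open>v\<close> in the algebra, and
  \<open>v\<close> fixes that function.\<close>

lemma unital_imp_finite_vertices:
  assumes "unital (hyper_leavitt_algebra H :: ('k::field, _) module)"
  shows "finite (vertices H)"
proof (rule ccontr)
  assume infinite: "infinite (vertices H)"
  interpret word_action "fun_scale :: 'k \<Rightarrow> _" ope by (rule word_action_ope)
  interpret A: quotient_presentation "free_nonunital_algebra (leavitt_gens H) ::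
    ('k, ('v, 'e, 'i, 'j) leavitt_gen word \<Rightarrow>\<^sub>0 'k) module" "leavitt_relations H"
    by (rule quotient_presentation_free_nonunital)
  have "unital A.Q"
    using assms by (simp add: A.Q_def hyper_leavitt_algebra_def leavitt_free_algebra_eq
        leavitt_ideal_eq[OF H])
  then obtain p where p: "p \<in> free_nonunital (leavitt_gens H)"
    and unit: "\<And>x. x \<in> carrier A.Q \<Longrightarrow> A.coset p \<otimes>\<^bsub>A.Q\<^esub> x = x"
    unfolding unital_def by (auto simp: A.carrier_Q)
  have "finite ((\<lambda>w. input_vertex (last (letters w))) ` Poly_Mapping.keys p)" by simp
  with infinite obtain v where v: "v \<in> vertices H"
    "v \<notin> (\<lambda>w. input_vertex (last (letters w))) ` Poly_Mapping.keys p"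
    by (meson finite_subset subsetI)
  define f :: "'v \<times> nat \<Rightarrow> 'k" where "f z = (if z = (v, 0) then 1 else 0)" for z
  have "(gen (Vertex v) :: _ \<Rightarrow>\<^sub>0 'k) \<in> free_nonunital (leavitt_gens H)"
    using v(1) by (intro free_nonunital_gen) (auto simp: leavitt_gens_def)
  moreover from this have "A.coset (gen (Vertex v)) \<in> carrier A.Q" by (auto simp: A.carrier_Q)
  ultimately have "residue (leavitt_relations H) (p * gen (Vertex v)) =
      residue (leavitt_relations H) (gen (Vertex v))"
    using unit[of "A.coset (gen (Vertex v))"] p
    by (simp add: A.mult_Q A.coset_eq_iff A.closed_mult)
  then have "act fun_scale ope (p * gen (Vertex v) - gen (Vertex v)) f = 0"
    by (intro leavitt_ideal_acts_trivially) (simp add: residue_eq_iff)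
  then have "act fun_scale ope p (ope (Vertex v) f) = ope (Vertex v) f"
    by (simp only: act_diff act_mult act_gen right_minus_eq)
  moreover have "ope (Vertex v) f = f"
    by (auto simp: f_def fun_eq_iff)
  moreover have "act fun_scale ope p f = 0"
    unfolding act_def
  proof (rule sum.neutral, rule ballI)
    fix w assume w: "w \<in> Poly_Mapping.keys p"
    then have "letters w \<noteq> []" using p by (auto simp: free_nonunital_iff')
    then obtain xs x where xs: "letters w = xs @ [x]" by (cases "letters w" rule: rev_cases) auto
    then have "input_vertex x \<noteq> v" using v(2) w by force
    then have "ope x f = 0"
      by (cases x) (auto simp: f_def fun_eq_iff Let_def)
    moreover have "foldr ope ys 0 = (0 :: 'v \<times> nat \<Rightarrow> 'k)" for ys
    proof (induction ys)
      case (Cons y ys)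
      then show ?case by (cases y) (auto simp: fun_eq_iff Let_def)
    qed simp
    ultimately show "fun_scale (Poly_Mapping.lookup p w) (foldr ope (letters w) f) = 0"
      by (simp add: xs sm_zero_right)
  qed
  ultimately have "f = 0" by simp
  then have "f (v, 0) = 0" by simp
  then show False by (simp add: f_def)
qed

end

section \<open>The correspondence\<close>

text \<open>Both algebras are compared with \<open>C\<close>, the one in which directness is known.
  It is pulled back along both maps.\<close>

lemma graded_isomorphicI:
  assumes \<phi>: "grading_preserving_iso A G C G'' \<phi>" and \<psi>: "grading_preserving_iso B G' C G'' \<psi>"
    and closed: "closed_algebra A" "closed_algebra B" "closed_algebra C"
    and grading: "algebra_grading C G''"
  shows "graded_isomorphic A G B G'"
proof -
  have "grading_preserving_iso A G B G' (the_inv_into (carrier B) \<psi> \<circ> \<phi>)"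
    using \<phi> grading_preserving_iso_sym[OF \<psi> closed(2)] by (rule grading_preserving_iso_trans)
  then show ?thesis
    using algebra_grading_transport[OF \<phi> closed(1,3) grading]
      algebra_grading_transport[OF \<psi> closed(2,3) grading]
    unfolding graded_isomorphic_def grading_preserving_iso_def by blast
qed

lemma closed_unital_leavitt: "closed_algebra (unital_leavitt_algebra H)"
  unfolding unital_leavitt_algebra_def unital_leavitt_ideal_def
  using quotient_presentation.closed_algebra_Q[OF quotient_presentation_free]
  by (simp add: quotient_presentation.Q_def[OF quotient_presentation_free])

lemma closed_leavitt: "is_hypergraph H \<Longrightarrow> closed_algebra (hyper_leavitt_algebra H)"
  unfolding hyper_leavitt_algebra_def
  using quotient_presentation.closed_algebra_Q[OF quotient_presentation_free_nonunital]
  by (simp add: quotient_presentation.Q_def[OF quotient_presentation_free_nonunital] leavitt_ideal_eq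
      leavitt_free_algebra_eq)

lemma (in bergman_leavitt) closed_bergman: "closed_algebra (bergman_algebra R F)"
  unfolding bergman_algebra_def bergman_free_algebra_eq bergman_ideal_eq
  using quotient_presentation.closed_algebra_Q[OF quotient_presentation_free]
  by (simp add: quotient_presentation.Q_def[OF quotient_presentation_free])

section \<open>Finite products of the field and their coordinates\<close>

lemma (in abelian_monoid) additive_finsum:
  assumes "finite A" "g \<in> A \<rightarrow> carrier G"
    and "\<And>r s. r \<in> carrier G \<Longrightarrow> s \<in> carrier G \<Longrightarrow> f (r \<oplus> s) = f r + f s" "f \<zero> = 0"
  shows "f (finsum G g A) = (\<Sum>a\<in>A. f (g a) :: 'k::comm_monoid_add)"
  using assms(1,2)
proof (induction A)
  case (insert a A)
  then have "g \<in> A \<rightarrow> carrier G" "g a \<in> carrier G" by auto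
  with insert show ?case by (simp add: assms(3))
qed (simp add: assms(4))

lemma algebra_ring_of_typeD:
  assumes "algebra (ring_of_type_algebra :: 'k::field ring) R"
  shows "cring R" "r \<in> carrier R \<Longrightarrow> c \<odot>\<^bsub>R\<^esub> r \<in> carrier R"
proof -
  interpret algebra "ring_of_type_algebra :: 'k ring" R by (rule assms)
  show "cring R" using assms by (simp add: algebra_def)
  show "r \<in> carrier R \<Longrightarrow> c \<odot>\<^bsub>R\<^esub> r \<in> carrier R"
    by (rule smult_closed) (simp_all add: ring_of_type_algebra_def)
qed

lemma power_algebra_sel:
  "carrier (power_algebra n) = {..<n} \<rightarrow>\<^sub>E UNIV"
  "monoid.mult (power_algebra n) f g = (\<lambda>l\<in>{..<n}. f l * g l)"
  "monoid.one (power_algebra n) = (\<lambda>l\<in>{..<n}. 1)"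
  "ring.zero (power_algebra n) = (\<lambda>l\<in>{..<n}. 0)"
  "ring.add (power_algebra n) f g = (\<lambda>l\<in>{..<n}. f l + g l)"
  "module.smult (power_algebra n) c f = (\<lambda>l\<in>{..<n}. c * f l)"
  by (simp_all add: power_algebra_def)

lemma comm_semisimple_power_algebra: "comm_semisimple (power_algebra n :: ('k::field, nat \<Rightarrow> 'k) module)"
proof -
  let ?R = "power_algebra n :: ('k, nat \<Rightarrow> 'k) module"
  have ext: "f = g" if "f \<in> carrier ?R" "g \<in> carrier ?R" "\<And>l. l < n \<Longrightarrow> f l = g l" for f g
  proof (rule PiE_ext)
    show "f \<in> {..<n} \<rightarrow>\<^sub>E UNIV" "g \<in> {..<n} \<rightarrow>\<^sub>E UNIV" using that by (simp_all add: power_algebra_sel)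
  qed (simp add: that)
  have closed: "f \<oplus>\<^bsub>?R\<^esub> g \<in> carrier ?R" "f \<otimes>\<^bsub>?R\<^esub> g \<in> carrier ?R" "c \<odot>\<^bsub>?R\<^esub> f \<in> carrier ?R"
    "\<zero>\<^bsub>?R\<^esub> \<in> carrier ?R" "\<one>\<^bsub>?R\<^esub> \<in> carrier ?R" for f g c
    by (auto simp: power_algebra_sel)
  have "abelian_group ?R"
  proof (rule abelian_groupI)
    fix f assume f: "f \<in> carrier ?R"
    show "\<exists>g\<in>carrier ?R. g \<oplus>\<^bsub>?R\<^esub> f = \<zero>\<^bsub>?R\<^esub>"
    proof
      show "(- 1) \<odot>\<^bsub>?R\<^esub> f \<in> carrier ?R" by (rule closed)
      show "(- 1) \<odot>\<^bsub>?R\<^esub> f \<oplus>\<^bsub>?R\<^esub> f = \<zero>\<^bsub>?R\<^esub>"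
        by (rule ext[OF closed(1) closed(4)]) (simp add: power_algebra_sel)
    qed
    show "\<zero>\<^bsub>?R\<^esub> \<oplus>\<^bsub>?R\<^esub> f = f" by (rule ext[OF closed(1) f]) (simp add: power_algebra_sel)
  next
    fix f g h :: "nat \<Rightarrow> 'k"
    show "f \<oplus>\<^bsub>?R\<^esub> g \<oplus>\<^bsub>?R\<^esub> h = f \<oplus>\<^bsub>?R\<^esub> (g \<oplus>\<^bsub>?R\<^esub> h)"
      by (rule ext[OF closed(1) closed(1)]) (simp add: power_algebra_sel)
    show "f \<oplus>\<^bsub>?R\<^esub> g = g \<oplus>\<^bsub>?R\<^esub> f"
      by (rule ext[OF closed(1) closed(1)]) (simp add: power_algebra_sel)
  qed (simp_all add: closed)
  moreover have "Group.comm_monoid ?R"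
  proof (rule comm_monoidI)
    fix f assume f: "f \<in> carrier ?R"
    show "\<one>\<^bsub>?R\<^esub> \<otimes>\<^bsub>?R\<^esub> f = f" by (rule ext[OF closed(2) f]) (simp add: power_algebra_sel)
  next
    fix f g h :: "nat \<Rightarrow> 'k"
    show "f \<otimes>\<^bsub>?R\<^esub> g \<otimes>\<^bsub>?R\<^esub> h = f \<otimes>\<^bsub>?R\<^esub> (g \<otimes>\<^bsub>?R\<^esub> h)"
      by (rule ext[OF closed(2) closed(2)]) (simp add: power_algebra_sel)
    show "f \<otimes>\<^bsub>?R\<^esub> g = g \<otimes>\<^bsub>?R\<^esub> f"
      by (rule ext[OF closed(2) closed(2)]) (simp add: power_algebra_sel)
  qed (simp_all add: closed)
  moreover have "(f \<oplus>\<^bsub>?R\<^esub> g) \<otimes>\<^bsub>?R\<^esub> h = f \<otimes>\<^bsub>?R\<^esub> h \<oplus>\<^bsub>?R\<^esub> g \<otimes>\<^bsub>?R\<^esub> h" for f g h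
    by (rule ext[OF closed(2) closed(1)]) (simp add: power_algebra_sel algebra_simps)
  ultimately have cring: "cring ?R"
    by (intro cringI)
  have "algebra (ring_of_type_algebra :: 'k ring) ?R"
  proof (intro algebra.intro cring algebra_axioms.intro
      module.intro cring_from_type_algebra \<open>abelian_group ?R\<close> module_axioms.intro)
    fix a b and f g :: "nat \<Rightarrow> 'k" assume f: "f \<in> carrier ?R"
    show "a \<odot>\<^bsub>?R\<^esub> f \<in> carrier ?R" by (rule closed)
    show "(a \<oplus>\<^bsub>ring_of_type_algebra\<^esub> b) \<odot>\<^bsub>?R\<^esub> f = a \<odot>\<^bsub>?R\<^esub> f \<oplus>\<^bsub>?R\<^esub> b \<odot>\<^bsub>?R\<^esub> f"
      by (rule ext[OF closed(3) closed(1)])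
        (simp add: power_algebra_sel ring_of_type_algebra_def algebra_simps)
    show "a \<odot>\<^bsub>?R\<^esub> (f \<oplus>\<^bsub>?R\<^esub> g) = a \<odot>\<^bsub>?R\<^esub> f \<oplus>\<^bsub>?R\<^esub> a \<odot>\<^bsub>?R\<^esub> g"
      by (rule ext[OF closed(3) closed(1)]) (simp add: power_algebra_sel algebra_simps)
    show "(a \<otimes>\<^bsub>ring_of_type_algebra\<^esub> b) \<odot>\<^bsub>?R\<^esub> f = a \<odot>\<^bsub>?R\<^esub> (b \<odot>\<^bsub>?R\<^esub> f)"
      by (rule ext[OF closed(3) closed(3)])
        (simp add: power_algebra_sel ring_of_type_algebra_def algebra_simps)
    show "\<one>\<^bsub>ring_of_type_algebra\<^esub> \<odot>\<^bsub>?R\<^esub> f = f"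
      by (rule ext[OF closed(3) f]) (simp add: power_algebra_sel ring_of_type_algebra_def)
    show "(a \<odot>\<^bsub>?R\<^esub> f) \<otimes>\<^bsub>?R\<^esub> g = a \<odot>\<^bsub>?R\<^esub> (f \<otimes>\<^bsub>?R\<^esub> g)"
      by (rule ext[OF closed(2) closed(3)]) (simp add: power_algebra_sel algebra_simps)
  qed
  moreover have "(\<lambda>f. f) \<in> ring_iso ?R ?R" "algebra_iso ?R ?R (\<lambda>f. f)"
    by (auto simp: ring_iso_def ring_hom_def algebra_iso_def bij_betw_def)
  ultimately show ?thesis unfolding comm_semisimple_def by blast
qed

lemma semisimple_coordinates:
  fixes R :: "('k::field, 'r) module"
  assumes "algebra (ring_of_type_algebra :: 'k ring) R"
    and "\<phi> \<in> ring_iso R (power_algebra n)" "algebra_iso R (power_algebra n) \<phi>"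
  shows "r \<in> carrier R \<Longrightarrow> s \<in> carrier R \<Longrightarrow> r \<oplus>\<^bsub>R\<^esub> s \<in> carrier R"
    and "r \<in> carrier R \<Longrightarrow> s \<in> carrier R \<Longrightarrow> r \<otimes>\<^bsub>R\<^esub> s \<in> carrier R"
    and "r \<in> carrier R \<Longrightarrow> c \<odot>\<^bsub>R\<^esub> r \<in> carrier R"
    and "\<zero>\<^bsub>R\<^esub> \<in> carrier R" and "\<one>\<^bsub>R\<^esub> \<in> carrier R"
    and "l < n \<Longrightarrow> r \<in> carrier R \<Longrightarrow> s \<in> carrier R \<Longrightarrow> \<phi> (r \<oplus>\<^bsub>R\<^esub> s) l = \<phi> r l + \<phi> s l"
    and "l < n \<Longrightarrow> r \<in> carrier R \<Longrightarrow> s \<in> carrier R \<Longrightarrow> \<phi> (r \<otimes>\<^bsub>R\<^esub> s) l = \<phi> r l * \<phi> s l"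
    and "l < n \<Longrightarrow> r \<in> carrier R \<Longrightarrow> \<phi> (c \<odot>\<^bsub>R\<^esub> r) l = c * \<phi> r l"
    and "l < n \<Longrightarrow> \<phi> \<zero>\<^bsub>R\<^esub> l = 0" and "l < n \<Longrightarrow> \<phi> \<one>\<^bsub>R\<^esub> l = 1"
    and "r \<in> carrier R \<Longrightarrow> s \<in> carrier R \<Longrightarrow> (\<And>l. l < n \<Longrightarrow> \<phi> r l = \<phi> s l) \<Longrightarrow> r = s"
    and "\<exists>r\<in>carrier R. \<forall>l<n. \<phi> r l = g l"
proof -
  interpret cring R by (rule algebra_ring_of_typeD(1)[OF assms(1)])
  have bij: "bij_betw \<phi> (carrier R) ({..<n} \<rightarrow>\<^sub>E UNIV)"
    using assms(3) by (simp add: algebra_iso_def power_algebra_sel)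
  show "r \<in> carrier R \<Longrightarrow> s \<in> carrier R \<Longrightarrow> r \<oplus>\<^bsub>R\<^esub> s \<in> carrier R"
    "r \<in> carrier R \<Longrightarrow> s \<in> carrier R \<Longrightarrow> r \<otimes>\<^bsub>R\<^esub> s \<in> carrier R"
    "\<zero>\<^bsub>R\<^esub> \<in> carrier R" "\<one>\<^bsub>R\<^esub> \<in> carrier R"
    by simp_all
  show "r \<in> carrier R \<Longrightarrow> c \<odot>\<^bsub>R\<^esub> r \<in> carrier R"
    by (rule algebra_ring_of_typeD(2)[OF assms(1)])
  have add: "\<phi> (r \<oplus>\<^bsub>R\<^esub> s) l = \<phi> r l + \<phi> s l" if "l < n" "r \<in> carrier R" "s \<in> carrier R" for l r s
    using assms(3) that by (simp add: algebra_iso_def power_algebra_sel)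
  then show "l < n \<Longrightarrow> r \<in> carrier R \<Longrightarrow> s \<in> carrier R \<Longrightarrow> \<phi> (r \<oplus>\<^bsub>R\<^esub> s) l = \<phi> r l + \<phi> s l" .
  show "l < n \<Longrightarrow> r \<in> carrier R \<Longrightarrow> s \<in> carrier R \<Longrightarrow> \<phi> (r \<otimes>\<^bsub>R\<^esub> s) l = \<phi> r l * \<phi> s l"
    using assms(3) by (simp add: algebra_iso_def power_algebra_sel)
  show "l < n \<Longrightarrow> r \<in> carrier R \<Longrightarrow> \<phi> (c \<odot>\<^bsub>R\<^esub> r) l = c * \<phi> r l"
    using assms(3) by (simp add: algebra_iso_def power_algebra_sel)
  show "\<phi> \<zero>\<^bsub>R\<^esub> l = 0" if "l < n"
  proof -
    \<comment> \<open>\<open>algebra_iso\<close> does not mention zero; its preservation comes from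
      additivity and cancellation in the field.\<close>
    have "\<phi> \<zero>\<^bsub>R\<^esub> l + \<phi> \<zero>\<^bsub>R\<^esub> l = \<phi> \<zero>\<^bsub>R\<^esub> l + 0"
      using add[OF that zero_closed zero_closed] by (simp only: l_zero zero_closed add_0_right)
    then show ?thesis by (rule add_left_imp_eq)
  qed
  have "\<phi> \<one>\<^bsub>R\<^esub> = \<one>\<^bsub>power_algebra n\<^esub>"
    using assms(2) by (simp add: ring_iso_def ring_hom_def)
  then show "l < n \<Longrightarrow> \<phi> \<one>\<^bsub>R\<^esub> l = 1"
    by (simp add: power_algebra_sel)
  show "r = s" if rs: "r \<in> carrier R" "s \<in> carrier R" and eq: "\<And>l. l < n \<Longrightarrow> \<phi> r l = \<phi> s l"
  proof -
    have "\<phi> r \<in> {..<n} \<rightarrow>\<^sub>E UNIV" "\<phi> s \<in> {..<n} \<rightarrow>\<^sub>E UNIV"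
      using bij rs by (auto dest: bij_betwE)
    then have "\<phi> r = \<phi> s" by (rule PiE_ext) (simp add: eq)
    then show ?thesis using bij rs by (auto simp: bij_betw_def dest: inj_onD)
  qed
  show "\<exists>r\<in>carrier R. \<forall>l<n. \<phi> r l = g l"
  proof -
    have "restrict g {..<n} \<in> \<phi> ` carrier R"
      using bij by (simp add: bij_betw_def)
    then obtain r where "r \<in> carrier R" "\<phi> r = restrict g {..<n}" by force
    then show ?thesis by (intro bexI[of _ r]) simp_all
  qed
qed

text \<open>The outcome of \<open>idempotent_factorization\<close> as a predicate, so that its four
  witnesses can be chosen uniformly in the index \<open>u\<close> and the coordinate.\<close>

definition factorization ::
  "nat \<Rightarrow> (nat \<Rightarrow> 'g) \<Rightarrow> (nat \<Rightarrow> nat \<Rightarrow> 'k::field) \<Rightarrow> nat \<Rightarrow> (nat \<Rightarrow> nat \<Rightarrow> 'k) \<Rightarrow> (nat \<Rightarrow> nat \<Rightarrow> 'k) \<Rightarrow>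
   (nat \<Rightarrow> 'g) \<Rightarrow> bool" where
  "factorization n \<alpha> x r p q \<delta> \<longleftrightarrow> (\<forall>i<n. \<forall>j<n. x i j = (\<Sum>a<r. p i a * q a j)) \<and>
    (\<forall>a<r. \<forall>b<r. (\<Sum>i<n. q a i * p i b) = (if a = b then 1 else 0)) \<and>
    (\<forall>i<n. \<forall>a<r. (p i a \<noteq> 0 \<longrightarrow> \<alpha> i = \<delta> a) \<and> (q a i \<noteq> 0 \<longrightarrow> \<alpha> i = \<delta> a))"

text \<open>A coordinate is a ring homomorphism to the field, so it preserves idempotence. As
  \<open>R\<close> lives in degree zero, an entry between rows of different degree is zero, which is
  the homogeneity required over the field.\<close>

lemma homogeneous_idempotent_factorization:
  fixes R :: "('k::field, 'r) module" and \<alpha> :: "nat \<Rightarrow> 'g::ab_group_add"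
  assumes R: "algebra (ring_of_type_algebra :: 'k ring) R"
    and \<phi>: "\<phi> \<in> ring_iso R (power_algebra n)" "algebra_iso R (power_algebra n) \<phi>"
    and x: "homogeneous_idempotent R (concentrated_in_zero R) m \<alpha> x"
  shows "i < m \<Longrightarrow> j < m \<Longrightarrow> x i j \<in> carrier R"
    and "l < n \<Longrightarrow> \<exists>r p q \<delta>. factorization m \<alpha> (\<lambda>i j. \<phi> (x i j) l) r p q \<delta>"
proof -
  interpret cring R by (rule algebra_ring_of_typeD(1)[OF R])
  note coord = semisimple_coordinates[OF R \<phi>]
  have x_mem: "x i j \<in> concentrated_in_zero R (\<alpha> j - \<alpha> i)" if "i < m" "j < m" for i j
    using x that by (simp add: homogeneous_idempotent_def)
  then have x_closed: "x i j \<in> carrier R" if "i < m" "j < m" for i j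
    using that by (fastforce simp: concentrated_in_zero_def split: if_splits)
  then show "i < m \<Longrightarrow> j < m \<Longrightarrow> x i j \<in> carrier R" .
  assume l: "l < n"
  show "\<exists>r p q \<delta>. factorization m \<alpha> (\<lambda>i j. \<phi> (x i j) l) r p q \<delta>"
    unfolding factorization_def
  proof (rule idempotent_factorization)
    fix i j assume ij: "i < m" "j < m"
    have "(\<Sum>k<m. \<phi> (x i k) l * \<phi> (x k j) l) = (\<Sum>k<m. \<phi> (x i k \<otimes>\<^bsub>R\<^esub> x k j) l)"
      using ij l by (intro sum.cong refl) (simp add: coord x_closed)
    also have "\<dots> = \<phi> (\<Oplus>\<^bsub>R\<^esub>k\<in>{..<m}. x i k \<otimes>\<^bsub>R\<^esub> x k j) l"
      using ij l by (intro additive_finsum[symmetric, of _ _ "\<lambda>r. \<phi> r l"]) (auto simp: coord x_closed)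
    also have "\<dots> = \<phi> (x i j) l"
      using x ij by (simp add: homogeneous_idempotent_def)
    finally show "(\<Sum>k<m. \<phi> (x i k) l * \<phi> (x k j) l) = \<phi> (x i j) l" .
    assume "\<phi> (x i j) l \<noteq> 0"
    then have "x i j \<noteq> \<zero>\<^bsub>R\<^esub>" using l by (auto simp: coord)
    then show "\<alpha> i = \<alpha> j"
      using x_mem[OF ij] by (auto simp: concentrated_in_zero_def split: if_splits)
  qed
qed

text \<open>The dual bases of all coordinates are joined into one index set of pairs, whose leading
  component is the vertex. Pairs are coded as numbers because the hypergraph to be built has indices
  of type \<open>nat\<close>.\<close>

lemma prod_code_index:
  fixes p :: "nat \<Rightarrow> nat \<Rightarrow> nat \<Rightarrow> 'k::field" and r :: "nat \<Rightarrow> nat" and n :: nat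
  defines "I \<equiv> prod_encode ` (SIGMA l:{..<n}. {..<r l})"
  assumes fact: "\<And>l. l < n \<Longrightarrow> factorization m \<alpha> (\<lambda>i j. x i j l) (r l) (p l) (q l) (\<delta> l)"
  shows "finite I"
    and "a \<in> I \<Longrightarrow> fst (prod_decode a) < n"
    and "v < n \<Longrightarrow> i < m \<Longrightarrow> j < m \<Longrightarrow> x i j v = (\<Sum>a\<in>{a \<in> I. fst (prod_decode a) = v}.
        p (fst (prod_decode a)) i (snd (prod_decode a)) * q (fst (prod_decode a)) (snd (prod_decode a)) j)"
    and "a \<in> I \<Longrightarrow> b \<in> I \<Longrightarrow> fst (prod_decode a) = fst (prod_decode b) \<Longrightarrow>
      (\<Sum>i<m. q (fst (prod_decode a)) (snd (prod_decode a)) i * p (fst (prod_decode b)) i (snd (prod_decode b))) =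
      (if a = b then 1 else 0)"
    and "a \<in> I \<Longrightarrow> i < m \<Longrightarrow> p (fst (prod_decode a)) i (snd (prod_decode a)) \<noteq> 0 \<or>
      q (fst (prod_decode a)) (snd (prod_decode a)) i \<noteq> 0 \<Longrightarrow>
      \<alpha> i = \<delta> (fst (prod_decode a)) (snd (prod_decode a))"
proof -
  have decode: "fst (prod_decode a) < n \<and> snd (prod_decode a) < r (fst (prod_decode a))" if "a \<in> I" for a
    using that by (auto simp: I_def)
  then show "a \<in> I \<Longrightarrow> fst (prod_decode a) < n" by blast
  show "finite I" unfolding I_def by auto
  show "x i j v = (\<Sum>a\<in>{a \<in> I. fst (prod_decode a) = v}.
        p (fst (prod_decode a)) i (snd (prod_decode a)) * q (fst (prod_decode a)) (snd (prod_decode a)) j)"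
    if v: "v < n" and ij: "i < m" "j < m"
  proof -
    have "x i j v = (\<Sum>a<r v. p v i a * q v a j)"
      using fact[OF v] ij by (simp add: factorization_def)
    also have "\<dots> = (\<Sum>a\<in>{a \<in> I. fst (prod_decode a) = v}.
        p (fst (prod_decode a)) i (snd (prod_decode a)) * q (fst (prod_decode a)) (snd (prod_decode a)) j)"
      by (rule sum.reindex_bij_witness[where i = "\<lambda>a. snd (prod_decode a)" and j = "\<lambda>a. prod_encode (v, a)"])
        (use v in \<open>auto simp: I_def\<close>)
    finally show ?thesis .
  qed
  show "(\<Sum>i<m. q (fst (prod_decode a)) (snd (prod_decode a)) i * p (fst (prod_decode b)) i (snd (prod_decode b))) =
      (if a = b then 1 else 0)"
    if ab: "a \<in> I" "b \<in> I" "fst (prod_decode a) = fst (prod_decode b)"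
  proof -
    have "a = b \<longleftrightarrow> snd (prod_decode a) = snd (prod_decode b)"
      using ab(3) by (metis prod_decode_inverse prod_eqI)
    then show ?thesis
      using fact decode[OF ab(1)] decode[OF ab(2)] ab(3) by (simp add: factorization_def)
  qed
  show "\<alpha> i = \<delta> (fst (prod_decode a)) (snd (prod_decode a))"
    if "a \<in> I" "i < m" "p (fst (prod_decode a)) i (snd (prod_decode a)) \<noteq> 0 \<or>
      q (fst (prod_decode a)) (snd (prod_decode a)) i \<noteq> 0"
    using fact decode[OF that(1)] that(2,3) unfolding factorization_def by blast
qed

lemma bergman_is_leavitt:
  fixes R :: "('k::field, 'r) module" and F :: "('g::ab_group_add, 'u, 'r) idempotent_pairs"
  assumes R: "comm_semisimple R" and F: "homogeneous_idempotent_pairs R (concentrated_in_zero R) F"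
  shows "\<exists>(H :: (nat, 'u, nat, nat) hypergraph) i0 j0 w.
    is_hypergraph H \<and> weight_map H i0 j0 w \<and> unital (hyper_leavitt_algebra H :: ('k, _) module) \<and>
    graded_isomorphic (bergman_algebra R F) (bergman_grading R (concentrated_in_zero R) F)
      (hyper_leavitt_algebra H) (leavitt_grading H w)"
proof -
  obtain n \<phi> where R: "algebra (ring_of_type_algebra :: 'k ring) R"
    and \<phi>: "\<phi> \<in> ring_iso R (power_algebra n)" "algebra_iso R (power_algebra n) \<phi>"
    using R unfolding comm_semisimple_def by blast
  note coord = semisimple_coordinates[OF R \<phi>]
  have e: "homogeneous_idempotent R (concentrated_in_zero R) (rows F u) (row_deg F u) (emat F u)"
    and f: "homogeneous_idempotent R (concentrated_in_zero R) (cols F u) (col_deg F u) (fmat F u)"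
    if "u \<in> index F" for u
    using F that by (auto simp: homogeneous_idempotent_pairs_def)
  have "\<forall>u l. \<exists>r p q \<delta>. u \<in> index F \<longrightarrow> l < n \<longrightarrow>
      factorization (rows F u) (row_deg F u) (\<lambda>i j. \<phi> (emat F u i j) l) r p q \<delta>"
    using homogeneous_idempotent_factorization(2)[OF R \<phi> e] by blast
  then obtain r p q \<delta> where e_fact: "\<And>u l. u \<in> index F \<Longrightarrow> l < n \<Longrightarrow> factorization (rows F u) (row_deg F u)
      (\<lambda>i j. \<phi> (emat F u i j) l) (r u l) (p u l) (q u l) (\<delta> u l)"
    by metis
  have "\<forall>u l. \<exists>r p q \<delta>. u \<in> index F \<longrightarrow> l < n \<longrightarrow>
      factorization (cols F u) (col_deg F u) (\<lambda>i j. \<phi> (fmat F u i j) l) r p q \<delta>"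
    using homogeneous_idempotent_factorization(2)[OF R \<phi> f] by blast
  then obtain r' p' q' \<delta>' where f_fact: "\<And>u l. u \<in> index F \<Longrightarrow> l < n \<Longrightarrow> factorization (cols F u) (col_deg F u)
      (\<lambda>i j. \<phi> (fmat F u i j) l) (r' u l) (p' u l) (q' u l) (\<delta>' u l)"
    by metis
  define l where "l a = fst (prod_decode a)" for a
  define k where "k a = snd (prod_decode a)" for a
  \<comment> \<open>Not yet a proper hypergraph: the index set belonging to a zero matrix is
    empty.\<close>
  define H0 :: "(nat, 'u, nat, nat) hypergraph" where
    "H0 = \<lparr>vertices = {..<n}, hyperedges = index F,
      src_index = (\<lambda>u. prod_encode ` (SIGMA l:{..<n}. {..<r u l})),
      rng_index = (\<lambda>u. prod_encode ` (SIGMA l:{..<n}. {..<r' u l})),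
      src = (\<lambda>u. l), rng = (\<lambda>u. l)\<rparr>"
  \<comment> \<open>Being a difference of a term in \<open>b\<close> and a term in \<open>a\<close>,
    this satisfies the weight condition for every choice of base indices.\<close>
  define w where "w u a b = \<delta>' u (l b) (k b) - \<delta> u (l a) (k a)" for u a b
  {
    fix u assume u: "u \<in> index F"
    note prod_code_index[where n = n and r = "r u" and p = "p u" and q = "q u" and \<delta> = "\<delta> u",
        OF e_fact[OF u], folded l_def k_def]
  }
  note e_code = this
  {
    fix u assume u: "u \<in> index F"
    note prod_code_index[where n = n and r = "r' u" and p = "p' u" and q = "q' u" and \<delta> = "\<delta>' u",
        OF f_fact[OF u], folded l_def k_def]
  }
  note f_code = this
  interpret bergman_leavitt R "\<lambda>l r. \<phi> r l" F H0 "\<lambda>u i a. p u (l a) i (k a)" "\<lambda>u a i. q u (l a) (k a) i"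
    "\<lambda>u i a. p' u (l a) i (k a)" "\<lambda>u a i. q' u (l a) (k a) i" "\<lambda>u a. \<delta> u (l a) (k a)"
    "\<lambda>u b. \<delta>' u (l b) (k b)" w
  \<comment> \<open>The cases treated by hand are the separation and prescription of coordinates
    (12, 13), the factorizations (21, 22), duality (23, 24) and homogeneity (25, 26).\<close>
  proof (unfold_locales, goal_cases)
    case (12 r s)
    then show ?case using coord(11)[of r s] by (simp add: H0_def)
  next
    case (13 g)
    show ?case using coord(12)[of g] by (simp add: H0_def Ball_def)
  next
    case (21 u i j v)
    then show ?case using e_code(3)[of u] by (simp add: H0_def)
  next
    case (22 u i j v)
    then show ?case using f_code(3)[of u] by (simp add: H0_def)
  next
    case (23 u a a')
    then show ?case using e_code(4)[of u] by (simp add: H0_def)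
  next
    case (24 u b b')
    then show ?case using f_code(4)[of u] by (simp add: H0_def)
  next
    case (25 u a i)
    then show ?case using e_code(5)[of u] by (simp add: H0_def)
  next
    case (26 u b j)
    then show ?case using f_code(5)[of u] by (simp add: H0_def)
  qed (simp_all add: H0_def coord e_code f_code w_def
      homogeneous_idempotent_factorization(1)[OF R \<phi> e] homogeneous_idempotent_factorization(1)[OF R \<phi> f])
  let ?K = "killed TYPE('k) H0"
  define H where "H = discard ?K H0"
  have H0: "finite (vertices H0)" "\<And>h. h \<in> hyperedges H0 \<Longrightarrow> finite (src_index H0 h)"
    "\<And>h. h \<in> hyperedges H0 \<Longrightarrow> finite (rng_index H0 h)"
    "\<And>h i. h \<in> hyperedges H0 \<Longrightarrow> i \<in> src_index H0 h \<Longrightarrow> src H0 h i \<in> vertices H0"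
    "\<And>h j. h \<in> hyperedges H0 \<Longrightarrow> j \<in> rng_index H0 h \<Longrightarrow> rng H0 h j \<in> vertices H0"
    using finite_vertices finite_src finite_rng src_vertex rng_vertex by (simp_all add: hyperedges_eq)
  have H: "is_hypergraph H" unfolding H_def by (rule discard_hypergraph[OF H0])
  have finite: "finite (vertices H)" using H0(1) by (simp add: H_def discard_def)
  define i0 where "i0 u = (SOME i. i \<in> src_index H u)" for u
  define j0 where "j0 u = (SOME j. j \<in> rng_index H u)" for u
  have "weight_map H i0 j0 w"
    unfolding weight_map_def
  proof (intro ballI conjI)
    fix u assume "u \<in> hyperedges H"
    then have "src_index H u \<noteq> {}" "rng_index H u \<noteq> {}" using H by (auto simp: is_hypergraph_def)
    then show "i0 u \<in> src_index H u" "j0 u \<in> rng_index H u"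
      unfolding i0_def j0_def by (simp_all add: some_in_eq)
  qed (simp add: w_def)
  moreover obtain \<psi>1 where \<psi>1: "grading_preserving_iso
      (bergman_algebra R F) (bergman_grading R (concentrated_in_zero R) F)
      (unital_leavitt_algebra H0) (unital_leavitt_grading H0 w) \<psi>1"
    using bergman_iso_leavitt by blast
  moreover obtain \<psi>2 where \<psi>2: "grading_preserving_iso
      (unital_leavitt_algebra H0 :: ('k, _) module) (unital_leavitt_grading H0 w)
      (unital_leavitt_algebra H) (unital_leavitt_grading H w) \<psi>2"
    using discard_iso[OF H0] unfolding H_def by blast
  moreover obtain \<psi>3 where \<psi>3: "grading_preserving_iso
      (hyper_leavitt_algebra H :: ('k, _) module) (leavitt_grading H w)
      (unital_leavitt_algebra H) (unital_leavitt_grading H w) \<psi>3"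
    using leavitt_iso_unital_leavitt[OF H finite] by blast
  ultimately have "graded_isomorphic (bergman_algebra R F) (bergman_grading R (concentrated_in_zero R) F)
      (hyper_leavitt_algebra H) (leavitt_grading H w)"
    by (intro graded_isomorphicI[OF grading_preserving_iso_trans[OF \<psi>1 \<psi>2] \<psi>3]
        closed_bergman closed_leavitt closed_unital_leavitt unital_leavitt_graded H)
  with H finite \<open>weight_map H i0 j0 w\<close> unital_leavitt[OF H finite] show ?thesis by blast
qed

lemma leavitt_is_bergman:
  fixes H :: "('v, 'e, 'i, 'j) hypergraph" and w :: "'e \<Rightarrow> 'i \<Rightarrow> 'j \<Rightarrow> 'g::ab_group_add"
  assumes H: "is_hypergraph H" and w: "weight_map H i0 j0 w"
    and unital: "unital (hyper_leavitt_algebra H :: ('k::field, _) module)"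
  shows "\<exists>(R :: ('k, nat \<Rightarrow> 'k) module) (F :: ('g, 'e, nat \<Rightarrow> 'k) idempotent_pairs).
    comm_semisimple R \<and> homogeneous_idempotent_pairs R (concentrated_in_zero R) F \<and>
    graded_isomorphic (hyper_leavitt_algebra H) (leavitt_grading H w)
      (bergman_algebra R F) (bergman_grading R (concentrated_in_zero R) F)"
proof -
  have finite: "finite (vertices H)" using unital by (rule unital_imp_finite_vertices[OF H])
  define n where "n = card (vertices H)"
  define R :: "('k, nat \<Rightarrow> 'k) module" where "R = power_algebra n"
  obtain \<beta> where \<beta>: "bij_betw \<beta> (vertices H) {..<n}"
    using ex_bij_betw_finite_nat[OF finite] by (auto simp: n_def lessThan_atLeast0)
  have "\<forall>u. \<exists>c. u \<in> hyperedges H \<longrightarrow> bij_betw c {..<card (src_index H u)} (src_index H u)"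
  proof
    fix u show "\<exists>c. u \<in> hyperedges H \<longrightarrow> bij_betw c {..<card (src_index H u)} (src_index H u)"
      using H ex_bij_betw_nat_finite[of "src_index H u"]
      by (auto simp: is_hypergraph_def lessThan_atLeast0)
  qed
  then obtain c where c: "\<And>u. u \<in> hyperedges H \<Longrightarrow> bij_betw (c u) {..<card (src_index H u)} (src_index H u)"
    by metis
  have "\<forall>u. \<exists>c. u \<in> hyperedges H \<longrightarrow> bij_betw c {..<card (rng_index H u)} (rng_index H u)"
  proof
    fix u show "\<exists>c. u \<in> hyperedges H \<longrightarrow> bij_betw c {..<card (rng_index H u)} (rng_index H u)"
      using H ex_bij_betw_nat_finite[of "rng_index H u"]
      by (auto simp: is_hypergraph_def lessThan_atLeast0)
  qed
  then obtain d where d: "\<And>u. u \<in> hyperedges H \<Longrightarrow> bij_betw (d u) {..<card (rng_index H u)} (rng_index H u)"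
    by metis
  \<comment> \<open>The diagonal matrix carrying at place \<open>i\<close> the primitive idempotent
    of the vertex \<open>g i\<close>.\<close>
  define unit_matrix :: "(nat \<Rightarrow> 'v) \<Rightarrow> nat \<Rightarrow> nat \<Rightarrow> nat \<Rightarrow> 'k" where
    "unit_matrix g i j = (\<lambda>l\<in>{..<n}. if i = j \<and> \<beta> (g i) = l then 1 else 0)" for g i j
  \<comment> \<open>The weight condition writes \<open>w u a b\<close> as a term in \<open>b\<close>
    plus a term in \<open>a\<close>. These are taken as the column degree and the negative of the
    row degree, so that symbols acquire exactly the weights as degrees.\<close>
  define F :: "('g, 'e, nat \<Rightarrow> 'k) idempotent_pairs" where
    "F = \<lparr>index = hyperedges H, rows = (\<lambda>u. card (src_index H u)), cols = (\<lambda>u. card (rng_index H u)),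
      row_deg = (\<lambda>u i. - w u (c u i) (j0 u)), col_deg = (\<lambda>u j. w u (i0 u) (d u j) - w u (i0 u) (j0 u)),
      emat = (\<lambda>u. unit_matrix (\<lambda>i. src H u (c u i))), fmat = (\<lambda>u. unit_matrix (\<lambda>j. rng H u (d u j)))\<rparr>"
  have R: "comm_semisimple R" unfolding R_def by (rule comm_semisimple_power_algebra)
  then have alg: "algebra (ring_of_type_algebra :: 'k ring) R" by (simp add: comm_semisimple_def)
  have id: "(\<lambda>f. f) \<in> ring_iso R (power_algebra n)" "algebra_iso R (power_algebra n) (\<lambda>f. f)"
    by (auto simp: R_def ring_iso_def ring_hom_def algebra_iso_def bij_betw_def)
  note coord = semisimple_coordinates[OF alg id]
  interpret R: cring R by (rule algebra_ring_of_typeD(1)[OF alg])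
  have unit_closed: "unit_matrix g i j \<in> carrier R" for g i j
    by (simp add: unit_matrix_def R_def power_algebra_sel)
  have unit_idempotent: "homogeneous_idempotent R (concentrated_in_zero R) m \<alpha> (unit_matrix g)"
    for m and \<alpha> :: "nat \<Rightarrow> 'g" and g
    unfolding homogeneous_idempotent_def
  proof (intro conjI allI impI)
    fix i j assume ij: "i < m" "j < m"
    have "unit_matrix g i j = \<zero>\<^bsub>R\<^esub>" if "i \<noteq> j"
      using that by (simp add: unit_matrix_def R_def power_algebra_sel)
    then show "unit_matrix g i j \<in> concentrated_in_zero R (\<alpha> j - \<alpha> i)"
      by (auto simp: concentrated_in_zero_def unit_closed)
    show "(\<Oplus>\<^bsub>R\<^esub>k\<in>{..<m}. unit_matrix g i k \<otimes>\<^bsub>R\<^esub> unit_matrix g k j) = unit_matrix g i j"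
    proof (rule coord(11))
      show "(\<Oplus>\<^bsub>R\<^esub>k\<in>{..<m}. unit_matrix g i k \<otimes>\<^bsub>R\<^esub> unit_matrix g k j) \<in> carrier R"
        by (rule R.finsum_closed) (auto simp: unit_closed)
      fix l assume l: "l < n"
      have "(\<Oplus>\<^bsub>R\<^esub>k\<in>{..<m}. unit_matrix g i k \<otimes>\<^bsub>R\<^esub> unit_matrix g k j) l =
        (\<Sum>k<m. (unit_matrix g i k \<otimes>\<^bsub>R\<^esub> unit_matrix g k j) l)"
        using l by (intro R.additive_finsum[of _ _ "\<lambda>f. f l"]) (auto simp: coord unit_closed)
      also have "\<dots> = (\<Sum>k<m. unit_matrix g i k l * unit_matrix g k j l)"
        using l by (simp add: coord unit_closed)
      also have "\<dots> = (\<Sum>k<m. if i = k then unit_matrix g i j l else 0)"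
        using l by (intro sum.cong refl) (auto simp: unit_matrix_def)
      also have "\<dots> = unit_matrix g i j l" using ij by simp
      finally show "(\<Oplus>\<^bsub>R\<^esub>k\<in>{..<m}. unit_matrix g i k \<otimes>\<^bsub>R\<^esub> unit_matrix g k j) l = unit_matrix g i j l" .
    qed (rule unit_closed)
  qed
  have F: "homogeneous_idempotent_pairs R (concentrated_in_zero R) F"
    using H unit_idempotent
    by (auto simp: homogeneous_idempotent_pairs_def F_def is_hypergraph_def card_gt_0_iff)
  have unit_sum: "unit_matrix (\<lambda>i. \<sigma> (g i)) i j (\<beta> v) = (\<Sum>a\<in>{a \<in> A. \<sigma> a = v}.
      (if g i = a then 1 else 0) * (if g j = a then 1 else 0))"
    if g: "bij_betw g {..<card A} A" and ij: "i < card A" "j < card A" and v: "v \<in> vertices H"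
      and \<sigma>: "\<And>a. a \<in> A \<Longrightarrow> \<sigma> a \<in> vertices H" and A: "finite A" for g \<sigma> i j v and A :: "'a set"
  proof -
    have gA: "g i \<in> A" "g j \<in> A" "g i = g j \<longleftrightarrow> i = j"
      using g ij by (auto simp: bij_betw_def inj_on_eq_iff)
    have "(\<Sum>a\<in>{a \<in> A. \<sigma> a = v}. (if g i = a then 1 else 0) * (if g j = a then 1 else 0 :: 'k)) =
      (\<Sum>a\<in>{a \<in> A. \<sigma> a = v}. if a = g i then (if i = j then 1 else 0) else 0)"
      using gA(3) by (intro sum.cong refl) auto
    also have "\<dots> = (if \<sigma> (g i) = v \<and> i = j then 1 else 0)"
      using A gA(1) by (cases "i = j") simp_all
    also have "\<dots> = unit_matrix (\<lambda>i. \<sigma> (g i)) i j (\<beta> v)"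
      using \<beta> v \<sigma>[OF gA(1)] by (auto simp: unit_matrix_def bij_betw_def inj_on_eq_iff)
    finally show ?thesis ..
  qed
  have unit_dual: "(\<Sum>i<card A. (if g i = a then 1 else 0) * (if g i = b then 1 else 0 :: 'k)) =
      (if a = b then 1 else 0)"
    if g: "bij_betw g {..<card A} A" and ab: "a \<in> A" "b \<in> A" for g a b and A :: "'a set"
  proof -
    have "a \<in> g ` {..<card A}" using g ab(1) by (simp add: bij_betw_def)
    then obtain i where i: "i < card A" "g i = a" by auto
    have "(\<Sum>i<card A. (if g i = a then 1 else 0) * (if g i = b then 1 else 0 :: 'k)) =
      (\<Sum>k<card A. if k = i then (if a = b then 1 else 0) else 0)"
      using g i by (intro sum.cong refl) (auto simp: bij_betw_def inj_on_eq_iff)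
    then show ?thesis using i by simp
  qed
  have weight: "w u a b = w u (i0 u) b - w u (i0 u) (j0 u) - - w u a (j0 u)"
    if "u \<in> hyperedges H" "a \<in> src_index H u" "b \<in> rng_index H u" for u a b
  proof -
    have "w u a b = w u a (j0 u) - w u (i0 u) (j0 u) + w u (i0 u) b"
      using w that unfolding weight_map_def by blast
    then show ?thesis by (simp add: algebra_simps)
  qed
  have \<beta>_less: "\<beta> v < n" if "v \<in> vertices H" for v
    using \<beta> that by (auto dest: bij_betwE)
  \<comment> \<open>The matrices are already diagonal, so all four factors are permutation matrices
    of the enumerations \<open>c u\<close> and \<open>d u\<close>.\<close>
  interpret bergman_leavitt R "\<lambda>v f. f (\<beta> v)" F H "\<lambda>u i a. if c u i = a then 1 else 0"
    "\<lambda>u a i. if c u i = a then 1 else 0" "\<lambda>u j b. if d u j = b then 1 else 0"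
    "\<lambda>u b j. if d u j = b then 1 else 0" "\<lambda>u a. - w u a (j0 u)"
    "\<lambda>u b. w u (i0 u) b - w u (i0 u) (j0 u)" w
  proof (unfold_locales, goal_cases)
    case (12 r s)
    then show ?case
    proof (intro coord(11))
      fix l assume "l < n"
      then obtain v where "v \<in> vertices H" "l = \<beta> v" using \<beta> by (auto simp: bij_betw_def)
      then show "r l = s l" using 12(3) by simp
    qed
  next
    case (13 g)
    obtain r where r: "r \<in> carrier R" "\<And>l. l < n \<Longrightarrow> r l = g (the_inv_into (vertices H) \<beta> l)"
      using coord(12)[of "\<lambda>l. g (the_inv_into (vertices H) \<beta> l)"] by blast
    have "r (\<beta> v) = g v" if "v \<in> vertices H" for v
      using \<beta> that r(2)[OF \<beta>_less[OF that]] by (simp add: bij_betw_def the_inv_into_f_f)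
    then show ?case using r(1) by blast
  next
    case (21 u i j v)
    then show ?case
      using unit_sum[of "c u" "src_index H u" i j v "src H u"] c H
      by (simp add: F_def is_hypergraph_def)
  next
    case (22 u i j v)
    then show ?case
      using unit_sum[of "d u" "rng_index H u" i j v "rng H u"] d H
      by (simp add: F_def is_hypergraph_def)
  next
    case (23 u a a')
    then show ?case using unit_dual[of "c u" "src_index H u" a a'] c by (simp add: F_def)
  next
    case (24 u b b')
    then show ?case using unit_dual[of "d u" "rng_index H u" b b'] d by (simp add: F_def)
  next
    case (25 u a i)
    then show ?case by (auto simp: F_def split: if_splits)
  next
    case (26 u b j)
    then show ?case by (auto simp: F_def split: if_splits)
  next
    case (27 u a b)
    then show ?case by (simp add: F_def weight)
  qed (use H finite in \<open>simp_all add: F_def coord \<beta>_less is_hypergraph_def unit_closed\<close>)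
  obtain \<psi>1 where \<psi>1: "grading_preserving_iso
      (bergman_algebra R F) (bergman_grading R (concentrated_in_zero R) F)
      (unital_leavitt_algebra H) (unital_leavitt_grading H w) \<psi>1"
    using bergman_iso_leavitt by blast
  obtain \<psi>2 where \<psi>2: "grading_preserving_iso
      (hyper_leavitt_algebra H :: ('k, _) module) (leavitt_grading H w)
      (unital_leavitt_algebra H) (unital_leavitt_grading H w) \<psi>2"
    using leavitt_iso_unital_leavitt[OF H finite] by blast
  have "graded_isomorphic (hyper_leavitt_algebra H) (leavitt_grading H w)
      (bergman_algebra R F) (bergman_grading R (concentrated_in_zero R) F)"
    using w by (intro graded_isomorphicI[OF \<psi>2 \<psi>1] closed_bergman closed_leavitt closed_unital_leavitt
        unital_leavitt_graded H)
  with R F show ?thesis by blast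
qed

theorem theorem4p10:
  shows
   "(\<forall>(R :: ('k::field, 'r) module) (F :: ('g::ab_group_add, 'u, 'r) idempotent_pairs).
       comm_semisimple R \<and>
       homogeneous_idempotent_pairs R (concentrated_in_zero R) F \<longrightarrow>
       (\<exists>(H :: (nat, 'u, nat, nat) hypergraph) i0 j0 w.
          is_hypergraph H \<and> weight_map H i0 j0 w \<and>
          unital (hyper_leavitt_algebra H :: ('k, _) module) \<and>
          graded_isomorphic
            (bergman_algebra R F) (bergman_grading R (concentrated_in_zero R) F)
            (hyper_leavitt_algebra H) (leavitt_grading H w))) \<and>
    (\<forall>(H :: ('v, 'e, 'i, 'j) hypergraph) i0 j0 (w :: 'e \<Rightarrow> 'i \<Rightarrow> 'j \<Rightarrow> 'g).
       is_hypergraph H \<and> weight_map H i0 j0 w \<and>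
       unital (hyper_leavitt_algebra H :: ('k, _) module) \<longrightarrow>
       (\<exists>(R :: ('k, nat \<Rightarrow> 'k) module) (F :: ('g, 'e, nat \<Rightarrow> 'k) idempotent_pairs).
          comm_semisimple R \<and>
          homogeneous_idempotent_pairs R (concentrated_in_zero R) F \<and>
          graded_isomorphic
            (hyper_leavitt_algebra H) (leavitt_grading H w)
            (bergman_algebra R F) (bergman_grading R (concentrated_in_zero R) F)))"
  by (intro conjI allI impI; elim conjE) (rule bergman_is_leavitt leavitt_is_bergman; assumption)+

end
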